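(* In the setting described in the context, let $M,N\in\mathbb{N}$. Then $$\frac{1}{M^{1/4}}\left[\int_0^{\max\left\{0,\frac{T(N+1)^2}{2M}-\left[1+\frac{\sqrt T}{\sqrt{2M}}\right]^2\right\}}\frac{\sqrt T\,\big[1-e^{-\nu\pi^2T}\big]\big[1-\exp(-\nu\pi^2\min\{1,\tfrac{TN^2}{2M}\})\big]^2}{32\nu\pi^2\sqrt2\,(x+[1+\sqrt T]^2)^{3/2}}\,dx\right]^{1/2}+\frac1{N^{1/2}}\left[\frac{\sqrt{1-e^{-\nu T}}}{4\pi\sqrt\nu}\right]$$ $$\le\|O_T-\mathcal{O}^{M,N}_T\|_{\mathcal{L}^2(\mathbb{P};H)}\le\sup_{t\in[0,T]}\|O_t-\mathcal{O}^{M,N}_t\|_{\mathcal{L}^2(\mathbb{P};H)}$$ $$\le\frac1{M^{1/4}}\left[\frac{\sqrt T}{2}\left(\frac1{\pi\sqrt\nu}+\frac1{\nu\pi^2}+4\pi\sqrt\nu\right)\right]^{1/2}+\frac1{N^{1/2}}\left[\frac1{\pi\sqrt{2\nu}}\right].$$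
   Context: Notation: for $h\in(0,\infty)$, $t\in\mathbb{R}$, $\lfloor t\rfloor_h=\max(\{0,h,-h,2h,-2h,\ldots\}\cap(-\infty,t])$; $\|Z\|_{\mathcal{L}^2(\mathbb{P};H)}=(\mathbb{E}[\|Z\|_H^2])^{1/2}$. Setting: Let $T,\nu\in(0,\infty)$, $H=L^2((0,1);\mathbb{R})$ with its usual inner product and norm, let $e_m\in H$, $m\in\mathbb{N}$, be (the equivalence class of) $x\mapsto\sqrt2\sin(m\pi x)$, and for $n\in\mathbb{N}$ let $P_n\in L(H)$ be given by $P_n(v)=\sum_{k=1}^n\langle e_k,v\rangle_He_k$. Let $A\colon D(A)\subseteq H\to H$ be the Laplacian with Dirichlet boundary conditions on $H$ times the real number $\nu$. Let $(\Omega,\mathcal{F},\mathbb{P})$ be a probability space, let $(W_t)_{t\in[0,T]}$ be an $\mathrm{Id}_H$-cylindrical Wiener process, and let $O\colon[0,T]\times\Omega\to H$ and $\mathcal{O}^{M,N}\colon[0,T]\times\Omega\to H$, $M,N\in\mathbb{N}$, be stochastic processes which satisfy for all $t\in[0,T]$, $M,N\in\mathbb{N}$ that $\mathbb{P}$-a.s. $O_t=\int_0^te^{(t-s)A}\,dW_s$ and $\mathcal{O}^{M,N}_t=\int_0^tP_Ne^{(t-\lfloor s\rfloor_{T/M})A}\,dW_s$. *)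

theory Defs
  imports "HOL-Probability.Probability"
begin

section \<open>The Hilbert space $H = L^2((0,1);R)$\<close>

abbreviation unit_interval :: "real measure" where
  "unit_interval \<equiv> restrict_space lborel {0<..<1}"

definition sq_integrable :: "(real \<Rightarrow> real) \<Rightarrow> bool" where
  "sq_integrable f \<longleftrightarrow>
     f \<in> borel_measurable unit_interval \<and> integrable unit_interval (\<lambda>x. (f x)\<^sup>2)"

lemma sq_integrable_mult:
  assumes "sq_integrable f" "sq_integrable g"
  shows "integrable unit_interval (\<lambda>x. f x * g x)"
proof (rule Bochner_Integration.integrable_bound)
  show "integrable unit_interval (\<lambda>x. (f x)\<^sup>2 + (g x)\<^sup>2)"
    using assms by (auto simp: sq_integrable_def)
  show "(\<lambda>x. f x * g x) \<in> borel_measurable unit_interval"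
    using assms unfolding sq_integrable_def by (intro borel_measurable_times) auto
  have "norm (a * b) \<le> norm (a\<^sup>2 + b\<^sup>2)" for a b :: real
  proof -
    have "2 * (\<bar>a\<bar> * \<bar>b\<bar>) \<le> a\<^sup>2 + b\<^sup>2"
      using sum_squares_bound[of "\<bar>a\<bar>" "\<bar>b\<bar>"] by (simp add: mult.assoc)
    moreover have "0 \<le> \<bar>a\<bar> * \<bar>b\<bar>" by simp
    ultimately have "\<bar>a\<bar> * \<bar>b\<bar> \<le> a\<^sup>2 + b\<^sup>2" by linarith
    then show ?thesis by (simp add: abs_mult)
  qed
  then show "AE x in unit_interval. norm (f x * g x) \<le> norm ((f x)\<^sup>2 + (g x)\<^sup>2)" by auto
qed

lemma sq_integrable_add:
  assumes "sq_integrable f" "sq_integrable g"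
  shows "sq_integrable (\<lambda>x. f x + g x)"
proof -
  have "(\<lambda>x. (f x + g x)\<^sup>2) = (\<lambda>x. (f x)\<^sup>2 + (g x)\<^sup>2 + 2 * (f x * g x))"
    by (simp add: power2_sum algebra_simps)
  then show ?thesis
    using assms sq_integrable_mult[OF assms] by (auto simp: sq_integrable_def)
qed

lemma sq_integrable_scale:
  assumes "sq_integrable f"
  shows "sq_integrable (\<lambda>x. c * f x)"
  using assms by (auto simp: sq_integrable_def power_mult_distrib)

lemma sq_integrable_zero: "sq_integrable (\<lambda>_. 0)"
  by (simp add: sq_integrable_def)

lemma sq_integrable_uminus:
  assumes "sq_integrable f"
  shows "sq_integrable (\<lambda>x. - f x)"
  using sq_integrable_scale[OF assms, of "-1"] by simp

lemma sq_integrable_diff: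
  assumes "sq_integrable f" "sq_integrable g"
  shows "sq_integrable (\<lambda>x. f x - g x)"
  using sq_integrable_add[OF assms(1) sq_integrable_uminus[OF assms(2)]] by simp

lemma sq_integrable_continuous:
  assumes "continuous_on {0..1} f"
  shows "sq_integrable f"
proof -
  have "set_integrable lborel {0..1} f" "set_integrable lborel {0..1} (\<lambda>x. (f x)\<^sup>2)"
    by (intro borel_integrable_atLeastAtMost' continuous_intros assms)+
  then have "set_integrable lborel {0<..<1} f" "set_integrable lborel {0<..<1} (\<lambda>x. (f x)\<^sup>2)"
    by (auto intro: set_integrable_subset)
  then have "integrable unit_interval f" "integrable unit_interval (\<lambda>x. (f x)\<^sup>2)"
    by (auto simp: set_integrable_def integrable_restrict_space)
  then show ?thesis by (auto simp: sq_integrable_def)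
qed

definition l2_rel :: "(real \<Rightarrow> real) \<Rightarrow> (real \<Rightarrow> real) \<Rightarrow> bool" where
  "l2_rel f g \<longleftrightarrow>
     sq_integrable f \<and> sq_integrable g \<and> (AE x in unit_interval. f x = g x)"

quotient_type l2 = "real \<Rightarrow> real" / partial: l2_rel
proof (rule part_equivpI)
  show "\<exists>f. l2_rel f f" using sq_integrable_zero by (auto simp: l2_rel_def)
  show "symp l2_rel" by (auto simp: l2_rel_def symp_def)
  show "transp l2_rel" by (auto simp: l2_rel_def transp_def)
qed

text \<open>\<open>abs_l2 f\<close> is the equivalence class of \<open>f\<close>; it is meaningful only if \<open>sq_integrable f\<close>.\<close>

instantiation l2 :: real_inner
begin

lift_definition zero_l2 :: l2 is "\<lambda>_. 0"
  by (simp add: l2_rel_def sq_integrable_zero)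

lift_definition plus_l2 :: "l2 \<Rightarrow> l2 \<Rightarrow> l2" is "\<lambda>f g x. f x + g x"
  by (auto simp: l2_rel_def sq_integrable_add)

lift_definition minus_l2 :: "l2 \<Rightarrow> l2 \<Rightarrow> l2" is "\<lambda>f g x. f x - g x"
  by (auto simp: l2_rel_def sq_integrable_diff)

lift_definition uminus_l2 :: "l2 \<Rightarrow> l2" is "\<lambda>f x. - f x"
  by (auto simp: l2_rel_def sq_integrable_uminus)

lift_definition scaleR_l2 :: "real \<Rightarrow> l2 \<Rightarrow> l2" is "\<lambda>c f x. c * f x"
  by (auto simp: l2_rel_def sq_integrable_scale)

lift_definition inner_l2 :: "l2 \<Rightarrow> l2 \<Rightarrow> real"
  is "\<lambda>f g. integral\<^sup>L unit_interval (\<lambda>x. f x * g x)"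
  unfolding l2_rel_def sq_integrable_def by (intro integral_cong_AE) auto

definition norm_l2 :: "l2 \<Rightarrow> real" where "norm_l2 v = sqrt (inner v v)"
definition sgn_l2 :: "l2 \<Rightarrow> l2" where "sgn_l2 v = scaleR (inverse (norm v)) v"
definition dist_l2 :: "l2 \<Rightarrow> l2 \<Rightarrow> real" where "dist_l2 v w = norm (v - w)"
definition uniformity_l2 :: "(l2 \<times> l2) filter" where
  "uniformity_l2 = (INF e\<in>{0<..}. principal {(x, y). dist x y < e})"
definition open_l2 :: "l2 set \<Rightarrow> bool" where
  "open_l2 U = (\<forall>x\<in>U. \<forall>\<^sub>F (x', y) in uniformity. x' = x \<longrightarrow> y \<in> U)"

instance
proof
  fix u v w :: l2 and a b :: real and U :: "l2 set"
  show "u + v + w = u + (v + w)"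
    by transfer (auto simp: l2_rel_def add.assoc intro!: sq_integrable_add)
  show "u + v = v + u"
    by transfer (auto simp: l2_rel_def add.commute intro!: sq_integrable_add)
  show "0 + u = u" by transfer (auto simp: l2_rel_def)
  show "- u + u = 0" by transfer (auto simp: l2_rel_def sq_integrable_zero)
  show "u - v = u + - v"
    by transfer (auto simp: l2_rel_def intro!: sq_integrable_diff)
  show "a *\<^sub>R (u + v) = a *\<^sub>R u + a *\<^sub>R v"
    by transfer (auto simp: l2_rel_def distrib_left intro!: sq_integrable_add sq_integrable_scale)
  show "(a + b) *\<^sub>R u = a *\<^sub>R u + b *\<^sub>R u"
    by transfer (auto simp: l2_rel_def distrib_right intro!: sq_integrable_add sq_integrable_scale)
  show "a *\<^sub>R b *\<^sub>R u = (a * b) *\<^sub>R u"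
    by transfer (auto simp: l2_rel_def mult.assoc intro!: sq_integrable_scale
          dest: sq_integrable_scale[of _ "a * b"])
  show "1 *\<^sub>R u = u" by transfer (auto simp: l2_rel_def)
  show "inner u v = inner v u" by transfer (simp add: mult.commute)
  show "inner (u + v) w = inner u w + inner v w"
    by transfer (simp add: l2_rel_def distrib_right sq_integrable_mult)
  show "inner (a *\<^sub>R u) v = a * inner u v"
    by transfer (simp add: mult.assoc)
  show "0 \<le> inner u u" by transfer simp
  show "(inner u u = 0) = (u = 0)"
  proof transfer
    fix f assume f: "l2_rel f f"
    then have "integrable unit_interval (\<lambda>x. f x * f x)"
      by (auto simp: l2_rel_def intro: sq_integrable_mult)
    then have "(integral\<^sup>L unit_interval (\<lambda>x. f x * f x) = 0)
        = (AE x in unit_interval. f x * f x = 0)"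
      by (intro integral_nonneg_eq_0_iff_AE) auto
    then show "(integral\<^sup>L unit_interval (\<lambda>x. f x * f x) = 0) = l2_rel f (\<lambda>_. 0)"
      using f by (auto simp: l2_rel_def sq_integrable_zero)
  qed
  show "norm u = sqrt (inner u u)" by (rule norm_l2_def)
  show "sgn u = scaleR (inverse (norm u)) u" by (rule sgn_l2_def)
  show "dist u v = norm (u - v)" by (rule dist_l2_def)
  show "(uniformity :: (l2 \<times> l2) filter) = (INF e\<in>{0<..}. principal {(x, y). dist x y < e})"
    by (rule uniformity_l2_def)
  show "open U = (\<forall>x\<in>U. \<forall>\<^sub>F (x', y) in uniformity. x' = x \<longrightarrow> y \<in> U)"
    by (rule open_l2_def)
qed

end

lift_definition sine_basis :: "nat \<Rightarrow> l2" is "\<lambda>m x. sqrt 2 * sin (real m * pi * x)"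
  by (auto simp: l2_rel_def intro!: sq_integrable_continuous continuous_intros)

definition galerkin_proj :: "nat \<Rightarrow> l2 \<Rightarrow> l2" where
  "galerkin_proj n v = (\<Sum>k=1..n. inner (sine_basis k) v *\<^sub>R sine_basis k)"


section \<open>The Dirichlet Laplacian and the semigroup it generates\<close>

text \<open>
  Unbounded operators are represented by their graphs. On $(0,1)$ the domain
  $H^2 \cap H^1_0$ consists of the (classes of) functions \<open>u\<close> such that \<open>u\<close> and \<open>u'\<close> are
  absolutely continuous, \<open>u''\<close> is square integrable and \<open>u\<close> vanishes at the boundary.
  Below \<open>u1\<close> and \<open>u2\<close> are the first and the second weak derivative of \<open>u\<close>, absolute continuity
  being expressed by the fundamental theorem of calculus.
\<close>

definition dirichlet_laplacian :: "real \<Rightarrow> (l2 \<times> l2) set" where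
  "dirichlet_laplacian \<nu> = {(abs_l2 u, \<nu> *\<^sub>R abs_l2 u2) | u u1 u2.
      sq_integrable u \<and> sq_integrable u2 \<and>
      (\<forall>x\<in>{0..1}. u x = u 0 + integral {0..x} u1) \<and>
      (\<forall>x\<in>{0..1}. u1 x = u1 0 + integral {0..x} u2) \<and>
      u 0 = 0 \<and> u 1 = 0}"

definition C0_semigroup :: "(real \<Rightarrow> 'a::real_normed_vector \<Rightarrow> 'a) \<Rightarrow> bool" where
  "C0_semigroup S \<longleftrightarrow>
     (\<forall>t\<ge>0. bounded_linear (S t)) \<and>
     (\<forall>v. S 0 v = v) \<and>
     (\<forall>s\<ge>0. \<forall>t\<ge>0. \<forall>v. S (s + t) v = S s (S t v)) \<and>
     (\<forall>v. ((\<lambda>t. S t v) \<longlongrightarrow> v) (at_right 0))"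

definition generator :: "(real \<Rightarrow> 'a::real_normed_vector \<Rightarrow> 'a) \<Rightarrow> ('a \<times> 'a) set" where
  "generator S = {(v, w). ((\<lambda>t. (S t v - v) /\<^sub>R t) \<longlongrightarrow> w) (at_right 0)}"

text \<open>\<open>is_exp_semigroup A S\<close> says that \<open>S t\<close> is $e^{tA}$ for all \<open>t \<ge> 0\<close>;
  a generator determines its semigroup there.\<close>

definition is_exp_semigroup ::
  "('a::real_normed_vector \<times> 'a) set \<Rightarrow> (real \<Rightarrow> 'a \<Rightarrow> 'a) \<Rightarrow> bool" where
  "is_exp_semigroup A S \<longleftrightarrow> C0_semigroup S \<and> generator S = A"


section \<open>Cylindrical Wiener processes\<close>

text \<open>
  An \<open>Id\<close>-cylindrical Wiener process on $[0,T]$ is a family \<open>W t v\<close> of real random variables,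
  formally $\langle W_t, v\rangle$, that is almost surely linear in \<open>v\<close>, continuous in \<open>t\<close>, and whose
  increments are centred Gaussian with variance $(t-s)\|v\|^2$ and, jointly in \<open>v\<close>,
  independent of the past.
\<close>

definition past_events ::
  "'w measure \<Rightarrow> (real \<Rightarrow> 'a \<Rightarrow> 'w \<Rightarrow> real) \<Rightarrow> real \<Rightarrow> 'w set set" where
  "past_events \<PP> W s = sigma_sets (space \<PP>)
     {W r v -` B \<inter> space \<PP> | r v B. 0 \<le> r \<and> r \<le> s \<and> B \<in> sets borel}"

definition increment_events ::
  "'w measure \<Rightarrow> (real \<Rightarrow> 'a \<Rightarrow> 'w \<Rightarrow> real) \<Rightarrow> real \<Rightarrow> real \<Rightarrow> 'w set set" where
  "increment_events \<PP> W s t = sigma_sets (space \<PP>)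
     {(\<lambda>\<omega>. W t v \<omega> - W s v \<omega>) -` B \<inter> space \<PP> | v B. B \<in> sets borel}"

definition cylindrical_wiener ::
  "'w measure \<Rightarrow> real \<Rightarrow> (real \<Rightarrow> 'a::real_inner \<Rightarrow> 'w \<Rightarrow> real) \<Rightarrow> bool" where
  "cylindrical_wiener \<PP> T W \<longleftrightarrow>
     (\<forall>t\<in>{0..T}. \<forall>v. W t v \<in> borel_measurable \<PP>) \<and>
     (\<forall>t\<in>{0..T}. \<forall>a b u v. AE \<omega> in \<PP>. W t (a *\<^sub>R u + b *\<^sub>R v) \<omega> = a * W t u \<omega> + b * W t v \<omega>) \<and>
     (\<forall>v. AE \<omega> in \<PP>. W 0 v \<omega> = 0) \<and>
     (\<forall>v. AE \<omega> in \<PP>. continuous_on {0..T} (\<lambda>t. W t v \<omega>)) \<and>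
     (\<forall>s t v. 0 \<le> s \<and> s < t \<and> t \<le> T \<and> v \<noteq> 0 \<longrightarrow>
        distributed \<PP> lborel (\<lambda>\<omega>. W t v \<omega> - W s v \<omega>)
          (\<lambda>x. ennreal (normal_density 0 (sqrt (t - s) * norm v) x))) \<and>
     (\<forall>s t. 0 \<le> s \<and> s < t \<and> t \<le> T \<longrightarrow>
        prob_space.indep_set \<PP> (past_events \<PP> W s) (increment_events \<PP> W s t))"


section \<open>Stochastic integrals of deterministic integrands\<close>

text \<open>The squared Hilbert-Schmidt norm, computed in the orthonormal basis
  \<open>sine_basis m\<close>, \<open>m \<ge> 1\<close>, of \<open>H\<close> (it does not depend on the choice of the orthonormal basis).\<close>

definition HS_norm_sq :: "(l2 \<Rightarrow> l2) \<Rightarrow> ennreal" where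
  "HS_norm_sq L = (\<Sum>m. ennreal ((norm (L (sine_basis (Suc m))))\<^sup>2))"

text \<open>
  A list entry \<open>(a, b, g, f)\<close> stands for the elementary integrand that equals the rank-one operator
  $v \mapsto \langle g, v\rangle f$ on $(a,b]$ and \<open>0\<close> elsewhere; its integral is
  $(\langle W_b,g\rangle - \langle W_a,g\rangle) f$. A list stands for the sum of its entries. Sums of
  this kind are exactly the step functions with finite-rank values, and they are dense in
  $L^2([0,t]; \mathrm{HS}(H))$.
\<close>

type_synonym elementary = "(real \<times> real \<times> l2 \<times> l2) list"

definition elementary_on :: "real \<Rightarrow> elementary \<Rightarrow> bool" where
  "elementary_on t xs \<longleftrightarrow> (\<forall>(a, b, g, f)\<in>set xs. 0 \<le> a \<and> a \<le> b \<and> b \<le> t)"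

definition elementary_op :: "elementary \<Rightarrow> real \<Rightarrow> l2 \<Rightarrow> l2" where
  "elementary_op xs s v = (\<Sum>(a, b, g, f)\<leftarrow>xs. (indicator {a<..b} s * inner g v) *\<^sub>R f)"

definition elementary_integral ::
  "(real \<Rightarrow> l2 \<Rightarrow> 'w \<Rightarrow> real) \<Rightarrow> elementary \<Rightarrow> 'w \<Rightarrow> l2" where
  "elementary_integral W xs \<omega> = (\<Sum>(a, b, g, f)\<leftarrow>xs. (W b g \<omega> - W a g \<omega>) *\<^sub>R f)"

text \<open>
  \<open>has_stochastic_integral \<PP> W t \<Phi> X\<close> says that $X = \int_0^t \Phi(s)\,dW_s$ almost surely. This is
  the usual construction by isometry: \<open>X\<close> is the mean-square limit of the integrals of elementary
  integrands that converge to \<open>\<Phi>\<close> in $L^2([0,t]; \mathrm{HS}(H))$. The values of \<open>\<Phi>\<close> need to be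
  Hilbert-Schmidt for almost all times only.
\<close>

definition has_stochastic_integral ::
  "'w measure \<Rightarrow> (real \<Rightarrow> l2 \<Rightarrow> 'w \<Rightarrow> real) \<Rightarrow> real \<Rightarrow> (real \<Rightarrow> l2 \<Rightarrow> l2) \<Rightarrow> ('w \<Rightarrow> l2) \<Rightarrow> bool" where
  "has_stochastic_integral \<PP> W t \<Phi> X \<longleftrightarrow>
     X \<in> borel_measurable \<PP> \<and>
     (\<forall>s\<in>{0..t}. bounded_linear (\<Phi> s)) \<and>
     (\<forall>u v. (\<lambda>s. inner u (\<Phi> s v)) \<in> borel_measurable (restrict_space lborel {0..t})) \<and>
     (\<exists>\<Psi>. (\<forall>n. elementary_on t (\<Psi> n)) \<and>
        (\<lambda>n. \<integral>\<^sup>+s\<in>{0..t}. HS_norm_sq (\<lambda>v. \<Phi> s v - elementary_op (\<Psi> n) s v) \<partial>lborel)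
          \<longlonglongrightarrow> 0 \<and>
        (\<lambda>n. \<integral>\<^sup>+\<omega>. ennreal ((norm (X \<omega> - elementary_integral W (\<Psi> n) \<omega>))\<^sup>2) \<partial>\<PP>)
          \<longlonglongrightarrow> 0)"


section \<open>Further notation\<close>

definition floor_grid :: "real \<Rightarrow> real \<Rightarrow> real" where
  "floor_grid h t = (GREATEST s. s \<in> range (\<lambda>k::int. of_int k * h) \<inter> {..t})"

text \<open>The norm of $L^2(P;H)$, with value \<open>\<infinity>\<close> if the second moment is infinite.\<close>

definition L2_norm :: "'w measure \<Rightarrow> ('w \<Rightarrow> 'a::real_normed_vector) \<Rightarrow> ennreal" where
  "L2_norm \<PP> Z =
     (let m = \<integral>\<^sup>+\<omega>. ennreal ((norm (Z \<omega>))\<^sup>2) \<partial>\<PP>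
      in if m = \<infinity> then \<infinity> else ennreal (sqrt (enn2real m)))"

end

theory Submission
  imports Defs
begin

text \<open>
  On the sine basis everything is diagonal. The semigroup multiplies \<open>sine_basis k\<close> by
  $e^{-\mu_k t}$ with $\mu_k = \nu\pi^2k^2$, the projection keeps the modes \<open>k \<le> N\<close>, and the Ito
  isometry turns the mean square error at time \<open>t\<close> into the series
  $$\sum_{k>N}\int_0^t e^{-2\mu_k(t-s)}\,ds
    + \sum_{k\le N}\int_0^t e^{-2\mu_k(t-s)}\bigl(1-e^{-\mu_k(s-\lfloor s\rfloor)}\bigr)^2ds,$$
  a spatial error from the discarded modes and a temporal error from the frozen integrand
  (\<open>mean_square_error\<close>). With the grid width $h = T/M$ the rest is a two-sided estimate of each part.

  Every discarded mode contributes about $1/(2\mu_k)$, so the spatial part is of order $1/N$. A retained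
  mode contributes at most $\min(1,\mu_kh)^2/(2\mu_k)$ (\<open>temporal_mode_le\<close>). The modes with
  $\mu_kh\le1$, about $h^{-1/2}$ many with at most a multiple of \<open>h\<close> each, and the tail of
  $\sum 1/\mu_k$ beyond them both add up to a multiple of $\sqrt h$ (\<open>sum_truncated_squares_le\<close>).
  For the lower bound, at least half of the mass of $e^{-2\mu_k(T-s)}$ lies where \<open>s\<close> is at least
  $h/2$ past its grid point (\<open>temporal_mode_ge\<close>), and only the modes with $k^2h/2\ge1$ are kept
  (\<open>temporal_sum_ge\<close>). The integral in the statement equals a constant times a difference of two
  inverse square roots, which a partial sum of $\sum 1/k^2$ dominates (\<open>temporal_lower_bound\<close>).
  The two parts are combined by $(p+q)^2\le2p^2+2q^2$ below and $p^2+q^2\le(p+q)^2$ above.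

  Three facts make the series formula available. First, the sine functions are complete in \<open>H\<close>
  (\<open>sine_basis_total\<close>), because $\sin(\pi x)\,p(\cos\pi x)$ is a sine polynomial for every
  polynomial \<open>p\<close>; completeness is what makes the Hilbert-Schmidt norm of a rank-one operator
  equal to the product of the norms. Second, an eigenvector of the generator is an eigenvector of the
  semigroup (\<open>semigroup_eigenvector\<close>). Third, the isometry passes from elementary integrands to the
  limits by which the stochastic integral is defined (\<open>ito_isometry_diff\<close>).
\<close>

section \<open>Parseval's identity\<close>

context
  fixes e :: "nat \<Rightarrow> 'a::real_inner"
  assumes orthonormal: "\<And>m n. inner (e m) (e n) = (if m = n then 1 else 0)"
    and total: "closure (span (range e)) = UNIV"
begin

text \<open>
  An element of the span involves finitely many basis vectors, so it survives every sufficiently late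
  truncation; this is what turns density of the span into convergence of the partial sums.
\<close>

lemma span_range_finite:
  assumes "w \<in> span (range e)"
  obtains n where "w \<in> span (e ` {..<n})"
proof -
  have "\<exists>n. w \<in> span (e ` {..<n})"
    using assms
  proof (induction rule: span_induct_alt)
    case base
    then show ?case by (auto intro: span_zero)
  next
    case (step c x y)
    then obtain k n where k: "x = e k" and n: "y \<in> span (e ` {..<n})" by auto
    have "x \<in> span (e ` {..<max n (Suc k)})" unfolding k by (intro span_base) auto
    moreover have "y \<in> span (e ` {..<max n (Suc k)})"
      using n span_mono[of "e ` {..<n}" "e ` {..<max n (Suc k)}"] by fastforce
    ultimately show ?case by (intro exI span_add span_scale)
  qed
  then show ?thesis using that by blast
qed

lemma residual_orthogonal:
  assumes "w \<in> span (e ` {..<n})"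
  shows "inner (v - (\<Sum>m<n. inner v (e m) *\<^sub>R e m)) w = 0"
  using assms
proof (induction rule: span_induct_alt)
  case (step c x y)
  then obtain k where k: "k < n" "x = e k" by auto
  have "inner (\<Sum>m<n. inner v (e m) *\<^sub>R e m) (e k) = inner v (e k)"
    using k by (simp add: inner_sum_left orthonormal if_distrib[of "(*) _"] cong: if_cong)
  then show ?case using step k by (simp add: inner_add_right inner_diff_left)
qed simp

text \<open>
  The partial sum is the best approximation in the span of the first \<open>n\<close> vectors. Density of the
  full span therefore forces the residuals to \<open>0\<close>, and the residual is the defect in Bessel's
  inequality.
\<close>

lemma parseval: "(\<lambda>m. (inner v (e m))\<^sup>2) sums (norm v)\<^sup>2"
proof -
  define p where "p n = (\<Sum>m<n. inner v (e m) *\<^sub>R e m)" for n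
  have p_span: "p n \<in> span (e ` {..<n})" for n
    unfolding p_def by (intro span_sum span_scale span_base) auto
  have "inner (p n) (p n) = (\<Sum>m<n. (inner v (e m))\<^sup>2)" for n
    unfolding p_def
    by (simp add: inner_sum_left inner_sum_right orthonormal if_distrib[of "(*) _"] power2_eq_square cong: if_cong)
  moreover have "inner (v - p n) (p n) = 0" for n
    unfolding p_def by (rule residual_orthogonal[OF p_span[unfolded p_def]])
  ultimately have bessel: "(\<Sum>m<n. (inner v (e m))\<^sup>2) = (norm v)\<^sup>2 - (norm (v - p n))\<^sup>2" for n
    unfolding power2_norm_eq_inner by (simp add: inner_diff_left inner_diff_right inner_commute)
  have best: "norm (v - p n) \<le> norm (v - w)" if "w \<in> span (e ` {..<n})" for n w
  proof -
    have "inner (v - p n) (p n - w) = 0"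
      unfolding p_def by (rule residual_orthogonal) (use that p_span in \<open>auto simp: p_def intro: span_diff\<close>)
    then have "inner (v - w) (v - w) = inner (v - p n) (v - p n) + inner (p n - w) (p n - w)"
      by (simp add: inner_diff_left inner_diff_right inner_commute)
    then show ?thesis unfolding norm_eq_sqrt_inner by simp
  qed
  have "(\<lambda>n. v - p n) \<longlonglongrightarrow> 0"
  proof (rule LIMSEQ_I)
    fix r :: real assume "0 < r"
    then obtain w where w: "w \<in> span (range e)" "dist w v < r"
      using total closure_approachable[of v "span (range e)"] by auto
    obtain k where k: "w \<in> span (e ` {..<k})" using w(1) by (rule span_range_finite)
    have "norm (v - p n) < r" if "n \<ge> k" for n
    proof -
      have "e ` {..<k} \<subseteq> e ` {..<n}" using that by auto
      then have "w \<in> span (e ` {..<n})" using k span_mono by blast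
      from best[OF this] show ?thesis using w(2) by (simp add: dist_norm norm_minus_commute)
    qed
    then show "\<exists>k. \<forall>n\<ge>k. norm (v - p n - 0) < r" by auto
  qed
  then have "(\<lambda>n. (norm v)\<^sup>2 - (norm (v - p n))\<^sup>2) \<longlonglongrightarrow> (norm v)\<^sup>2 - (norm (0::'a))\<^sup>2"
    by (intro tendsto_intros)
  then show ?thesis unfolding sums_def bessel by simp
qed

lemma parseval_inner: "(\<lambda>m. inner u (e m) * inner v (e m)) sums inner u v"
proof -
  have "(\<lambda>m. ((inner (u + v) (e m))\<^sup>2 - (inner (u - v) (e m))\<^sup>2) / 4) sums (((norm (u + v))\<^sup>2 - (norm (u - v))\<^sup>2) / 4)"
    by (intro sums_divide sums_diff parseval)
  moreover have "((inner (u + v) (e m))\<^sup>2 - (inner (u - v) (e m))\<^sup>2) / 4 = inner u (e m) * inner v (e m)" for m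
    by (simp add: inner_add_left inner_diff_left power2_eq_square algebra_simps)
  moreover have "((norm (u + v))\<^sup>2 - (norm (u - v))\<^sup>2) / 4 = inner u v"
    by (simp add: power2_norm_eq_inner inner_add_left inner_diff_left inner_add_right inner_diff_right inner_commute)
  ultimately show ?thesis by simp
qed

end

section \<open>Completeness of the sine basis\<close>

lemma l2_rel_refl: "sq_integrable f \<Longrightarrow> l2_rel f f"
  by (simp add: l2_rel_def)

lemma l2_cases:
  obtains f where "sq_integrable f" "v = abs_l2 f"
  by (induction v rule: l2.abs_induct) (auto simp: l2_rel_def)

lemma abs_l2_add: "sq_integrable f \<Longrightarrow> sq_integrable g \<Longrightarrow> abs_l2 (\<lambda>x. f x + g x) = abs_l2 f + abs_l2 g"
  by (simp add: plus_l2.abs_eq l2_rel_refl)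

lemma abs_l2_diff: "sq_integrable f \<Longrightarrow> sq_integrable g \<Longrightarrow> abs_l2 (\<lambda>x. f x - g x) = abs_l2 f - abs_l2 g"
  by (simp add: minus_l2.abs_eq l2_rel_refl)

lemma abs_l2_scale: "sq_integrable f \<Longrightarrow> abs_l2 (\<lambda>x. c * f x) = c *\<^sub>R abs_l2 f"
  by (simp add: scaleR_l2.abs_eq l2_rel_refl)

lemma inner_abs_l2:
  "sq_integrable f \<Longrightarrow> sq_integrable g \<Longrightarrow>
     inner (abs_l2 f) (abs_l2 g) = (\<integral>x. f x * g x \<partial>unit_interval)"
  by (simp add: inner_l2.abs_eq l2_rel_refl)

lemma norm_abs_l2_sq: "sq_integrable f \<Longrightarrow> (norm (abs_l2 f))\<^sup>2 = (\<integral>x. (f x)\<^sup>2 \<partial>unit_interval)"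
  by (simp add: power2_norm_eq_inner inner_abs_l2 flip: power2_eq_square)

lemma sine_basis_eq: "sine_basis m = abs_l2 (\<lambda>x. sqrt 2 * sin (real m * pi * x))"
  by (rule sine_basis.abs_eq)

text \<open>
  Square integrability is inherited by measurable minorants; it is needed to know that a pointwise limit
  has a class in \<open>H\<close> at all.
\<close>

lemma sq_integrable_bound:
  assumes "f \<in> borel_measurable unit_interval" "AE x in unit_interval. \<bar>f x\<bar> \<le> w x" "sq_integrable w"
  shows "sq_integrable f"
proof -
  have "integrable unit_interval (\<lambda>x. (f x)\<^sup>2)"
  proof (rule Bochner_Integration.integrable_bound)
    show "integrable unit_interval (\<lambda>x. (w x)\<^sup>2)" using assms(3) by (simp add: sq_integrable_def)
    show "AE x in unit_interval. norm ((f x)\<^sup>2) \<le> norm ((w x)\<^sup>2)"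
      using assms(2)
    proof eventually_elim
      case (elim x)
      then have "\<bar>f x\<bar>\<^sup>2 \<le> (w x)\<^sup>2" by (intro power_mono) auto
      then show ?case by simp
    qed
  qed (use assms(1) in measurable)
  then show ?thesis using assms(1) by (simp add: sq_integrable_def)
qed

text \<open>
  The functions whose class lies in the closed linear span of the sine basis. That all of $L^2$ has this
  property is shown on representatives, where pointwise limits and indicator functions make sense.
\<close>

definition sine_approximable :: "(real \<Rightarrow> real) \<Rightarrow> bool" where
  "sine_approximable f \<longleftrightarrow>
     sq_integrable f \<and> abs_l2 f \<in> closure (span (range (\<lambda>m. sine_basis (Suc m))))"

lemma subspace_closure:
  fixes V :: "'a::real_normed_vector set"
  assumes "subspace V"
  shows "subspace (closure V)"
  unfolding subspace_def
proof (intro conjI ballI allI)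
  show "0 \<in> closure V" using assms closure_subset subspace_0 by blast
next
  fix x y assume "x \<in> closure V" "y \<in> closure V"
  then obtain f g where "\<And>n. f n \<in> V" "f \<longlonglongrightarrow> x" "\<And>n. g n \<in> V" "g \<longlonglongrightarrow> y"
    unfolding closure_sequential by blast
  then show "x + y \<in> closure V"
    unfolding closure_sequential
    by (intro exI[of _ "\<lambda>n. f n + g n"] conjI allI tendsto_add subspace_add[OF assms])
next
  fix c x assume "x \<in> closure V"
  then obtain f where "\<And>n. f n \<in> V" "f \<longlonglongrightarrow> x"
    unfolding closure_sequential by blast
  then show "c *\<^sub>R x \<in> closure V"
    unfolding closure_sequential
    by (intro exI[of _ "\<lambda>n. c *\<^sub>R f n"] conjI allI tendsto_intros subspace_scale[OF assms])
qed

lemmas subspace_sine_closure =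
  subspace_closure[OF subspace_span[of "range (\<lambda>m. sine_basis (Suc m))"]]

lemma sine_approximable_zero: "sine_approximable (\<lambda>_. 0)"
  using subspace_0[OF subspace_sine_closure]
  by (simp add: sine_approximable_def sq_integrable_zero flip: zero_l2_def)

lemma sine_approximable_add:
  "sine_approximable f \<Longrightarrow> sine_approximable g \<Longrightarrow> sine_approximable (\<lambda>x. f x + g x)"
  using subspace_add[OF subspace_sine_closure]
  by (simp add: sine_approximable_def sq_integrable_add abs_l2_add)

lemma sine_approximable_scale: "sine_approximable f \<Longrightarrow> sine_approximable (\<lambda>x. c * f x)"
  using subspace_scale[OF subspace_sine_closure]
  by (simp add: sine_approximable_def sq_integrable_scale abs_l2_scale)

lemma sine_approximable_diff:
  "sine_approximable f \<Longrightarrow> sine_approximable g \<Longrightarrow> sine_approximable (\<lambda>x. f x - g x)"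
  using sine_approximable_add[of f "\<lambda>x. - 1 * g x"] sine_approximable_scale[of g "-1"] by simp

lemma sine_approximable_sum:
  "(\<And>i. i \<in> I \<Longrightarrow> sine_approximable (F i)) \<Longrightarrow> sine_approximable (\<lambda>x. \<Sum>i\<in>I. F i x)"
proof (induction I rule: infinite_finite_induct)
  case (insert i I)
  then have "sine_approximable (\<lambda>x. F i x + (\<Sum>j\<in>I. F j x))"
    by (intro sine_approximable_add) auto
  then show ?case using insert by simp
qed (simp_all add: sine_approximable_zero)

text \<open>
  The closed span is stable under dominated pointwise convergence, since such convergence implies
  convergence in $L^2$. Limits enter the approximation of general functions only in this form.
\<close>

lemma sine_approximable_dominated:
  assumes F: "\<And>n. sine_approximable (F n)"
    and f: "f \<in> borel_measurable unit_interval"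
    and lim: "AE x in unit_interval. (\<lambda>n. F n x) \<longlonglongrightarrow> f x"
    and bound: "\<And>n. AE x in unit_interval. \<bar>F n x\<bar> \<le> w x"
    and w: "sq_integrable w"
  shows "sine_approximable f"
proof -
  have Fsq: "sq_integrable (F n)" for n using F by (simp add: sine_approximable_def)
  have "AE x in unit_interval. \<forall>n. \<bar>F n x\<bar> \<le> w x" using bound by (simp add: AE_all_countable)
  then have fb: "AE x in unit_interval. \<bar>f x\<bar> \<le> w x"
    using lim
  proof eventually_elim
    case (elim x)
    show ?case by (rule LIMSEQ_le_const2[OF tendsto_rabs[OF elim(2)]]) (use elim(1) in auto)
  qed
  have fsq: "sq_integrable f" by (rule sq_integrable_bound[OF f fb w])
  have "(\<lambda>n. \<integral>x. (F n x - f x)\<^sup>2 \<partial>unit_interval) \<longlonglongrightarrow> (\<integral>x. 0 \<partial>unit_interval)"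
  proof (rule integral_dominated_convergence)
    show "integrable unit_interval (\<lambda>x. 4 * (w x)\<^sup>2)" using w by (simp add: sq_integrable_def)
    show "(\<lambda>x. (F n x - f x)\<^sup>2) \<in> borel_measurable unit_interval" for n
      using Fsq[of n] f unfolding sq_integrable_def
      by (intro borel_measurable_power borel_measurable_diff) auto
    show "AE x in unit_interval. (\<lambda>n. (F n x - f x)\<^sup>2) \<longlonglongrightarrow> 0"
      using lim
    proof eventually_elim
      case (elim x)
      have "(\<lambda>n. (F n x - f x)\<^sup>2) \<longlonglongrightarrow> (f x - f x)\<^sup>2" by (intro tendsto_intros elim)
      then show ?case by simp
    qed
    show "AE x in unit_interval. norm ((F n x - f x)\<^sup>2) \<le> 4 * (w x)\<^sup>2" for n
      using bound[of n] fb
    proof eventually_elim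
      case (elim x)
      then have "\<bar>F n x - f x\<bar> \<le> 2 * w x" by linarith
      then have "\<bar>F n x - f x\<bar>\<^sup>2 \<le> (2 * w x)\<^sup>2" by (intro power_mono) auto
      then show ?case by (simp add: power_mult_distrib)
    qed
  qed simp
  then have "(\<lambda>n. (norm (abs_l2 (F n) - abs_l2 f))\<^sup>2) \<longlonglongrightarrow> 0"
    by (simp add: norm_abs_l2_sq sq_integrable_diff Fsq fsq flip: abs_l2_diff)
  then have "(\<lambda>n. sqrt ((norm (abs_l2 (F n) - abs_l2 f))\<^sup>2)) \<longlonglongrightarrow> sqrt 0" by (rule tendsto_real_sqrt)
  then have "(\<lambda>n. norm (abs_l2 (F n) - abs_l2 f)) \<longlonglongrightarrow> 0" by simp
  then have "(\<lambda>n. abs_l2 (F n)) \<longlonglongrightarrow> abs_l2 f" by (simp add: tendsto_norm_zero_iff LIM_zero_iff)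
  then have "abs_l2 f \<in> closure (span (range (\<lambda>m. sine_basis (Suc m))))"
    by (intro closed_sequentially[OF closed_closure _ \<open>_ \<longlonglongrightarrow> abs_l2 f\<close>])
       (use F in \<open>auto simp: sine_approximable_def\<close>)
  then show ?thesis using fsq by (simp add: sine_approximable_def)
qed

text \<open>
  The product formula $2\sin a\cos b = \sin(a+b)+\sin(a-b)$ keeps sine polynomials closed under
  multiplication by $\cos(\pi x)$.
\<close>

lemma sine_approximable_sin_cos_power:
  "sine_approximable (\<lambda>x. sin (real m * pi * x) * cos (pi * x) ^ k)"
proof (induction k arbitrary: m)
  case 0
  show ?case
  proof (cases m)
    case 0
    then show ?thesis using sine_approximable_zero by simp
  next
    case (Suc j)
    have "sine_approximable (\<lambda>x. sqrt 2 * sin (real m * pi * x))"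
      unfolding sine_approximable_def sine_basis_eq[symmetric] Suc
      by (auto intro!: sq_integrable_continuous continuous_intros
          subsetD[OF closure_subset] span_base)
    from sine_approximable_scale[OF this, of "1 / sqrt 2"] show ?thesis by simp
  qed
next
  case (Suc k)
  show ?case
  proof (cases m)
    case 0
    then show ?thesis using sine_approximable_zero by simp
  next
    case m: (Suc j)
    have "(1/2) * (sin (real (m + 1) * pi * x) * cos (pi * x) ^ k + sin (real j * pi * x) * cos (pi * x) ^ k)
        = sin (real m * pi * x) * cos (pi * x) ^ Suc k" for x
    proof -
      have "sin (real (m + 1) * pi * x) + sin (real j * pi * x) = 2 * (sin (real m * pi * x) * cos (pi * x))"
        using sin_times_cos[of "real m * pi * x" "pi * x"] m by (simp add: algebra_simps)
      then show ?thesis by (simp flip: distrib_right)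
    qed
    then show ?thesis
      using sine_approximable_scale[OF sine_approximable_add[OF Suc.IH[of "m + 1"] Suc.IH[of j]], of "1/2"]
      by simp
  qed
qed

text \<open>
  Write $\varphi(x) = g(\cos\pi x)$ with \<open>g\<close> continuous on $[-1,1]$ and approximate \<open>g\<close>
  uniformly by polynomials. The factor $\sin(\pi x)$ turns powers of the cosine into sine polynomials.
\<close>

lemma sine_approximable_sin_continuous:
  assumes "continuous_on {0..1} \<phi>"
  shows "sine_approximable (\<lambda>x. sin (pi * x) * \<phi> x)"
proof -
  let ?g = "\<lambda>y. \<phi> (arccos y / pi)"
  have cont: "continuous_on {-1..1} ?g"
  proof (rule continuous_on_compose2[OF assms])
    show "continuous_on {-1..1} (\<lambda>y. arccos y / pi)" by (intro continuous_intros) auto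
    show "(\<lambda>y. arccos y / pi) ` {- 1..1} \<subseteq> {0..1}"
      by (auto simp: arccos_lbound arccos_ubound)
  qed
  have "\<exists>p. real_polynomial_function p \<and> (\<forall>y\<in>{-1..1}. \<bar>?g y - p y\<bar> < 1 / Suc n)" for n :: nat
    by (rule Stone_Weierstrass_real_polynomial_function[OF compact_Icc cont, of "1 / Suc n"]) auto
  then obtain p where p: "\<And>n. real_polynomial_function (p n)"
    "\<And>n y. y \<in> {-1..1} \<Longrightarrow> \<bar>?g y - p n y\<bar> < 1 / Suc n" by metis
  obtain B where B: "\<And>x. x \<in> {0..1} \<Longrightarrow> \<bar>\<phi> x\<bar> \<le> B"
    using compact_imp_bounded[OF compact_continuous_image[OF assms compact_Icc]]
    by (auto simp: bounded_iff intro: that)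
  have pn: "\<bar>\<phi> x - p n (cos (pi * x))\<bar> < 1 / Suc n" if "x \<in> {0..1}" for x n
  proof -
    have "arccos (cos (pi * x)) = pi * x" using that by (intro arccos_cos) auto
    then show ?thesis using p(2)[of "cos (pi * x)" n] by simp
  qed
  show ?thesis
  proof (rule sine_approximable_dominated[where F="\<lambda>n x. sin (pi * x) * p n (cos (pi * x))" and w="\<lambda>_. B + 1"])
    fix n
    obtain a d where pd: "p n = (\<lambda>x. \<Sum>i\<le>d. a i * x ^ i)"
      using p(1)[of n] by (auto simp: real_polynomial_function_iff_sum)
    have "sine_approximable (\<lambda>x. \<Sum>i\<le>d. a i * (sin (real 1 * pi * x) * cos (pi * x) ^ i))"
      by (intro sine_approximable_sum sine_approximable_scale sine_approximable_sin_cos_power)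
    then show "sine_approximable (\<lambda>x. sin (pi * x) * p n (cos (pi * x)))"
      by (simp add: pd sum_distrib_left mult_ac)
    show "AE x in unit_interval. \<bar>sin (pi * x) * p n (cos (pi * x))\<bar> \<le> B + 1"
    proof (rule AE_I2)
      fix x assume "x \<in> space unit_interval"
      then have x: "x \<in> {0..1}" by (simp add: space_restrict_space)
      have "1 / real (Suc n) \<le> 1" by simp
      then have "\<bar>p n (cos (pi * x))\<bar> \<le> B + 1" using pn[OF x, of n] B[OF x] by linarith
      moreover have "\<bar>sin (pi * x) * p n (cos (pi * x))\<bar> \<le> 1 * \<bar>p n (cos (pi * x))\<bar>"
        unfolding abs_mult by (intro mult_right_mono) auto
      ultimately show "\<bar>sin (pi * x) * p n (cos (pi * x))\<bar> \<le> B + 1" by simp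
    qed
  next
    have "continuous_on {0..1} (\<lambda>x. sin (pi * x) * \<phi> x)" by (intro continuous_intros assms)
    from sq_integrable_continuous[OF this]
    show "(\<lambda>x. sin (pi * x) * \<phi> x) \<in> borel_measurable unit_interval" by (simp add: sq_integrable_def)
    show "sq_integrable (\<lambda>_. B + 1)" by (intro sq_integrable_continuous continuous_intros)
    show "AE x in unit_interval. (\<lambda>n. sin (pi * x) * p n (cos (pi * x))) \<longlonglongrightarrow> sin (pi * x) * \<phi> x"
    proof (rule AE_I2)
      fix x assume "x \<in> space unit_interval"
      then have x: "x \<in> {0..1}" by (simp add: space_restrict_space)
      have "(\<lambda>n. \<phi> x - p n (cos (pi * x))) \<longlonglongrightarrow> 0"
        by (rule Lim_null_comparison[OF _ LIMSEQ_Suc[OF lim_1_over_n]])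
           (use pn[OF x] in \<open>auto intro!: always_eventually less_imp_le\<close>)
      then have "(\<lambda>n. \<phi> x - (\<phi> x - p n (cos (pi * x)))) \<longlonglongrightarrow> \<phi> x - 0" by (intro tendsto_intros)
      then show "(\<lambda>n. sin (pi * x) * p n (cos (pi * x))) \<longlonglongrightarrow> sin (pi * x) * \<phi> x"
        by (intro tendsto_intros) simp
    qed
  qed
qed

text \<open>
  Half-lines are limits of continuous ramps, and a Dynkin system argument passes to all Borel sets.
\<close>

lemma sine_approximable_sin_indicator:
  assumes "B \<in> sets (borel :: real measure)"
  shows "sine_approximable (\<lambda>x. sin (pi * x) * indicator B x)"
proof -
  have meas: "(\<lambda>x. sin (pi * x) * indicator A x) \<in> borel_measurable unit_interval"
    if "A \<in> sets borel" for A :: "real set"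
    using that by (intro measurable_restrict_space1) auto
  have dom: "sine_approximable (\<lambda>x. sin (pi * x) * indicator A x)"
    if "\<And>n. sine_approximable (\<lambda>x. sin (pi * x) * \<phi> n x)" "\<And>n x. \<bar>\<phi> n x\<bar> \<le> 1"
      "\<And>x. (\<lambda>n. \<phi> n x) \<longlonglongrightarrow> indicator A x" "A \<in> sets borel" for \<phi> and A :: "real set"
  proof (rule sine_approximable_dominated[where F="\<lambda>n x. sin (pi * x) * \<phi> n x" and w="\<lambda>_. 1"])
    show "AE x in unit_interval. \<bar>sin (pi * x) * \<phi> n x\<bar> \<le> 1" for n
    proof (rule AE_I2)
      fix x
      have "\<bar>sin (pi * x) * \<phi> n x\<bar> \<le> 1 * 1"
        unfolding abs_mult by (intro mult_mono that) auto
      then show "\<bar>sin (pi * x) * \<phi> n x\<bar> \<le> 1" by simp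
    qed
    show "sq_integrable (\<lambda>_. 1)" by (intro sq_integrable_continuous continuous_intros)
  qed (auto intro!: that meas tendsto_intros)
  have sets_borel_eq: "sets (borel :: real measure) = sigma_sets UNIV (range atMost)"
    by (subst borel_eq_atMost) simp
  have "Int_stable (range (atMost :: real \<Rightarrow> _))" "range atMost \<subseteq> Pow (UNIV :: real set)"
    "B \<in> sigma_sets UNIV (range atMost)"
    using assms sets_borel_eq by (auto simp: Int_stable_def image_iff)
  then show ?thesis
  proof (induction rule: sigma_sets_induct_disjoint)
    case (basic A)
    then obtain b where A: "A = {..b}" by auto
    show "sine_approximable (\<lambda>x. sin (pi * x) * indicator A x)"
    \<comment> \<open>The ramp falls from \<open>1\<close> at \<open>b\<close> to \<open>0\<close> at \<open>b + 1/n\<close>.\<close>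
    proof (rule dom[where \<phi>="\<lambda>n x. max 0 (min 1 (1 - real n * (x - b)))"])
      show "sine_approximable (\<lambda>x. sin (pi * x) * max 0 (min 1 (1 - real n * (x - b))))" for n
        by (intro sine_approximable_sin_continuous continuous_intros)
      show "(\<lambda>n. max 0 (min 1 (1 - real n * (x - b)))) \<longlonglongrightarrow> indicator A x" for x
      proof (cases "x \<le> b")
        case True
        then have "real n * (x - b) \<le> 0" for n by (simp add: mult_nonneg_nonpos)
        then have "max 0 (min 1 (1 - real n * (x - b))) = 1" for n by (smt (verit))
        then show ?thesis using True A by simp
      next
        case False
        obtain k :: nat where k: "1 < real k * (x - b)" using reals_Archimedean3[of "x - b"] False by auto
        have "eventually (\<lambda>n. max 0 (min 1 (1 - real n * (x - b))) = 0) sequentially"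
          using eventually_ge_at_top[of k]
        proof eventually_elim
          case (elim n)
          then have "real k * (x - b) \<le> real n * (x - b)" using False by (intro mult_right_mono) auto
          then show ?case using k by simp
        qed
        then have "(\<lambda>n. max 0 (min 1 (1 - real n * (x - b)))) \<longlonglongrightarrow> 0" by (rule tendsto_eventually)
        then show ?thesis using False A by simp
      qed
    qed (auto simp: A)
  next
    case empty
    show ?case by (simp add: sine_approximable_zero)
  next
    case (compl A)
    moreover have "sine_approximable (\<lambda>x. sin (pi * x) * 1)"
      by (intro sine_approximable_sin_continuous continuous_intros)
    ultimately have "sine_approximable (\<lambda>x. sin (pi * x) * 1 - sin (pi * x) * indicator A x)"
      by (intro sine_approximable_diff)
    then show ?case
      by (rule back_subst[of sine_approximable]) (auto simp: indicator_def fun_eq_iff)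
  next
    case (union A)
    note disj = union(1) and A = union(2) and IH = union(3)
    have ind: "indicator (\<Union>i<n. A i) x = (\<Sum>i<n. indicator (A i) x :: real)" for n x
      using disj by (intro indicator_UN_disjoint) (auto simp: disjoint_family_on_def)
    have meas_A: "A i \<in> sets borel" for i
      using A sets_borel_eq by auto
    show "sine_approximable (\<lambda>x. sin (pi * x) * indicator (\<Union>i. A i) x)"
    proof (rule dom[where \<phi>="\<lambda>n. indicator (\<Union>i<n. A i)"])
      show "sine_approximable (\<lambda>x. sin (pi * x) * indicator (\<Union>i<n. A i) x)" for n
        unfolding ind sum_distrib_left by (intro sine_approximable_sum IH)
      show "(\<lambda>n. indicator (\<Union>i<n. A i) x) \<longlonglongrightarrow> (indicator (\<Union>i. A i) x :: real)" for x
        by (rule LIMSEQ_indicator_UN)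
    qed (use meas_A in \<open>auto simp: indicator_def\<close>)
  qed
qed

text \<open>
  The factor $\sin(\pi x)$ is positive on the open interval, so it can be divided out: simple functions
  that approximate $f/\sin(\pi\,\cdot)$ give approximations of \<open>f\<close>.
\<close>

lemma sine_approximable_sq_integrable:
  assumes f: "sq_integrable f"
  shows "sine_approximable f"
proof -
  define g where "g x = indicator {0<..<1} x * f x / sin (pi * x)" for x
  have "(\<lambda>x. indicator {0<..<1} x *\<^sub>R f x) \<in> borel_measurable lborel"
    using f by (simp add: sq_integrable_def borel_measurable_restrict_space_iff)
  then have g: "g \<in> borel_measurable borel" unfolding g_def by simp
  obtain s where s: "\<And>i. simple_function borel (s i)" "\<And>x. (\<lambda>i. s i x) \<longlonglongrightarrow> g x"
    "\<And>i x. dist (s i x) 0 \<le> 2 * dist (g x) 0"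
    using borel_measurable_implies_sequence_metric[OF g, of 0] by auto
  have g_sin: "sin (pi * x) * g x = f x" if "x \<in> {0<..<1}" for x
  proof -
    have "sin (pi * x) > 0" using that by (intro sin_gt_zero) auto
    then show ?thesis using that by (simp add: g_def)
  qed
  show ?thesis
  proof (rule sine_approximable_dominated[where F="\<lambda>n x. sin (pi * x) * s n x" and w="\<lambda>x. 2 * \<bar>f x\<bar>"])
    fix n
    have fin: "finite (range (s n))" using s(1)[of n] by (simp add: simple_function_def)
    have "sine_approximable (\<lambda>x. \<Sum>y\<in>range (s n). y * (sin (pi * x) * indicator (s n -` {y}) x))"
      using s(1)[of n]
      by (intro sine_approximable_sum sine_approximable_scale sine_approximable_sin_indicator)
         (auto simp: simple_function_def)
    moreover have "(\<Sum>y\<in>range (s n). y * (sin (pi * x) * indicator (s n -` {y}) x)) = sin (pi * x) * s n x" for x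
    proof -
      have "(\<Sum>y\<in>range (s n). y * (sin (pi * x) * indicator (s n -` {y}) x))
          = (\<Sum>y\<in>range (s n). if y = s n x then sin (pi * x) * y else 0)"
        by (intro sum.cong) (auto simp: indicator_def)
      then show ?thesis using fin by simp
    qed
    ultimately show "sine_approximable (\<lambda>x. sin (pi * x) * s n x)" by simp
    show "AE x in unit_interval. \<bar>sin (pi * x) * s n x\<bar> \<le> 2 * \<bar>f x\<bar>"
    proof (rule AE_I2)
      fix x assume "x \<in> space unit_interval"
      then have "x \<in> {0<..<1}" by (simp add: space_restrict_space)
      moreover have "\<bar>sin (pi * x)\<bar> * \<bar>s n x\<bar> \<le> \<bar>sin (pi * x)\<bar> * (2 * \<bar>g x\<bar>)"
        using s(3)[of n x] by (intro mult_left_mono) auto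
      ultimately show "\<bar>sin (pi * x) * s n x\<bar> \<le> 2 * \<bar>f x\<bar>"
        using g_sin[of x] by (metis abs_mult mult.left_commute)
    qed
  next
    show "f \<in> borel_measurable unit_interval" using f by (simp add: sq_integrable_def)
    show "sq_integrable (\<lambda>x. 2 * \<bar>f x\<bar>)"
      using f by (intro sq_integrable_scale) (auto simp: sq_integrable_def)
    show "AE x in unit_interval. (\<lambda>n. sin (pi * x) * s n x) \<longlonglongrightarrow> f x"
    proof (rule AE_I2)
      fix x assume "x \<in> space unit_interval"
      then have "x \<in> {0<..<1}" by (simp add: space_restrict_space)
      then show "(\<lambda>n. sin (pi * x) * s n x) \<longlonglongrightarrow> f x"
        using tendsto_mult_left[OF s(2)[of x], of "sin (pi * x)"] g_sin by simp
    qed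
  qed
qed

theorem sine_basis_total: "closure (span (range (\<lambda>m. sine_basis (Suc m)))) = UNIV"
proof -
  have "v \<in> closure (span (range (\<lambda>m. sine_basis (Suc m))))" for v
  proof -
    obtain f where "sq_integrable f" "v = abs_l2 f" by (rule l2_cases)
    then show ?thesis
      using sine_approximable_sq_integrable[of f] by (simp add: sine_approximable_def)
  qed
  then show ?thesis by auto
qed

text \<open>
  All inner products of sine functions reduce to these integrals by the product formula.
\<close>

lemma integral_cos_pi:
  "(\<integral>x. cos (of_int k * pi * x) \<partial>unit_interval) = (if k = 0 then 1 else 0)"
proof -
  have eq: "(\<integral>x. f x \<partial>unit_interval) = integral {0..1} f" if "continuous_on {0..1} f" for f :: "real \<Rightarrow> real"
  proof -
    have "(\<integral>x. f x \<partial>unit_interval) = (LINT x:{0<..<1}|lborel. f x)"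
      unfolding set_lebesgue_integral_def by (rule integral_restrict_space) simp
    also have "\<dots> = integral {0<..<1} f"
      by (intro set_borel_integral_eq_integral(2) set_integrable_subset[OF borel_integrable_atLeastAtMost'[OF that]])
         auto
    also have "\<dots> = integral {0..1} f"
      using integral_open_interval_real[of 0 1 f] by simp
    finally show ?thesis .
  qed
  have "(\<integral>x. cos (of_int k * pi * x) \<partial>unit_interval) = integral {0..1} (\<lambda>x. cos (of_int k * pi * x))"
    by (intro eq continuous_intros)
  also have "\<dots> = (if k = 0 then 1 else 0)"
  proof (cases "k = 0")
    case False
    have "((\<lambda>x. cos (of_int k * pi * x)) has_integral
        sin (of_int k * pi * 1) / (of_int k * pi) - sin (of_int k * pi * 0) / (of_int k * pi)) {0..1}"
      using False
      by (intro fundamental_theorem_of_calculus)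
         (auto intro!: derivative_eq_intros simp flip: has_real_derivative_iff_has_vector_derivative)
    moreover have "sin (of_int k * pi) = 0" by (auto simp: sin_zero_iff_int2)
    ultimately show ?thesis using False by (simp add: integral_unique)
  qed simp
  finally show ?thesis .
qed

lemma sine_basis_orthonormal:
  "inner (sine_basis (Suc m)) (sine_basis (Suc n)) = (if m = n then 1 else 0)"
proof -
  have sq: "sq_integrable (\<lambda>x. sqrt 2 * sin (real k * pi * x))" for k
    by (intro sq_integrable_continuous continuous_intros)
  have sq': "integrable unit_interval (\<lambda>x. cos (of_int k * pi * x))" for k
  proof -
    have "sq_integrable (\<lambda>x. cos (of_int k * pi * x))" "sq_integrable (\<lambda>x. 1)"
      by (intro sq_integrable_continuous continuous_intros)+
    from sq_integrable_mult[OF this] show ?thesis by simp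
  qed
  have prod: "(sqrt 2 * sin (real (Suc m) * pi * x)) * (sqrt 2 * sin (real (Suc n) * pi * x))
      = cos (of_int (int m - int n) * pi * x) - cos (of_int (int m + int n + 2) * pi * x)" for x
  proof -
    have "(sqrt 2 * sin (real (Suc m) * pi * x)) * (sqrt 2 * sin (real (Suc n) * pi * x))
      = 2 * (sin (real (Suc m) * pi * x) * sin (real (Suc n) * pi * x))" by simp
    also have "\<dots> = cos (real (Suc m) * pi * x - real (Suc n) * pi * x) - cos (real (Suc m) * pi * x + real (Suc n) * pi * x)"
      by (simp add: sin_times_sin)
    finally show ?thesis by (simp add: algebra_simps)
  qed
  show ?thesis
    unfolding sine_basis_eq inner_abs_l2[OF sq sq] prod
    by (subst Bochner_Integration.integral_diff[OF sq' sq']) (simp only: integral_cos_pi, auto)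
qed

lemma l2_parseval_inner:
  "(\<lambda>m. inner u (sine_basis (Suc m)) * inner v (sine_basis (Suc m))) sums inner u v"
  by (rule parseval_inner[OF sine_basis_orthonormal sine_basis_total])

lemma l2_parseval: "(\<lambda>m. (inner v (sine_basis (Suc m)))\<^sup>2) sums (norm v)\<^sup>2"
  by (rule parseval[OF sine_basis_orthonormal sine_basis_total])

section \<open>The heat semigroup on the sine basis\<close>

lemma C0_semigroup_right_continuous:
  assumes "C0_semigroup S" "0 \<le> s"
  shows "((\<lambda>t. S t v) \<longlongrightarrow> S s v) (at_right s)"
proof -
  have "((\<lambda>h. S h (S s v)) \<longlongrightarrow> S s v) (at_right 0)"
    using assms(1) by (simp add: C0_semigroup_def)
  moreover have "eventually (\<lambda>h. S h (S s v) = S (h + s) v) (at_right 0)"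
    using eventually_at_right_less[of "0::real"]
    by eventually_elim (use assms in \<open>simp add: C0_semigroup_def\<close>)
  ultimately show ?thesis
    unfolding filterlim_at_right_to_0[of _ _ s] by (rule Lim_transform_eventually)
qed

text \<open>
  Right continuity alone does not give left continuity of the orbits; for that a bound on the operators
  just before time \<open>t\<close> is needed. The uniform boundedness principle would draw it from the Baire
  property of the space; the Baire property of the time axis does the same job: some level set
  $\{s : \|S_s\|\le n\}$ is dense in an interval before \<open>t\<close>, right continuity extends the bound to
  the whole interval, and composition with a fixed operator of the semigroup moves the interval to
  \<open>t\<close>.
\<close>

lemma C0_semigroup_bounded_near:
  assumes S: "C0_semigroup S" and "0 < t"
  obtains d K where "0 < d" "d \<le> t" "0 \<le> K" "\<And>s v. \<bar>s - t\<bar> < d \<Longrightarrow> norm (S s v) \<le> K * norm v"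
proof -
  have lin: "bounded_linear (S s)" if "0 \<le> s" for s using S that by (simp add: C0_semigroup_def)
  define I where "I = {t/3..2*t/3}"
  define E where "E n = {s\<in>I. \<forall>v. norm (S s v) \<le> real n * norm v}" for n
  \<comment> \<open>Otherwise the complements of the closures would be open and dense with empty intersection.\<close>
  have "\<exists>n. \<not> I \<subseteq> closure (I - closure (E n))"
  proof (rule ccontr)
    assume "\<not> ?thesis"
    then have dense: "I \<subseteq> closure (I - closure (E n))" for n by auto
    have "I \<subseteq> closure (\<Inter> (range (\<lambda>n. I - closure (E n))))"
    proof (rule Baire)
      show "closed I" by (simp add: I_def)
      fix X assume "X \<in> range (\<lambda>n. I - closure (E n))"
      then obtain n where X: "X = I - closure (E n)" by auto
      have "openin (top_of_set I) (I \<inter> - closure (E n))"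
        by (intro openin_open_Int) (simp add: open_closed)
      then show "openin (top_of_set I) X \<and> I \<subseteq> closure X"
        using dense[of n] by (simp add: X Diff_eq)
    qed simp
    also have "\<Inter> (range (\<lambda>n. I - closure (E n))) = {}"
    proof -
      have "\<exists>n. s \<in> closure (E n)" if "s \<in> I" for s
      proof -
        have "0 \<le> s" using that \<open>0 < t\<close> by (simp add: I_def)
        then obtain K where K: "norm (S s v) \<le> norm v * K" for v
          using bounded_linear.bounded[OF lin] by blast
        obtain n :: nat where "K \<le> real n" using real_arch_simple by blast
        then have "norm (S s v) \<le> real n * norm v" for v
          using K[of v] mult_left_mono[of K "real n" "norm v"] by (simp add: mult.commute)
        then have "s \<in> E n" using that by (simp add: E_def)
        then show ?thesis using closure_subset by blast
      qed
      then show ?thesis by (auto simp: I_def)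
    qed
    finally show False using \<open>0 < t\<close> by (auto simp: I_def)
  qed
  then obtain n x where x: "x \<in> I" "x \<notin> closure (I - closure (E n))" by auto
  then obtain r where r: "0 < r" "ball x r \<inter> (I - closure (E n)) = {}"
    unfolding closure_iff_nhds_not_empty
    by (metis Int_commute closure_approachable disjoint_iff dist_commute mem_ball x(2))
  define a where "a = max (t/3) (x - r)"
  define b where "b = min (2*t/3) (x + r)"
  have ab: "a < b" "0 < a" "b < t" using x(1) r(1) \<open>0 < t\<close>
    unfolding a_def b_def I_def by (auto simp: max_def min_def)
  have dense: "s \<in> closure (E n)" if "s \<in> {a<..<b}" for s
    using r(2) that by (auto simp: a_def b_def I_def dist_real_def disjoint_iff)
  have bound: "norm (S s v) \<le> real n * norm v" if s: "s \<in> {a<..<b}" for s v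
  proof (rule ccontr)
    assume "\<not> ?thesis"
    moreover have "((\<lambda>r. norm (S r v)) \<longlongrightarrow> norm (S s v)) (at_right s)"
      using s ab by (intro tendsto_norm C0_semigroup_right_continuous[OF S]) auto
    ultimately have "eventually (\<lambda>r. real n * norm v < norm (S r v)) (at_right s)"
      by (intro order_tendstoD(1)) auto
    then obtain c where c: "s < c" "\<And>y. s < y \<Longrightarrow> y < c \<Longrightarrow> real n * norm v < norm (S y v)"
      unfolding eventually_at_right_field by auto
    define c' where "c' = min b c"
    have c': "s < c'" using c s by (auto simp: c'_def)
    have "(s + c') / 2 \<in> closure (E n)" using s c' by (intro dense) (auto simp: c'_def)
    then obtain y where "y \<in> E n" "dist y ((s + c') / 2) < (c' - s) / 2"
      using c' unfolding closure_approachable by (metis diff_gt_0_iff_gt half_gt_zero)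
    then have "s < y" "y < c'" by (auto simp: dist_real_def abs_less_iff field_simps)
    then show False
      using c(2)[of y] \<open>y \<in> E n\<close> by (auto simp: E_def c'_def not_less[symmetric])
  qed
  \<comment> \<open>The shift by \<open>t - m\<close> carries the midpoint of the bounded interval to \<open>t\<close>.\<close>
  define m where "m = (a + b) / 2"
  have tm: "0 \<le> t - m" using ab by (simp add: m_def)
  obtain K where K: "0 < K" "\<And>v. norm (S (t - m) v) \<le> norm v * K"
    using bounded_linear.pos_bounded[OF lin[OF tm]] by blast
  show ?thesis
  proof
    show "0 < (b - a) / 2" "(b - a) / 2 \<le> t" using ab by auto
    show "0 \<le> real n * K" using K by simp
    fix s v assume s: "\<bar>s - t\<bar> < (b - a) / 2"
    define q where "q = s - (t - m)"
    have q: "q \<in> {a<..<b}" using s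
      unfolding q_def m_def greaterThanLessThan_iff abs_less_iff by (auto simp: field_simps)
    have "0 \<le> q" using q ab by auto
    have "S s v = S (t - m + q) v" by (simp add: q_def)
    also have "\<dots> = S (t - m) (S q v)" using S tm \<open>0 \<le> q\<close> unfolding C0_semigroup_def by blast
    also have "norm \<dots> \<le> norm (S q v) * K" by (rule K)
    also have "\<dots> \<le> (real n * norm v) * K" using K(1) bound[OF q] by (intro mult_right_mono) auto
    finally show "norm (S s v) \<le> real n * K * norm v" by (simp add: mult_ac)
  qed
qed

text \<open>
  The orbit solves the linear equation $u' = lu$. The definition of the generator yields only the right
  derivative; the local bound on the operators supplies the left one, so that $e^{-lt}u(t)$ has zero
  derivative and is constant. An inner product is used to reduce constancy to the real-valued case.
\<close>

lemma semigroup_eigenvector: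
  fixes v :: "'a::real_inner"
  assumes S: "C0_semigroup S" and gen: "(v, l *\<^sub>R v) \<in> generator S" and "0 \<le> t"
  shows "S t v = exp (l * t) *\<^sub>R v"
proof -
  have add: "S (s + r) w = S s (S r w)" if "0 \<le> s" "0 \<le> r" for s r w
    using S that by (simp add: C0_semigroup_def)
  have zero: "S 0 w = w" for w using S by (simp add: C0_semigroup_def)
  have lin: "bounded_linear (S s)" if "0 \<le> s" for s using S that by (simp add: C0_semigroup_def)
  have blin: "linear (S s)" if "0 \<le> s" for s using lin[OF that] by (rule bounded_linear.linear)
  have small: "\<exists>d>0. \<forall>h. 0 < h \<and> h < d \<longrightarrow> norm (S h v - v - (h * l) *\<^sub>R v) \<le> e * h \<and> norm (S h v - v) \<le> e"
    if "0 < e" for e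
  proof -
    have "eventually (\<lambda>h. dist ((S h v - v) /\<^sub>R h) (l *\<^sub>R v) < e) (at_right 0)"
      using gen that unfolding generator_def by (auto dest: tendstoD)
    moreover have "eventually (\<lambda>h. dist (S h v) v < e) (at_right 0)"
      using S that unfolding C0_semigroup_def by (auto dest: tendstoD)
    ultimately have "eventually (\<lambda>h. norm (S h v - v - (h * l) *\<^sub>R v) \<le> e * h \<and> norm (S h v - v) \<le> e) (at_right 0)"
      using eventually_at_right_less[of "0::real"]
    proof eventually_elim
      case (elim h)
      have "S h v - v - (h * l) *\<^sub>R v = h *\<^sub>R ((S h v - v) /\<^sub>R h - l *\<^sub>R v)"
        using elim(3) by (simp add: scaleR_diff_right)
      also have "norm \<dots> = h * dist ((S h v - v) /\<^sub>R h) (l *\<^sub>R v)"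
        using elim(3) by (simp add: dist_norm)
      also have "\<dots> \<le> h * e" using elim by (intro mult_left_mono) auto
      finally show ?case using elim(2) by (simp add: mult.commute dist_norm)
    qed
    then show ?thesis unfolding eventually_at_right_field by auto
  qed
  have deriv: "((\<lambda>s. S s v) has_derivative (\<lambda>h. h *\<^sub>R (l *\<^sub>R S t v))) (at t)" if "0 < t" for t
    unfolding has_derivative_at_alt
  proof (intro conjI allI impI)
    show "bounded_linear (\<lambda>h. h *\<^sub>R (l *\<^sub>R S t v))" by (rule bounded_linear_scaleR_left)
    fix e :: real assume "0 < e"
    obtain d K where K: "0 < d" "d \<le> t" "0 \<le> K" "\<And>s v. \<bar>s - t\<bar> < d \<Longrightarrow> norm (S s v) \<le> K * norm v"
      using C0_semigroup_bounded_near[OF S \<open>0 < t\<close>] by metis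
    \<comment> \<open>The factor $1+|l|$ is for the left derivative, where $lS_tv$ is compared with $lS_yv$;
      \<open>K + 1\<close> avoids a division by zero.\<close>
    define e' where "e' = e / ((K + 1) * (1 + \<bar>l\<bar>))"
    have e': "0 < e'" "K * e' * (1 + \<bar>l\<bar>) \<le> e"
    proof -
      have pos: "0 < (K + 1) * (1 + \<bar>l\<bar>)" using K(3) by (intro mult_pos_pos) auto
      then show "0 < e'" using \<open>0 < e\<close> by (simp add: e'_def)
      then have "K * e' * (1 + \<bar>l\<bar>) \<le> (K + 1) * e' * (1 + \<bar>l\<bar>)" by (intro mult_right_mono) auto
      also have "\<dots> = e" using pos by (simp add: e'_def field_simps)
      finally show "K * e' * (1 + \<bar>l\<bar>) \<le> e" .
    qed
    obtain d' where d': "0 < d'" "\<And>h. 0 < h \<Longrightarrow> h < d' \<Longrightarrow> norm (S h v - v - (h * l) *\<^sub>R v) \<le> e' * h"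
      "\<And>h. 0 < h \<Longrightarrow> h < d' \<Longrightarrow> norm (S h v - v) \<le> e'"
      using small[OF e'(1)] by blast
    have "norm (S y v - S t v - (y - t) *\<^sub>R (l *\<^sub>R S t v)) \<le> e * norm (y - t)"
      if y: "norm (y - t) < min d d'" for y
    proof (cases y t rule: linorder_cases)
      case equal
      then show ?thesis by simp
    next
      case greater
      define h where "h = y - t"
      have h: "0 < h" "h < d'" "y = t + h" using greater y by (auto simp: h_def)
      have "S y v - S t v - (y - t) *\<^sub>R (l *\<^sub>R S t v) = S t (S h v - v - (h * l) *\<^sub>R v)"
        using h \<open>0 < t\<close> by (simp add: add linear_diff[OF blin] linear_scale[OF blin])
      also have "norm \<dots> \<le> K * (e' * h)"
        using K(4)[of t "S h v - v - (h * l) *\<^sub>R v"] K(1) mult_left_mono[OF d'(2)[OF h(1,2)] K(3)] by simp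
      also have "\<dots> = K * e' * 1 * h" by simp
      also have "\<dots> \<le> K * e' * (1 + \<bar>l\<bar>) * h"
        using K e' h by (intro mult_right_mono mult_left_mono) auto
      also have "\<dots> \<le> e * h" using e' h by (intro mult_right_mono) auto
      finally show ?thesis using h by simp
    next
      case less
      define h where "h = t - y"
      have h: "0 < h" "h < d'" "t = y + h" "0 \<le> y" using less y K(2) by (auto simp: h_def)
      have Sy: "norm (S y w) \<le> K * norm w" for w using K(4)[of y w] y by simp
      have St: "S t v = S y (S h v)" using h add[of y h v] by simp
      have yt: "y - t = - h" by (simp add: h_def)
      have e: "S y (S h v - v) = S t v - S y v"
        "S y (S h v - v - (h * l) *\<^sub>R v) = S t v - S y v - (h * l) *\<^sub>R S y v"
        unfolding St using h by (simp_all add: linear_diff[OF blin] linear_scale[OF blin])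
      have "S y v - S t v - (y - t) *\<^sub>R (l *\<^sub>R S t v)
          = (h * l) *\<^sub>R S y (S h v - v) - S y (S h v - v - (h * l) *\<^sub>R v)"
        unfolding e yt by (simp add: algebra_simps)
      also have "norm \<dots> \<le> norm ((h * l) *\<^sub>R S y (S h v - v)) + norm (S y (S h v - v - (h * l) *\<^sub>R v))"
        by (rule norm_triangle_ineq4)
      also have "\<dots> \<le> (h * \<bar>l\<bar>) * (K * e') + K * (e' * h)"
      proof (rule add_mono)
        have "norm (S y (S h v - v)) \<le> K * e'"
          using Sy[of "S h v - v"] mult_left_mono[OF d'(3)[OF h(1,2)] K(3)] by simp
        then have "(h * \<bar>l\<bar>) * norm (S y (S h v - v)) \<le> (h * \<bar>l\<bar>) * (K * e')"
          using h by (intro mult_left_mono) auto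
        then show "norm ((h * l) *\<^sub>R S y (S h v - v)) \<le> (h * \<bar>l\<bar>) * (K * e')"
          using h by (simp add: abs_mult)
        show "norm (S y (S h v - v - (h * l) *\<^sub>R v)) \<le> K * (e' * h)"
          using Sy[of "S h v - v - (h * l) *\<^sub>R v"] mult_left_mono[OF d'(2)[OF h(1,2)] K(3)] by simp
      qed
      also have "\<dots> = K * e' * (1 + \<bar>l\<bar>) * h" by (simp add: algebra_simps)
      also have "\<dots> \<le> e * h" using e' h by (intro mult_right_mono) auto
      finally show ?thesis using h by simp
    qed
    then show "\<exists>d>0. \<forall>y. norm (y - t) < d \<longrightarrow> norm (S y v - S t v - (y - t) *\<^sub>R l *\<^sub>R S t v) \<le> e * norm (y - t)"
      using K(1) d'(1) by (intro exI[of _ "min d d'"]) auto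
  qed
  define G where "G s = exp (- l * s) *\<^sub>R S s v" for s
  have G_deriv: "(G has_derivative (\<lambda>_. 0)) (at s)" if "0 < s" for s
  proof -
    have e: "((\<lambda>s. exp (- l * s)) has_derivative (\<lambda>h. h * (- l * exp (- l * s)))) (at s)"
      by (auto intro!: derivative_eq_intros)
    show ?thesis
      unfolding G_def by (rule has_derivative_eq_rhs[OF has_derivative_scaleR[OF e deriv[OF that]]])
        (simp add: fun_eq_iff)
  qed
  have G_cont: "continuous_on {0..t} G"
    unfolding continuous_on_eq_continuous_within
  proof
    fix s assume s: "s \<in> {0..t}"
    show "continuous (at s within {0..t}) G"
    proof (cases "s = 0")
      case True
      have "((\<lambda>s. exp (- l * s)) \<longlongrightarrow> exp (- l * 0)) (at_right 0)" by (intro tendsto_intros)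
      then have "(G \<longlongrightarrow> exp (- l * 0) *\<^sub>R S 0 v) (at_right 0)"
        unfolding G_def by (intro tendsto_scaleR C0_semigroup_right_continuous[OF S]) auto
      then have "(G \<longlongrightarrow> G 0) (at_right 0)" by (simp add: G_def)
      then show ?thesis
        unfolding True continuous_within by (rule tendsto_mono[rotated]) (auto simp: at_within_def intro!: le_infI2)
    next
      case False
      then have "0 < s" using s by simp
      from has_derivative_continuous[OF has_derivative_at_withinI[OF G_deriv[OF this]]]
      show ?thesis .
    qed
  qed
  have "inner (G t) u = inner (G 0) u" for u
  proof (rule has_derivative_zero_unique_strong_interval[of "{0}" 0 t "\<lambda>s. inner (G s) u"])
    show "continuous_on {0..t} (\<lambda>s. inner (G s) u)" by (intro continuous_intros G_cont)
    show "((\<lambda>s. inner (G s) u) has_derivative (\<lambda>h. 0)) (at s within {0..t})" if "s \<in> {0..t} - {0}" for s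
    proof -
      have "0 < s" using that by simp
      then have "(G has_derivative (\<lambda>_. 0)) (at s within {0..t})"
        by (rule has_derivative_at_withinI[OF G_deriv])
      then have "((\<lambda>s. inner (G s) u) has_derivative (\<lambda>h. inner 0 u)) (at s within {0..t})"
        by (rule bounded_linear.has_derivative[OF bounded_linear_inner_left])
      then show ?thesis by simp
    qed
  qed (use \<open>0 \<le> t\<close> in auto)
  then have "inner (G t - G 0) (G t - G 0) = 0" by (simp only: inner_diff_left diff_self)
  then have "G t = G 0" by simp
  then have "exp (l * t) *\<^sub>R (exp (- l * t) *\<^sub>R S t v) = exp (l * t) *\<^sub>R v"
    by (simp add: G_def zero)
  then show ?thesis by (simp flip: exp_add)
qed

text \<open>
  The sine functions are smooth and vanish at both ends, so they lie in the domain, with two classical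
  derivatives as witnesses.
\<close>

lemma sine_basis_laplacian:
  "(sine_basis m, - (\<nu> * (real m * pi)\<^sup>2) *\<^sub>R sine_basis m) \<in> dirichlet_laplacian \<nu>"
proof -
  define c where "c = real m * pi"
  define u where "u x = sqrt 2 * sin (c * x)" for x
  define u1 where "u1 x = sqrt 2 * c * cos (c * x)" for x
  define u2 where "u2 x = - c\<^sup>2 * u x" for x
  have sq: "sq_integrable u" unfolding u_def by (intro sq_integrable_continuous continuous_intros)
  have sq2: "sq_integrable u2" unfolding u2_def by (rule sq_integrable_scale[OF sq])
  have d1: "(u has_vector_derivative u1 x) (at x within A)" for x A
    unfolding has_real_derivative_iff_has_vector_derivative[symmetric] u_def u1_def
    by (auto intro!: derivative_eq_intros)
  have d2: "(u1 has_vector_derivative u2 x) (at x within A)" for x A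
    unfolding has_real_derivative_iff_has_vector_derivative[symmetric] u_def u1_def u2_def
    by (auto intro!: derivative_eq_intros simp: power2_eq_square)
  have "u x = u 0 + integral {0..x} u1 \<and> u1 x = u1 0 + integral {0..x} u2" if "x \<in> {0..1}" for x
    using that integral_unique[OF fundamental_theorem_of_calculus[of 0 x u u1]] d1
      integral_unique[OF fundamental_theorem_of_calculus[of 0 x u1 u2]] d2 by auto
  moreover have "u 0 = 0" "u 1 = 0" by (auto simp: u_def c_def sin_zero_iff_int2 intro!: exI[of _ "int m"])
  ultimately have "(abs_l2 u, \<nu> *\<^sub>R abs_l2 u2) \<in> dirichlet_laplacian \<nu>"
    unfolding dirichlet_laplacian_def using sq sq2 by blast
  moreover have "abs_l2 u2 = - c\<^sup>2 *\<^sub>R abs_l2 u"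
    unfolding u2_def using sq by (intro scaleR_l2.abs_eq[symmetric]) (simp add: l2_rel_def)
  moreover have "abs_l2 u = sine_basis m" unfolding u_def c_def by (rule sine_basis.abs_eq[symmetric])
  ultimately show ?thesis by (simp add: c_def)
qed

lemma exp_semigroup_sine_basis:
  assumes "is_exp_semigroup (dirichlet_laplacian \<nu>) S" "0 \<le> t"
  shows "S t (sine_basis m) = exp (- (\<nu> * (real m * pi)\<^sup>2) * t) *\<^sub>R sine_basis m"
proof (rule semigroup_eigenvector)
  show "C0_semigroup S" using assms(1) by (simp add: is_exp_semigroup_def)
  show "(sine_basis m, - (\<nu> * (real m * pi)\<^sup>2) *\<^sub>R sine_basis m) \<in> generator S"
    using assms(1) sine_basis_laplacian[of m \<nu>] by (simp add: is_exp_semigroup_def)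
qed fact

section \<open>Weakly measurable maps into \<open>H\<close>\<close>

text \<open>
  Borel measurability passes to sums only with the help of a countable base of the range.
  Measurability of all scalar products is preserved by linear operations without any such argument, and
  by Parseval's identity it suffices for integrating squared norms.
\<close>

definition weakly_measurable :: "'a measure \<Rightarrow> ('a \<Rightarrow> l2) \<Rightarrow> bool" where
  "weakly_measurable M Y \<longleftrightarrow> (\<forall>u. (\<lambda>x. inner u (Y x)) \<in> borel_measurable M)"

lemma weakly_measurable_add:
  "weakly_measurable M Y \<Longrightarrow> weakly_measurable M Z \<Longrightarrow> weakly_measurable M (\<lambda>x. Y x + Z x)"
  unfolding weakly_measurable_def inner_add_right by (intro allI borel_measurable_add) auto

lemma weakly_measurable_diff:
  "weakly_measurable M Y \<Longrightarrow> weakly_measurable M Z \<Longrightarrow> weakly_measurable M (\<lambda>x. Y x - Z x)"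
  unfolding weakly_measurable_def inner_diff_right by (intro allI borel_measurable_diff) auto

lemma weakly_measurable_sum:
  "(\<And>i. i \<in> I \<Longrightarrow> weakly_measurable M (Y i)) \<Longrightarrow> weakly_measurable M (\<lambda>x. \<Sum>i\<in>I. Y i x)"
  unfolding weakly_measurable_def inner_sum_right by (intro allI borel_measurable_sum) auto

lemma weakly_measurable_scaleR:
  "f \<in> borel_measurable M \<Longrightarrow> weakly_measurable M (\<lambda>x. f x *\<^sub>R w)"
  by (simp add: weakly_measurable_def)

lemma weakly_measurable_borel:
  assumes "Y \<in> borel_measurable M"
  shows "weakly_measurable M Y"
proof -
  have "continuous_on UNIV (inner u)" for u :: l2 by (intro continuous_intros)
  from borel_measurable_continuous_onI[OF this] have "inner u \<in> borel_measurable borel" for u :: l2 .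
  from measurable_compose[OF assms this] show ?thesis by (simp add: weakly_measurable_def)
qed

lemma measurable_norm_sq:
  assumes "weakly_measurable M Y"
  shows "(\<lambda>x. ennreal ((norm (Y x))\<^sup>2)) \<in> borel_measurable M"
proof -
  have "(\<lambda>x. inner (Y x) (sine_basis (Suc m))) \<in> borel_measurable M" for m
    unfolding inner_commute[of "Y _"] using assms by (simp add: weakly_measurable_def)
  moreover have "(norm (Y x))\<^sup>2 = (\<Sum>m. (inner (Y x) (sine_basis (Suc m)))\<^sup>2)" for x
    by (rule sums_unique[OF l2_parseval])
  ultimately show ?thesis by simp
qed

text \<open>
  Young's inequality; the weight \<open>d\<close> lets the first coefficient tend to \<open>1\<close> while the second
  one multiplies a term that vanishes in the limit.
\<close>

lemma norm_add_sq_le: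
  fixes x y :: "'a::real_normed_vector"
  assumes "0 < d"
  shows "(norm (x + y))\<^sup>2 \<le> (1 + d) * (norm x)\<^sup>2 + (1 + 1 / d) * (norm y)\<^sup>2"
proof -
  have "(norm (x + y))\<^sup>2 \<le> (norm x + norm y)\<^sup>2"
    by (intro power_mono norm_triangle_ineq) auto
  also have "\<dots> = (1 + d) * (norm x)\<^sup>2 + (1 + 1 / d) * (norm y)\<^sup>2 - (d * norm x - norm y)\<^sup>2 / d"
    using assms by (simp add: field_simps power2_eq_square)
  also have "\<dots> \<le> (1 + d) * (norm x)\<^sup>2 + (1 + 1 / d) * (norm y)\<^sup>2" using assms by simp
  finally show ?thesis .
qed

lemma ennreal_norm_add_sq_le:
  fixes x y :: "'a::real_normed_vector"
  assumes "0 < d"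
  shows "ennreal ((norm (x + y))\<^sup>2)
    \<le> ennreal (1 + d) * ennreal ((norm x)\<^sup>2) + ennreal (1 + 1 / d) * ennreal ((norm y)\<^sup>2)"
  using norm_add_sq_le[OF assms, of x y] assms
  by (simp flip: ennreal_mult ennreal_plus) 

lemma nn_integral_norm_add_sq_le:
  assumes "weakly_measurable M Y" "weakly_measurable M Z" "0 < d"
  shows "(\<integral>\<^sup>+x. ennreal ((norm (Y x + Z x))\<^sup>2) \<partial>M)
    \<le> ennreal (1 + d) * (\<integral>\<^sup>+x. ennreal ((norm (Y x))\<^sup>2) \<partial>M) + ennreal (1 + 1 / d) * (\<integral>\<^sup>+x. ennreal ((norm (Z x))\<^sup>2) \<partial>M)"
proof -
  note [measurable] = measurable_norm_sq[OF assms(1)] measurable_norm_sq[OF assms(2)]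
  have "(\<integral>\<^sup>+x. ennreal ((norm (Y x + Z x))\<^sup>2) \<partial>M)
    \<le> (\<integral>\<^sup>+x. ennreal (1 + d) * ennreal ((norm (Y x))\<^sup>2) + ennreal (1 + 1 / d) * ennreal ((norm (Z x))\<^sup>2) \<partial>M)"
    by (intro nn_integral_mono ennreal_norm_add_sq_le assms)
  also have "\<dots> = ennreal (1 + d) * (\<integral>\<^sup>+x. ennreal ((norm (Y x))\<^sup>2) \<partial>M)
      + ennreal (1 + 1 / d) * (\<integral>\<^sup>+x. ennreal ((norm (Z x))\<^sup>2) \<partial>M)"
    unfolding nn_integral_cmult[OF measurable_norm_sq[OF assms(1)], symmetric]
      nn_integral_cmult[OF measurable_norm_sq[OF assms(2)], symmetric]
    by (rule nn_integral_add) measurable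
  finally show ?thesis .
qed

lemma measurable_HS_norm_sq:
  assumes "\<And>v. weakly_measurable M (\<lambda>s. \<Phi> s v)"
  shows "(\<lambda>s. HS_norm_sq (\<Phi> s)) \<in> borel_measurable M"
  unfolding HS_norm_sq_def by (intro borel_measurable_suminf_order measurable_norm_sq assms)

lemma nn_integral_HS_add_sq_le:
  assumes "\<And>v. weakly_measurable M (\<lambda>s. \<Phi> s v)" "\<And>v. weakly_measurable M (\<lambda>s. \<Psi> s v)" "0 < d"
  shows "(\<integral>\<^sup>+s. HS_norm_sq (\<lambda>v. \<Phi> s v + \<Psi> s v) \<partial>M)
    \<le> ennreal (1 + d) * (\<integral>\<^sup>+s. HS_norm_sq (\<Phi> s) \<partial>M) + ennreal (1 + 1 / d) * (\<integral>\<^sup>+s. HS_norm_sq (\<Psi> s) \<partial>M)"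
proof -
  note [measurable] = measurable_HS_norm_sq[of M \<Phi>, OF assms(1)] measurable_HS_norm_sq[of M \<Psi>, OF assms(2)]
  have "HS_norm_sq (\<lambda>v. \<Phi> s v + \<Psi> s v) \<le> ennreal (1 + d) * HS_norm_sq (\<Phi> s) + ennreal (1 + 1 / d) * HS_norm_sq (\<Psi> s)" for s
  proof -
    have "HS_norm_sq (\<lambda>v. \<Phi> s v + \<Psi> s v)
      \<le> (\<Sum>m. ennreal (1 + d) * ennreal ((norm (\<Phi> s (sine_basis (Suc m))))\<^sup>2)
             + ennreal (1 + 1 / d) * ennreal ((norm (\<Psi> s (sine_basis (Suc m))))\<^sup>2))"
      unfolding HS_norm_sq_def by (intro suminf_le ennreal_norm_add_sq_le assms) auto
    then show ?thesis
      by (simp add: HS_norm_sq_def suminf_add[symmetric])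
  qed
  then have "(\<integral>\<^sup>+s. HS_norm_sq (\<lambda>v. \<Phi> s v + \<Psi> s v) \<partial>M)
      \<le> (\<integral>\<^sup>+s. ennreal (1 + d) * HS_norm_sq (\<Phi> s) + ennreal (1 + 1 / d) * HS_norm_sq (\<Psi> s) \<partial>M)"
    by (intro nn_integral_mono)
  also have "\<dots> = ennreal (1 + d) * (\<integral>\<^sup>+s. HS_norm_sq (\<Phi> s) \<partial>M) + ennreal (1 + 1 / d) * (\<integral>\<^sup>+s. HS_norm_sq (\<Psi> s) \<partial>M)"
    by (simp add: nn_integral_add nn_integral_cmult)
  finally show ?thesis .
qed

text \<open>
  The limit passage for an isometry: \<open>B n\<close> is the common squared norm of the approximations of two
  objects with squared norms \<open>A\<close> and \<open>A'\<close>, and \<open>C n\<close>, \<open>C' n\<close> are the squared distances.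
  Letting \<open>n\<close> tend to infinity gives $A\le(1+d)^2A'$, and then \<open>d\<close> tends to \<open>0\<close>.
\<close>

lemma ennreal_approximation_le:
  fixes A A' :: ennreal
  assumes A: "\<And>d n. 0 < d \<Longrightarrow> A \<le> ennreal (1 + d) * B n + ennreal (1 + 1 / d) * C n"
    and B: "\<And>d n. 0 < d \<Longrightarrow> B n \<le> ennreal (1 + d) * A' + ennreal (1 + 1 / d) * C' n"
    and lim: "C \<longlonglongrightarrow> 0" "C' \<longlonglongrightarrow> 0"
  shows "A \<le> A'"
proof (cases A')
  case top
  then show ?thesis by simp
next
  case (real a)
  have le: "A \<le> ennreal ((1 + d)\<^sup>2 * a)" if "0 < d" for d
  proof -
    have "A \<le> ennreal (1 + d) * (ennreal (1 + d) * A' + ennreal (1 + 1 / d) * C' n) + ennreal (1 + 1 / d) * C n" for n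
      by (rule order_trans[OF A[OF that, of n]]) (intro add_right_mono mult_left_mono B that zero_le)
    moreover have "(\<lambda>n. ennreal (1 + d) * (ennreal (1 + d) * A' + ennreal (1 + 1 / d) * C' n) + ennreal (1 + 1 / d) * C n)
        \<longlonglongrightarrow> ennreal (1 + d) * (ennreal (1 + d) * A' + ennreal (1 + 1 / d) * 0) + ennreal (1 + 1 / d) * 0"
      by (intro tendsto_add ennreal_tendsto_cmult tendsto_const lim) auto
    ultimately have "A \<le> ennreal (1 + d) * (ennreal (1 + d) * A')"
      by (intro LIMSEQ_le_const) auto
    moreover have "ennreal (1 + d) * (ennreal (1 + d) * A') = ennreal ((1 + d)\<^sup>2 * a)"
      using real that by (simp add: ennreal_mult power2_eq_square mult.assoc del: ennreal_plus)
    ultimately show ?thesis by simp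
  qed
  have "(\<lambda>n. ennreal ((1 + 1 / real (Suc n))\<^sup>2 * a)) \<longlonglongrightarrow> ennreal ((1 + 0)\<^sup>2 * a)"
    by (intro tendsto_intros tendsto_ennrealI LIMSEQ_Suc[OF lim_1_over_n])
  then have "A \<le> ennreal ((1 + 0)\<^sup>2 * a)"
    by (rule LIMSEQ_le_const) (use le in auto)
  then show ?thesis using real by simp
qed

section \<open>The Ito isometry\<close>

lemma integrable_square_mult:
  fixes X Y :: "'a \<Rightarrow> real"
  assumes "integrable M (\<lambda>x. (X x)\<^sup>2)" "integrable M (\<lambda>x. (Y x)\<^sup>2)"
    "X \<in> borel_measurable M" "Y \<in> borel_measurable M"
  shows "integrable M (\<lambda>x. X x * Y x)"
proof (rule Bochner_Integration.integrable_bound)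
  show "integrable M (\<lambda>x. (X x)\<^sup>2 + (Y x)\<^sup>2)" using assms by simp
  show "AE x in M. norm (X x * Y x) \<le> norm ((X x)\<^sup>2 + (Y x)\<^sup>2)"
  proof (rule AE_I2)
    fix x
    have "2 * (\<bar>X x\<bar> * \<bar>Y x\<bar>) \<le> (X x)\<^sup>2 + (Y x)\<^sup>2"
      using sum_squares_bound[of "\<bar>X x\<bar>" "\<bar>Y x\<bar>"] by (simp add: mult.assoc)
    moreover have "0 \<le> \<bar>X x\<bar> * \<bar>Y x\<bar>" by simp
    ultimately have "\<bar>X x\<bar> * \<bar>Y x\<bar> \<le> (X x)\<^sup>2 + (Y x)\<^sup>2" by linarith
    then show "norm (X x * Y x) \<le> norm ((X x)\<^sup>2 + (Y x)\<^sup>2)" by (simp add: abs_mult)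
  qed
qed (use assms in measurable)

locale wiener = prob_space \<PP> for \<PP> :: "'w measure" +
  fixes T :: real and W :: "real \<Rightarrow> l2 \<Rightarrow> 'w \<Rightarrow> real"
  assumes cylindrical: "cylindrical_wiener \<PP> T W"
begin

lemma W_measurable [measurable]: "0 \<le> t \<Longrightarrow> t \<le> T \<Longrightarrow> W t v \<in> borel_measurable \<PP>"
  using cylindrical by (simp add: cylindrical_wiener_def)

lemma W_linear:
  "0 \<le> t \<Longrightarrow> t \<le> T \<Longrightarrow> AE \<omega> in \<PP>. W t (a *\<^sub>R u + b *\<^sub>R v) \<omega> = a * W t u \<omega> + b * W t v \<omega>"
  using cylindrical by (simp add: cylindrical_wiener_def)

lemma W_start: "AE \<omega> in \<PP>. W 0 v \<omega> = 0"
  using cylindrical by (simp add: cylindrical_wiener_def)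

text \<open>
  The degenerate cases \<open>s = t\<close> and \<open>v = 0\<close> are separate because the Gaussian density is only
  given for a positive variance; for \<open>v = 0\<close> the process vanishes by linearity.
\<close>

lemma increment_moments:
  assumes "0 \<le> s" "s \<le> t" "t \<le> T"
  shows "has_bochner_integral \<PP> (\<lambda>\<omega>. W t v \<omega> - W s v \<omega>) 0"
    and "has_bochner_integral \<PP> (\<lambda>\<omega>. (W t v \<omega> - W s v \<omega>)\<^sup>2) ((t - s) * (norm v)\<^sup>2)"
proof -
  let ?D = "\<lambda>\<omega>. W t v \<omega> - W s v \<omega>"
  have D_meas: "?D \<in> borel_measurable \<PP>" using assms by (intro borel_measurable_diff W_measurable) auto
  have "has_bochner_integral \<PP> ?D 0
      \<and> has_bochner_integral \<PP> (\<lambda>\<omega>. (?D \<omega>)\<^sup>2) ((t - s) * (norm v)\<^sup>2)"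
  proof (cases "s = t \<or> v = 0")
    case True
    have "AE \<omega> in \<PP>. ?D \<omega> = 0"
    proof (cases "s = t")
      case False
      then have "v = 0" using True by simp
      have "AE \<omega> in \<PP>. W r 0 \<omega> = 0" if "0 \<le> r" "r \<le> T" for r
        using W_linear[OF that, of 0 0 0 0] by simp
      from this[of s] this[of t] show ?thesis using assms \<open>v = 0\<close> by auto
    qed simp
    then have "has_bochner_integral \<PP> ?D 0 \<longleftrightarrow> has_bochner_integral \<PP> (\<lambda>_. 0::real) 0"
      "has_bochner_integral \<PP> (\<lambda>\<omega>. (?D \<omega>)\<^sup>2) 0 \<longleftrightarrow> has_bochner_integral \<PP> (\<lambda>_. 0::real) 0"
      using D_meas by (intro has_bochner_integral_cong_AE; force)+
    moreover have "(t - s) * (norm v)\<^sup>2 = 0" using True by auto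
    ultimately show ?thesis by (simp only: has_bochner_integral_zero simp_thms)
  next
    case False
    define \<sigma> where "\<sigma> = sqrt (t - s) * norm v"
    have \<sigma>: "0 < \<sigma>" "\<sigma>\<^sup>2 = (t - s) * (norm v)\<^sup>2" using False assms by (auto simp: \<sigma>_def power_mult_distrib)
    have D: "distributed \<PP> lborel ?D (\<lambda>x. ennreal (normal_density 0 \<sigma> x))"
      using cylindrical False assms unfolding cylindrical_wiener_def \<sigma>_def by auto
    have "integrable \<PP> ?D" "integral\<^sup>L \<PP> ?D = 0"
      using distributed_integrable[OF D, of "\<lambda>x. x"] integrable_normal_moment_nz_1[OF \<sigma>(1), of 0]
        normal_distributed_expectation[OF \<sigma>(1) D] by auto
    moreover have "integrable \<PP> (\<lambda>\<omega>. (?D \<omega>)\<^sup>2)"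
      using distributed_integrable[OF D, of "\<lambda>x. x\<^sup>2"] integrable_normal_moment[OF \<sigma>(1), of 0 2] by simp
    moreover have "integral\<^sup>L \<PP> (\<lambda>\<omega>. (?D \<omega>)\<^sup>2) = \<sigma>\<^sup>2"
      using normal_distributed_variance[OF \<sigma>(1) D] calculation(2) by simp
    ultimately show ?thesis using \<sigma>(2) by (simp add: has_bochner_integral_iff)
  qed
  then show "has_bochner_integral \<PP> ?D 0"
    and "has_bochner_integral \<PP> (\<lambda>\<omega>. (?D \<omega>)\<^sup>2) ((t - s) * (norm v)\<^sup>2)" by auto
qed

lemma W_moments:
  assumes "0 \<le> t" "t \<le> T"
  shows "has_bochner_integral \<PP> (W t v) 0" and "has_bochner_integral \<PP> (\<lambda>\<omega>. (W t v \<omega>)\<^sup>2) (t * (norm v)\<^sup>2)"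
proof -
  have meas: "W t v \<in> borel_measurable \<PP>" "W 0 v \<in> borel_measurable \<PP>"
    using assms by (auto intro: W_measurable)
  have "AE \<omega> in \<PP>. W t v \<omega> - W 0 v \<omega> = W t v \<omega>" "AE \<omega> in \<PP>. (W t v \<omega> - W 0 v \<omega>)\<^sup>2 = (W t v \<omega>)\<^sup>2"
    using W_start[of v] by (eventually_elim; simp)+
  then have "has_bochner_integral \<PP> (\<lambda>\<omega>. W t v \<omega> - W 0 v \<omega>) 0 \<longleftrightarrow> has_bochner_integral \<PP> (W t v) 0"
    "has_bochner_integral \<PP> (\<lambda>\<omega>. (W t v \<omega> - W 0 v \<omega>)\<^sup>2) x \<longleftrightarrow> has_bochner_integral \<PP> (\<lambda>\<omega>. (W t v \<omega>)\<^sup>2) x" for x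
    using meas by (intro has_bochner_integral_cong_AE borel_measurable_diff borel_measurable_power; simp)+
  then show "has_bochner_integral \<PP> (W t v) 0" and "has_bochner_integral \<PP> (\<lambda>\<omega>. (W t v \<omega>)\<^sup>2) (t * (norm v)\<^sup>2)"
    using increment_moments[of 0 t v] assms by simp_all
qed

lemma W_product_integrable:
  assumes "0 \<le> s" "s \<le> T" "0 \<le> t" "t \<le> T"
  shows "integrable \<PP> (\<lambda>\<omega>. W s g \<omega> * W t h \<omega>)"
  using assms W_moments(2)[of s g] W_moments(2)[of t h]
  by (intro integrable_square_mult) (auto simp: has_bochner_integral_iff)

text \<open>
  At equal times, polarisation of the variance. For \<open>s < t\<close> the increment after \<open>s\<close> is centred
  and independent of the value at \<open>s\<close>, so it contributes nothing.
\<close>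

lemma covariance_ordered:
  assumes "0 \<le> s" "s \<le> t" "t \<le> T"
  shows "expectation (\<lambda>\<omega>. W s g \<omega> * W t h \<omega>) = s * inner g h"
proof -
  have s: "0 \<le> s" "s \<le> T" and t: "0 \<le> t" "t \<le> T" using assms by auto
  have same: "expectation (\<lambda>\<omega>. W s g \<omega> * W s h \<omega>) = s * inner g h"
  proof -
    have "expectation (\<lambda>\<omega>. (W s (g + h) \<omega>)\<^sup>2)
        = expectation (\<lambda>\<omega>. (W s g \<omega>)\<^sup>2 + (W s h \<omega>)\<^sup>2 + 2 * (W s g \<omega> * W s h \<omega>))"
    proof (rule integral_cong_AE)
      show "AE \<omega> in \<PP>. (W s (g + h) \<omega>)\<^sup>2 = (W s g \<omega>)\<^sup>2 + (W s h \<omega>)\<^sup>2 + 2 * (W s g \<omega> * W s h \<omega>)"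
        using W_linear[OF s, of 1 g 1 h] by eventually_elim (simp add: power2_sum)
    qed (use s in measurable)
    also have "\<dots> = s * (norm g)\<^sup>2 + s * (norm h)\<^sup>2 + 2 * expectation (\<lambda>\<omega>. W s g \<omega> * W s h \<omega>)"
      using W_moments(2)[OF s, of g] W_moments(2)[OF s, of h] W_product_integrable[OF s s, of g h]
      by (simp add: has_bochner_integral_iff)
    finally have "s * (norm (g + h))\<^sup>2 = s * (norm g)\<^sup>2 + s * (norm h)\<^sup>2 + 2 * expectation (\<lambda>\<omega>. W s g \<omega> * W s h \<omega>)"
      using W_moments(2)[OF s, of "g + h"] by (simp add: has_bochner_integral_iff)
    then show ?thesis
      by (simp add: power2_norm_eq_inner inner_add_left inner_add_right inner_commute algebra_simps)
  qed
  show ?thesis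
  proof (cases "s = t")
    case True
    then show ?thesis using same by simp
  next
    case False
    let ?D = "\<lambda>\<omega>. W t h \<omega> - W s h \<omega>"
    have meas: "W s g \<in> borel_measurable \<PP>" "?D \<in> borel_measurable \<PP>"
      using s t by (auto intro!: W_measurable borel_measurable_diff)
    have "indep_set (past_events \<PP> W s) (increment_events \<PP> W s t)"
      using cylindrical False assms unfolding cylindrical_wiener_def by auto
    moreover have "sigma_sets (space \<PP>) {W s g -` A \<inter> space \<PP> |A. A \<in> sets borel} \<subseteq> past_events \<PP> W s"
      unfolding past_events_def using s by (intro sigma_sets_mono') auto
    moreover have "sigma_sets (space \<PP>) {?D -` A \<inter> space \<PP> |A. A \<in> sets borel} \<subseteq> increment_events \<PP> W s t"
      unfolding increment_events_def by (intro sigma_sets_mono') auto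
    ultimately have "indep_set (sigma_sets (space \<PP>) {W s g -` A \<inter> space \<PP> |A. A \<in> sets borel})
       (sigma_sets (space \<PP>) {?D -` A \<inter> space \<PP> |A. A \<in> sets borel})"
      unfolding indep_sets2_eq by blast
    then have ind: "indep_var borel (W s g) borel ?D" using meas unfolding indep_var_eq by simp
    have int: "integrable \<PP> (W s g)" "integrable \<PP> ?D" "expectation ?D = 0"
      using W_moments(1)[OF s, of g] increment_moments(1)[OF assms, of h] by (auto simp: has_bochner_integral_iff)
    have "expectation (\<lambda>\<omega>. W s g \<omega> * W t h \<omega>) = expectation (\<lambda>\<omega>. W s g \<omega> * W s h \<omega> + W s g \<omega> * ?D \<omega>)"
      by (simp add: algebra_simps)
    also have "\<dots> = s * inner g h + expectation (W s g) * expectation ?D"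
      using indep_var_lebesgue_integral[OF ind int(1,2)] indep_var_integrable[OF ind int(1,2)]
        W_product_integrable[OF s s, of g h] same by simp
    finally show ?thesis using int(3) by simp
  qed
qed

lemma covariance:
  assumes "0 \<le> s" "s \<le> T" "0 \<le> t" "t \<le> T"
  shows "expectation (\<lambda>\<omega>. W s g \<omega> * W t h \<omega>) = min s t * inner g h"
proof (cases "s \<le> t")
  case True
  then show ?thesis using covariance_ordered[of s t g h] assms by simp
next
  case False
  then show ?thesis using covariance_ordered[of t s h g] assms by (simp add: mult.commute inner_commute)
qed

lemma increment_covariance:
  assumes "0 \<le> a" "a \<le> b" "b \<le> T" "0 \<le> c" "c \<le> d" "d \<le> T"
  shows "has_bochner_integral \<PP> (\<lambda>\<omega>. (W b g \<omega> - W a g \<omega>) * (W d h \<omega> - W c h \<omega>))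
    (measure lborel ({a<..b} \<inter> {c<..d}) * inner g h)"
proof -
  have bochner: "has_bochner_integral \<PP> (\<lambda>\<omega>. W b g \<omega> * W d h \<omega> - W b g \<omega> * W c h \<omega> - W a g \<omega> * W d h \<omega> + W a g \<omega> * W c h \<omega>)
     (min b d * inner g h - min b c * inner g h - min a d * inner g h + min a c * inner g h)"
    using assms
    by (intro has_bochner_integral_add has_bochner_integral_diff)
       (auto simp: has_bochner_integral_iff covariance W_product_integrable)
  have "measure lborel ({a<..b} \<inter> {c<..d}) = min b d - min b c - min a d + min a c"
  proof -
    have "{a<..b} \<inter> {c<..d} = {max a c<..min b d}" by auto
    then show ?thesis using assms by (cases "max a c \<le> min b d") (auto simp: min_def max_def split: if_splits)
  qed
  then have "min b d * inner g h - min b c * inner g h - min a d * inner g h + min a c * inner g h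
      = measure lborel ({a<..b} \<inter> {c<..d}) * inner g h"
    by (simp only: left_diff_distrib distrib_right)
  moreover have "W b g \<omega> * W d h \<omega> - W b g \<omega> * W c h \<omega> - W a g \<omega> * W d h \<omega> + W a g \<omega> * W c h \<omega>
      = (W b g \<omega> - W a g \<omega>) * (W d h \<omega> - W c h \<omega>)" for \<omega>
    by (simp add: algebra_simps)
  ultimately show ?thesis using bochner by simp
qed

text \<open>
  Indexed families in place of lists of quadruples, so that squared norms become double sums.
\<close>

lemma elementary_increments:
  assumes "elementary_on t xs"
  obtains a b g f where
    "\<And>i. i < length xs \<Longrightarrow> 0 \<le> a i \<and> a i \<le> b i \<and> b i \<le> t"
    "\<And>\<omega>. elementary_integral W xs \<omega> = (\<Sum>i<length xs. (W (b i) (g i) \<omega> - W (a i) (g i) \<omega>) *\<^sub>R f i)"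
    "\<And>s v. elementary_op xs s v = (\<Sum>i<length xs. (indicator {a i<..b i} s * inner (g i) v) *\<^sub>R f i)"
proof
  define a where "a i = fst (xs ! i)" for i
  define b where "b i = fst (snd (xs ! i))" for i
  define g where "g i = fst (snd (snd (xs ! i)))" for i
  define f where "f i = snd (snd (snd (xs ! i)))" for i
  have xs: "xs ! i = (a i, b i, g i, f i)" for i by (simp add: a_def b_def g_def f_def)
  show "0 \<le> a i \<and> a i \<le> b i \<and> b i \<le> t" if "i < length xs" for i
    using assms nth_mem[OF that] unfolding elementary_on_def xs by fastforce
  show "elementary_integral W xs \<omega> = (\<Sum>i<length xs. (W (b i) (g i) \<omega> - W (a i) (g i) \<omega>) *\<^sub>R f i)" for \<omega>
    unfolding elementary_integral_def by (simp add: sum_list_sum_nth atLeast0LessThan xs)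
  show "elementary_op xs s v = (\<Sum>i<length xs. (indicator {a i<..b i} s * inner (g i) v) *\<^sub>R f i)" for s v
    unfolding elementary_op_def by (simp add: sum_list_sum_nth atLeast0LessThan xs)
qed

lemma elementary_integral_weakly_measurable:
  assumes "elementary_on t xs" "t \<le> T"
  shows "weakly_measurable \<PP> (elementary_integral W xs)"
proof -
  obtain a b g f where *: "\<And>i. i < length xs \<Longrightarrow> 0 \<le> a i \<and> a i \<le> b i \<and> b i \<le> t"
    "\<And>\<omega>. elementary_integral W xs \<omega> = (\<Sum>i<length xs. (W (b i) (g i) \<omega> - W (a i) (g i) \<omega>) *\<^sub>R f i)"
    by (rule elementary_increments[OF assms(1)]) (rule that)
  have "W (b i) (g i) \<in> borel_measurable \<PP>" "W (a i) (g i) \<in> borel_measurable \<PP>" if "i < length xs" for i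
    using *(1)[OF that] assms(2) by (auto intro!: W_measurable)
  then show ?thesis
    unfolding *(2)[abs_def]
    by (intro weakly_measurable_sum weakly_measurable_scaleR borel_measurable_diff) auto
qed

lemma elementary_op_weakly_measurable: "weakly_measurable M (\<lambda>s. elementary_op xs s v)"
  if "sets M = sets borel" for M :: "real measure"
proof (induction xs)
  case Nil
  then show ?case by (simp add: weakly_measurable_def elementary_op_def)
next
  case (Cons x xs)
  obtain a b g f where x: "x = (a, b, g, f)" by (cases x)
  have "weakly_measurable M (\<lambda>s. (indicator {a<..b} s * inner g v) *\<^sub>R f + elementary_op xs s v)"
    using that by (intro weakly_measurable_add weakly_measurable_scaleR Cons.IH) (auto cong: measurable_cong_sets)
  then show ?case by (simp add: elementary_op_def x)
qed

text \<open>
  Both sides expand into the double sum over pairs of entries of the length of the common time interval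
  times $\langle g_i,g_j\rangle\langle f_i,f_j\rangle$: on the left by the covariance of the increments, on
  the right by Parseval's identity, which sums $\langle g_i,e_m\rangle\langle g_j,e_m\rangle$ over the
  basis.
\<close>

lemma elementary_isometry:
  assumes "elementary_on t xs" "t \<le> T"
  shows "(\<integral>\<^sup>+\<omega>. ennreal ((norm (elementary_integral W xs \<omega>))\<^sup>2) \<partial>\<PP>)
    = (\<integral>\<^sup>+s\<in>{0..t}. HS_norm_sq (elementary_op xs s) \<partial>lborel)"
proof -
  obtain a b g f where bounds: "\<And>i. i < length xs \<Longrightarrow> 0 \<le> a i \<and> a i \<le> b i \<and> b i \<le> t"
    and I: "\<And>\<omega>. elementary_integral W xs \<omega> = (\<Sum>i<length xs. (W (b i) (g i) \<omega> - W (a i) (g i) \<omega>) *\<^sub>R f i)"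
    and op: "\<And>s v. elementary_op xs s v = (\<Sum>i<length xs. (indicator {a i<..b i} s * inner (g i) v) *\<^sub>R f i)"
    by (rule elementary_increments[OF assms(1)]) (rule that)
  define n where "n = length xs"
  define J where "J i = {a i<..b i}" for i
  define D where "D i \<omega> = W (b i) (g i) \<omega> - W (a i) (g i) \<omega>" for i \<omega>
  define q where "q = (\<Sum>i<n. \<Sum>j<n. measure lborel (J i \<inter> J j) * inner (g i) (g j) * inner (f i) (f j))"
  have norm_sum: "(norm (\<Sum>i<n. c i *\<^sub>R f i))\<^sup>2 = (\<Sum>i<n. \<Sum>j<n. c i * c j * inner (f i) (f j))" for c :: "nat \<Rightarrow> real"
    unfolding power2_norm_eq_inner inner_sum_left unfolding inner_sum_right by (simp add: mult_ac)
  have "has_bochner_integral \<PP> (\<lambda>\<omega>. \<Sum>i<n. \<Sum>j<n. D i \<omega> * D j \<omega> * inner (f i) (f j)) q"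
    unfolding q_def
  proof (intro has_bochner_integral_sum has_bochner_integral_mult_left)
    fix i j assume "i \<in> {..<n}" "j \<in> {..<n}"
    then show "has_bochner_integral \<PP> (\<lambda>\<omega>. D i \<omega> * D j \<omega>) (measure lborel (J i \<inter> J j) * inner (g i) (g j))"
      unfolding D_def J_def using bounds[of i] bounds[of j] assms(2)
      by (intro increment_covariance) (auto simp: n_def)
  qed
  moreover have "(norm (elementary_integral W xs \<omega>))\<^sup>2 = (\<Sum>i<n. \<Sum>j<n. D i \<omega> * D j \<omega> * inner (f i) (f j))" for \<omega>
    using norm_sum[of "\<lambda>i. D i \<omega>"] by (simp add: I D_def n_def)
  ultimately have "has_bochner_integral \<PP> (\<lambda>\<omega>. (norm (elementary_integral W xs \<omega>))\<^sup>2) q" by simp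
  then have lhs: "(\<integral>\<^sup>+\<omega>. ennreal ((norm (elementary_integral W xs \<omega>))\<^sup>2) \<partial>\<PP>) = ennreal q"
    by (subst nn_integral_eq_integral) (auto simp: has_bochner_integral_iff)
  define r where "r s = (\<Sum>i<n. \<Sum>j<n. indicator (J i \<inter> J j) s * inner (g i) (g j) * inner (f i) (f j))" for s :: real
  have r_sums: "(\<lambda>m. (norm (elementary_op xs s (sine_basis (Suc m))))\<^sup>2) sums r s" for s
  proof -
    have "(norm (elementary_op xs s v))\<^sup>2
        = (\<Sum>i<n. \<Sum>j<n. indicator (J i \<inter> J j) s * (inner (g i) v * inner (g j) v) * inner (f i) (f j))" for v
      unfolding op norm_sum n_def[symmetric] J_def[symmetric]
      by (intro sum.cong refl) (simp add: indicator_inter_arith mult_ac)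
    then show ?thesis
      unfolding r_def by (simp only:) (intro sums_sum sums_mult2 sums_mult l2_parseval_inner)
  qed
  have r_nonneg: "0 \<le> r s" for s
    using sums_le[OF _ sums_zero r_sums[of s]] by simp
  have HS: "HS_norm_sq (elementary_op xs s) = ennreal (r s)" for s
    unfolding HS_norm_sq_def by (rule suminf_ennreal_eq[OF _ r_sums]) simp
  have r_int: "has_bochner_integral lborel r q"
    unfolding r_def[abs_def] q_def
  proof (intro has_bochner_integral_sum has_bochner_integral_mult_left)
    fix i j
    have "bounded (J i \<inter> J j)"
      by (rule bounded_subset[OF bounded_closed_interval[of "a i" "b i"]]) (auto simp: J_def)
    then have "emeasure lborel (J i \<inter> J j) < \<infinity>" by (rule emeasure_bounded_finite)
    moreover have "J i \<inter> J j \<in> sets lborel" by (simp add: J_def)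
    ultimately show "has_bochner_integral lborel (indicator (J i \<inter> J j)) (measure lborel (J i \<inter> J j))"
      by (intro has_bochner_integral_real_indicator)
  qed
  have "r s * indicator {0..t} s = r s" for s
  proof (cases "s \<in> {0..t}")
    case False
    then have "s \<notin> J i" if "i < n" for i using bounds[of i] that by (auto simp: J_def n_def)
    then have "r s = 0" unfolding r_def by (intro sum.neutral ballI) auto
    then show ?thesis by simp
  qed simp
  then have "ennreal (r s) * indicator {0..t} s = ennreal (r s)" for s
    by (metis ennreal_mult' ennreal_indicator r_nonneg)
  then have "(\<integral>\<^sup>+s\<in>{0..t}. HS_norm_sq (elementary_op xs s) \<partial>lborel) = (\<integral>\<^sup>+s. ennreal (r s) \<partial>lborel)"
    by (simp add: HS)
  also have "\<dots> = ennreal q"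
    using r_int r_nonneg by (subst nn_integral_eq_integral) (auto simp: has_bochner_integral_iff)
  finally show ?thesis using lhs by simp
qed

lemma elementary_op_append_neg:
  "elementary_op (xs @ map (\<lambda>(a, b, g, f). (a, b, g, - f)) ys) s v = elementary_op xs s v - elementary_op ys s v"
  by (induction ys arbitrary: xs)
     (auto simp: elementary_op_def)

lemma elementary_integral_append_neg:
  "elementary_integral W (xs @ map (\<lambda>(a, b, g, f). (a, b, g, - f)) ys) \<omega>
    = elementary_integral W xs \<omega> - elementary_integral W ys \<omega>"
  by (induction ys arbitrary: xs)
     (auto simp: elementary_integral_def)

lemma elementary_on_append_neg:
  "elementary_on t xs \<Longrightarrow> elementary_on t ys \<Longrightarrow>
     elementary_on t (xs @ map (\<lambda>(a, b, g, f). (a, b, g, - f)) ys)"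
  by (fastforce simp: elementary_on_def)

text \<open>
  Appending one approximating sequence to the negative of the other one approximates the difference of
  the integrals and the difference of the integrands at once, and for these approximations the
  isometry is \<open>elementary_isometry\<close>. The definition of the integral asks for Borel
  measurability, which the difference inherits in the weak sense; hence the isometry is stated for the
  difference itself.
\<close>

theorem ito_isometry_diff:
  assumes int1: "has_stochastic_integral \<PP> W t \<Phi>1 X1" and int2: "has_stochastic_integral \<PP> W t \<Phi>2 X2"
    and "t \<le> T"
  shows "(\<integral>\<^sup>+\<omega>. ennreal ((norm (X1 \<omega> - X2 \<omega>))\<^sup>2) \<partial>\<PP>)
    = (\<integral>\<^sup>+s\<in>{0..t}. HS_norm_sq (\<lambda>v. \<Phi>1 s v - \<Phi>2 s v) \<partial>lborel)"
proof -
  define R where "R = restrict_space lborel {0..t}"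
  have R: "(\<integral>\<^sup>+s\<in>{0..t}. f s \<partial>lborel) = (\<integral>\<^sup>+s. f s \<partial>R)" for f
    unfolding R_def by (subst nn_integral_restrict_space) auto
  obtain \<Psi>1 where \<Psi>1: "\<And>n. elementary_on t (\<Psi>1 n)"
    "(\<lambda>n. \<integral>\<^sup>+s. HS_norm_sq (\<lambda>v. \<Phi>1 s v - elementary_op (\<Psi>1 n) s v) \<partial>R) \<longlonglongrightarrow> 0"
    "(\<lambda>n. \<integral>\<^sup>+\<omega>. ennreal ((norm (X1 \<omega> - elementary_integral W (\<Psi>1 n) \<omega>))\<^sup>2) \<partial>\<PP>) \<longlonglongrightarrow> 0"
    using int1 unfolding has_stochastic_integral_def R by blast
  obtain \<Psi>2 where \<Psi>2: "\<And>n. elementary_on t (\<Psi>2 n)"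
    "(\<lambda>n. \<integral>\<^sup>+s. HS_norm_sq (\<lambda>v. \<Phi>2 s v - elementary_op (\<Psi>2 n) s v) \<partial>R) \<longlonglongrightarrow> 0"
    "(\<lambda>n. \<integral>\<^sup>+\<omega>. ennreal ((norm (X2 \<omega> - elementary_integral W (\<Psi>2 n) \<omega>))\<^sup>2) \<partial>\<PP>) \<longlonglongrightarrow> 0"
    using int2 unfolding has_stochastic_integral_def R by blast
  have X: "weakly_measurable \<PP> X1" "weakly_measurable \<PP> X2"
    using int1 int2 by (auto simp: has_stochastic_integral_def intro: weakly_measurable_borel)
  have \<Phi>: "weakly_measurable R (\<lambda>s. \<Phi>1 s v)" "weakly_measurable R (\<lambda>s. \<Phi>2 s v)" for v
    using int1 int2 by (auto simp: has_stochastic_integral_def weakly_measurable_def R_def)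
  have op: "weakly_measurable R (\<lambda>s. elementary_op xs s v)" for xs v
    using elementary_op_weakly_measurable[of lborel xs v]
    unfolding weakly_measurable_def R_def by (auto intro: measurable_restrict_space1)
  define xs where "xs n = \<Psi>1 n @ map (\<lambda>(a, b, g, f). (a, b, g, - f)) (\<Psi>2 n)" for n
  have xs_on: "elementary_on t (xs n)" for n
    unfolding xs_def by (intro elementary_on_append_neg \<Psi>1 \<Psi>2)
  define Y where "Y \<omega> = X1 \<omega> - X2 \<omega>" for \<omega>
  define \<Lambda> where "\<Lambda> s v = \<Phi>1 s v - \<Phi>2 s v" for s v
  define I where "I n = elementary_integral W (xs n)" for n
  define E where "E n = elementary_op (xs n)" for n
  have Y: "weakly_measurable \<PP> Y" unfolding Y_def by (intro weakly_measurable_diff X)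
  have \<Lambda>: "weakly_measurable R (\<lambda>s. \<Lambda> s v)" for v unfolding \<Lambda>_def by (intro weakly_measurable_diff \<Phi>)
  have I: "weakly_measurable \<PP> (I n)" for n
    unfolding I_def by (intro elementary_integral_weakly_measurable[OF xs_on] \<open>t \<le> T\<close>)
  have E: "weakly_measurable R (\<lambda>s. E n s v)" for n v unfolding E_def by (rule op)
  have isometry: "(\<integral>\<^sup>+\<omega>. ennreal ((norm (I n \<omega>))\<^sup>2) \<partial>\<PP>) = (\<integral>\<^sup>+s. HS_norm_sq (E n s) \<partial>R)" for n
    unfolding I_def E_def R[symmetric] by (rule elementary_isometry[OF xs_on \<open>t \<le> T\<close>])
  have squeeze: "C \<longlonglongrightarrow> 0"
    if "\<And>n. C n \<le> ennreal (1 + 1) * A n + ennreal (1 + 1 / 1) * B n" "A \<longlonglongrightarrow> 0" "B \<longlonglongrightarrow> 0"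
    for A B C :: "nat \<Rightarrow> ennreal"
  proof (rule tendsto_sandwich[of "\<lambda>_. 0"])
    have "(\<lambda>n. ennreal (1 + 1) * A n + ennreal (1 + 1 / 1) * B n) \<longlonglongrightarrow> ennreal (1 + 1) * 0 + ennreal (1 + 1 / 1) * 0"
      by (intro tendsto_add ennreal_tendsto_cmult that) auto
    then show "(\<lambda>n. ennreal (1 + 1) * A n + ennreal (1 + 1 / 1) * B n) \<longlonglongrightarrow> 0" by simp
  qed (use that(1) in auto)
  have Y_I: "(\<lambda>n. \<integral>\<^sup>+\<omega>. ennreal ((norm (Y \<omega> - I n \<omega>))\<^sup>2) \<partial>\<PP>) \<longlonglongrightarrow> 0"
  proof (rule squeeze[OF _ \<Psi>1(3) \<Psi>2(3)])
    fix n
    have eq: "norm (Y \<omega> - I n \<omega>)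
        = norm ((X1 \<omega> - elementary_integral W (\<Psi>1 n) \<omega>) + (elementary_integral W (\<Psi>2 n) \<omega> - X2 \<omega>))" for \<omega>
      by (simp add: Y_def I_def xs_def elementary_integral_append_neg algebra_simps)
    show "(\<integral>\<^sup>+\<omega>. ennreal ((norm (Y \<omega> - I n \<omega>))\<^sup>2) \<partial>\<PP>)
      \<le> ennreal (1 + 1) * (\<integral>\<^sup>+\<omega>. ennreal ((norm (X1 \<omega> - elementary_integral W (\<Psi>1 n) \<omega>))\<^sup>2) \<partial>\<PP>)
      + ennreal (1 + 1 / 1) * (\<integral>\<^sup>+\<omega>. ennreal ((norm (X2 \<omega> - elementary_integral W (\<Psi>2 n) \<omega>))\<^sup>2) \<partial>\<PP>)"
      unfolding eq norm_minus_commute[of "X2 _"]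
      by (intro nn_integral_norm_add_sq_le weakly_measurable_diff X
          elementary_integral_weakly_measurable[OF \<Psi>1(1)] elementary_integral_weakly_measurable[OF \<Psi>2(1)] \<open>t \<le> T\<close>) simp
  qed
  have HS_commute: "HS_norm_sq (\<lambda>v. P v - Q v) = HS_norm_sq (\<lambda>v. Q v - P v)" for P Q
    by (simp add: HS_norm_sq_def norm_minus_commute)
  have \<Lambda>_E: "(\<lambda>n. \<integral>\<^sup>+s. HS_norm_sq (\<lambda>v. \<Lambda> s v - E n s v) \<partial>R) \<longlonglongrightarrow> 0"
  proof (rule squeeze[OF _ \<Psi>1(2) \<Psi>2(2)])
    fix n
    have eq: "(\<lambda>v. \<Lambda> s v - E n s v)
        = (\<lambda>v. (\<Phi>1 s v - elementary_op (\<Psi>1 n) s v) + (elementary_op (\<Psi>2 n) s v - \<Phi>2 s v))" for s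
      by (simp add: \<Lambda>_def E_def xs_def elementary_op_append_neg algebra_simps)
    show "(\<integral>\<^sup>+s. HS_norm_sq (\<lambda>v. \<Lambda> s v - E n s v) \<partial>R)
      \<le> ennreal (1 + 1) * (\<integral>\<^sup>+s. HS_norm_sq (\<lambda>v. \<Phi>1 s v - elementary_op (\<Psi>1 n) s v) \<partial>R)
      + ennreal (1 + 1 / 1) * (\<integral>\<^sup>+s. HS_norm_sq (\<lambda>v. \<Phi>2 s v - elementary_op (\<Psi>2 n) s v) \<partial>R)"
      unfolding eq HS_commute[of "\<Phi>2 _"]
      by (intro nn_integral_HS_add_sq_le weakly_measurable_diff \<Phi> op) simp
  qed
  have "(\<integral>\<^sup>+\<omega>. ennreal ((norm (Y \<omega>))\<^sup>2) \<partial>\<PP>) \<le> (\<integral>\<^sup>+s. HS_norm_sq (\<Lambda> s) \<partial>R)"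
  proof (rule ennreal_approximation_le[OF _ _ Y_I \<Lambda>_E])
    fix d :: real and n assume "0 < d"
    then show "(\<integral>\<^sup>+\<omega>. ennreal ((norm (Y \<omega>))\<^sup>2) \<partial>\<PP>) \<le> ennreal (1 + d) * (\<integral>\<^sup>+\<omega>. ennreal ((norm (I n \<omega>))\<^sup>2) \<partial>\<PP>)
        + ennreal (1 + 1 / d) * (\<integral>\<^sup>+\<omega>. ennreal ((norm (Y \<omega> - I n \<omega>))\<^sup>2) \<partial>\<PP>)"
      using nn_integral_norm_add_sq_le[OF I[of n] weakly_measurable_diff[OF Y I[of n]]] by simp
    show "(\<integral>\<^sup>+\<omega>. ennreal ((norm (I n \<omega>))\<^sup>2) \<partial>\<PP>) \<le> ennreal (1 + d) * (\<integral>\<^sup>+s. HS_norm_sq (\<Lambda> s) \<partial>R)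
        + ennreal (1 + 1 / d) * (\<integral>\<^sup>+s. HS_norm_sq (\<lambda>v. \<Lambda> s v - E n s v) \<partial>R)"
      unfolding isometry HS_commute[of "\<Lambda> _"]
      using nn_integral_HS_add_sq_le[of R \<Lambda> "\<lambda>s v. E n s v - \<Lambda> s v" d, OF \<Lambda> weakly_measurable_diff[OF E[of n] \<Lambda>] \<open>0 < d\<close>] by simp
  qed
  moreover have "(\<integral>\<^sup>+s. HS_norm_sq (\<Lambda> s) \<partial>R) \<le> (\<integral>\<^sup>+\<omega>. ennreal ((norm (Y \<omega>))\<^sup>2) \<partial>\<PP>)"
  proof (rule ennreal_approximation_le[OF _ _ \<Lambda>_E Y_I])
    fix d :: real and n assume "0 < d"
    then show "(\<integral>\<^sup>+s. HS_norm_sq (\<Lambda> s) \<partial>R) \<le> ennreal (1 + d) * (\<integral>\<^sup>+\<omega>. ennreal ((norm (I n \<omega>))\<^sup>2) \<partial>\<PP>)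
        + ennreal (1 + 1 / d) * (\<integral>\<^sup>+s. HS_norm_sq (\<lambda>v. \<Lambda> s v - E n s v) \<partial>R)"
      unfolding isometry
      using nn_integral_HS_add_sq_le[of R "E n" "\<lambda>s v. \<Lambda> s v - E n s v" d, OF E[of n] weakly_measurable_diff[OF \<Lambda> E[of n]]] by simp
    show "(\<integral>\<^sup>+\<omega>. ennreal ((norm (I n \<omega>))\<^sup>2) \<partial>\<PP>) \<le> ennreal (1 + d) * (\<integral>\<^sup>+\<omega>. ennreal ((norm (Y \<omega>))\<^sup>2) \<partial>\<PP>)
        + ennreal (1 + 1 / d) * (\<integral>\<^sup>+\<omega>. ennreal ((norm (Y \<omega> - I n \<omega>))\<^sup>2) \<partial>\<PP>)"
      unfolding norm_minus_commute[of "Y _"]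
      using nn_integral_norm_add_sq_le[OF Y weakly_measurable_diff[OF I[of n] Y] \<open>0 < d\<close>] by simp
  qed
  ultimately show ?thesis unfolding R Y_def \<Lambda>_def by (rule antisym)
qed

end

section \<open>Sums of inverse squares\<close>

text \<open>
  Telescoping with $1/k^2\ge 1/k-1/(k+1)$.
\<close>

lemma sum_inverse_squares_ge:
  assumes "1 \<le> n" "n \<le> Suc m"
  shows "1 / real n - 1 / (real m + 1) \<le> (\<Sum>k=n..m. 1 / (real k)\<^sup>2)"
  using assms(2)
proof (induction m)
  case 0
  then have "n = 1" using assms(1) by simp
  then show ?case by simp
next
  case (Suc m)
  show ?case
  proof (cases "n = Suc (Suc m)")
    case True
    then show ?thesis by simp
  next
    case False
    then have "n \<le> Suc m" using Suc.prems by simp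
    have "1 / (real m + 1) - 1 / (real (Suc m) + 1) = 1 / ((real m + 1) * (real m + 2))"
      by (simp add: field_simps)
    also have "\<dots> \<le> 1 / ((real m + 1) * (real m + 1))"
      by (intro divide_left_mono mult_left_mono) auto
    also have "\<dots> = 1 / (real (Suc m))\<^sup>2" by (simp add: power2_eq_square add.commute)
    finally have "1 / (real m + 1) - 1 / (real (Suc m) + 1) \<le> 1 / (real (Suc m))\<^sup>2" .
    moreover have "(\<Sum>k=n..Suc m. 1 / (real k)\<^sup>2) = (\<Sum>k=n..m. 1 / (real k)\<^sup>2) + 1 / (real (Suc m))\<^sup>2"
      using \<open>n \<le> Suc m\<close> by simp
    ultimately show ?thesis using Suc.IH \<open>n \<le> Suc m\<close> by linarith
  qed
qed

text \<open>
  Telescoping with $1/k^2\le 1/(k-1)-1/k$.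
\<close>

lemma sum_inverse_squares_le:
  assumes "1 \<le> n"
  shows "(\<Sum>k=Suc n..m. 1 / (real k)\<^sup>2) \<le> 1 / real n"
proof (cases "n \<le> m")
  case True
  have "(\<Sum>k=Suc n..m. 1 / (real k)\<^sup>2) \<le> 1 / real n - 1 / real m"
    using True
  proof (induction m rule: dec_induct)
    case (step m)
    have "1 / (real (Suc m))\<^sup>2 \<le> 1 / (real m * (real m + 1))"
      using step assms by (intro divide_left_mono mult_pos_pos zero_less_power) (auto simp: power2_eq_square algebra_simps)
    also have "\<dots> = 1 / real m - 1 / real (Suc m)" using step assms by (simp add: field_simps)
    finally show ?case using step by simp
  qed simp
  also have "\<dots> \<le> 1 / real n" by simp
  finally show ?thesis .
qed simp

text \<open>
  Telescoping with $1/k^2\le 2/k-2/(k+1)$; weaker than \<open>sum_inverse_squares_le\<close> by a constant, but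
  it covers \<open>n = 0\<close> as well.
\<close>

lemma sum_inverse_squares_le_double: "(\<Sum>k=Suc n..m. 1 / (real k)\<^sup>2) \<le> 2 / (real n + 1)"
proof (cases "n \<le> m")
  case True
  have "(\<Sum>k=Suc n..m. 1 / (real k)\<^sup>2) \<le> 2 / (real n + 1) - 2 / (real m + 1)"
    using True
  proof (induction m rule: dec_induct)
    case (step m)
    have "1 / (real (Suc m))\<^sup>2 = 2 / (2 * (real m + 1)\<^sup>2)" by (simp add: add.commute)
    also have "\<dots> \<le> 2 / ((real m + 1) * (real m + 2))"
      by (intro divide_left_mono mult_pos_pos zero_less_power) (auto simp: power2_eq_square algebra_simps)
    also have "\<dots> = 2 / (real m + 1) - 2 / (real (Suc m) + 1)" by (simp add: field_simps)
    finally show ?case using step by simp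
  qed simp
  also have "\<dots> \<le> 2 / (real n + 1)" by simp
  finally show ?thesis .
qed simp

text \<open>
  The summand is at most $b^2$ for $k\le1/b$, which makes at most \<open>b\<close> in total, and at most
  $1/k^2$ for larger \<open>k\<close>, which makes at most \<open>2 b\<close>.
\<close>

lemma sum_truncated_squares_le:
  fixes b :: real
  assumes "0 < b"
  shows "(\<Sum>k=1..N. (min 1 (b\<^sup>2 * (real k)\<^sup>2))\<^sup>2 / (real k)\<^sup>2) \<le> 3 * b"
proof -
  let ?f = "\<lambda>k. (min 1 (b\<^sup>2 * (real k)\<^sup>2))\<^sup>2 / (real k)\<^sup>2"
  define n where "n = nat \<lfloor>1 / b\<rfloor>"
  have n: "real n \<le> 1 / b" "1 / b < real n + 1"
    using assms by (auto simp: n_def)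
  have small: "?f k \<le> b\<^sup>2" if "k \<in> {1..n}" for k
  proof -
    have "real k \<le> 1 / b" using that n(1) by (meson atLeastAtMost_iff of_nat_mono order_trans)
    then have "b * real k \<le> 1" using assms by (simp add: field_simps)
    then have "(b * real k)\<^sup>2 \<le> 1" using assms by (simp add: power_le_one)
    then have le: "b\<^sup>2 * (real k)\<^sup>2 \<le> 1" by (simp add: power_mult_distrib)
    then have "?f k = b\<^sup>2 * (b\<^sup>2 * (real k)\<^sup>2)"
      using that by (simp add: min_def power2_eq_square) 
    also have "\<dots> \<le> b\<^sup>2 * 1" by (intro mult_left_mono le) auto
    finally show ?thesis by simp
  qed
  have large: "?f k \<le> 1 / (real k)\<^sup>2" for k
    by (intro divide_right_mono power_le_one) auto
  have "sum ?f {1..N} \<le> sum ?f ({1..n} \<union> {Suc n..N})"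
    by (intro sum_mono2) auto
  also have "\<dots> = sum ?f {1..n} + sum ?f {Suc n..N}"
    by (intro sum.union_disjoint) auto
  also have "\<dots> \<le> (\<Sum>k=1..n. b\<^sup>2) + (\<Sum>k=Suc n..N. 1 / (real k)\<^sup>2)"
    by (intro add_mono sum_mono small large) auto
  also have "\<dots> \<le> real n * b\<^sup>2 + 2 / (real n + 1)"
    using sum_inverse_squares_le_double[of n N] by simp
  also have "\<dots> \<le> b + 2 * b"
  proof (rule add_mono)
    have "real n * b\<^sup>2 \<le> 1 / b * b\<^sup>2" by (intro mult_right_mono n) auto
    then show "real n * b\<^sup>2 \<le> b" using assms by (simp add: power2_eq_square)
    have "1 / (real n + 1) \<le> b" using n(2) assms by (simp add: field_simps)
    then show "2 / (real n + 1) \<le> 2 * b" by simp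
  qed
  finally show ?thesis by simp
qed

section \<open>Closed-form bounds for the sums over modes\<close>

text \<open>
  With $b = a\sqrt h$ the sum is at most $3b/(2a^2)$. The stated constant is not homogeneous in \<open>a\<close>;
  it is large enough because $4a^3+1\ge2a$ for positive \<open>a\<close>.
\<close>

lemma temporal_sum_le:
  fixes a h :: real
  assumes "0 < a" "0 < h"
  shows "(\<Sum>k=1..N. (min 1 ((a * real k)\<^sup>2 * h))\<^sup>2 / (2 * (a * real k)\<^sup>2))
    \<le> sqrt h / 2 * (1 / a + 1 / a\<^sup>2 + 4 * a)"
proof -
  define b where "b = a * sqrt h"
  have b: "0 < b" "b\<^sup>2 = a\<^sup>2 * h" using assms by (auto simp: b_def power_mult_distrib)
  have "(\<Sum>k=1..N. (min 1 ((a * real k)\<^sup>2 * h))\<^sup>2 / (2 * (a * real k)\<^sup>2))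
      = (\<Sum>k=1..N. (min 1 (b\<^sup>2 * (real k)\<^sup>2))\<^sup>2 / (real k)\<^sup>2) / (2 * a\<^sup>2)"
    unfolding b(2) sum_divide_distrib by (intro sum.cong refl) (simp add: power_mult_distrib mult_ac)
  also have "\<dots> \<le> 3 * b / (2 * a\<^sup>2)"
    by (intro divide_right_mono sum_truncated_squares_le b) auto
  also have "\<dots> = sqrt h / 2 * (3 / a)" using assms by (simp add: b_def power2_eq_square)
  also have "\<dots> \<le> sqrt h / 2 * (1 / a + 1 / a\<^sup>2 + 4 * a)"
  proof (rule mult_left_mono)
    \<comment> \<open>$(2a-1)^2(a+1) = 4a^3-3a+1$\<close>
    have "0 \<le> (2 * a - 1)\<^sup>2 * (a + 1) + a" using assms by simp
    then have "2 * a \<le> 1 + 4 * a ^ 3" by (simp add: power2_eq_square power3_eq_cube algebra_simps)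
    then show "3 / a \<le> 1 / a + 1 / a\<^sup>2 + 4 * a"
      using assms by (simp add: field_simps power2_eq_square power3_eq_cube)
  qed (use assms in auto)
  finally show ?thesis .
qed

text \<open>
  Decreasing \<open>q\<close> to \<open>p\<close> increases the integrand, and then $-2(x+p^2)^{-1/2}$ is an
  antiderivative of $(x+p^2)^{-3/2}$.
\<close>

lemma integral_powr_le:
  fixes p q X K :: real
  assumes "0 < p" "p \<le> q" "0 \<le> X" "0 \<le> K"
  shows "integral {0..X} (\<lambda>x. K / (x + q\<^sup>2) powr (3/2)) \<le> 2 * K * (1 / p - 1 / sqrt (X + p\<^sup>2))"
    and "0 \<le> integral {0..X} (\<lambda>x. K / (x + q\<^sup>2) powr (3/2))"
proof -
  have pos: "0 < x + r\<^sup>2" if "0 \<le> x" "p \<le> r" for x r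
    using that assms by (intro add_nonneg_pos) auto
  have int: "(\<lambda>x. K / (x + r\<^sup>2) powr (3/2)) integrable_on {0..X}" if "p \<le> r" for r
  proof (intro integrable_continuous_real continuous_intros ballI)
    fix x assume "x \<in> {0..X}"
    then show "x + r\<^sup>2 \<noteq> 0" "(x + r\<^sup>2) powr (3/2) \<noteq> 0"
      using pos[of x r] that by auto
  qed
  have "integral {0..X} (\<lambda>x. K / (x + q\<^sup>2) powr (3/2)) \<le> integral {0..X} (\<lambda>x. K / (x + p\<^sup>2) powr (3/2))"
  proof (intro integral_le int)
    fix x assume x: "x \<in> {0..X}"
    have "x + p\<^sup>2 \<le> x + q\<^sup>2" using assms by (simp add: power_mono)
    then have "(x + p\<^sup>2) powr (3/2) \<le> (x + q\<^sup>2) powr (3/2)"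
      using pos[of x p] x by (intro powr_mono2) auto
    then show "K / (x + q\<^sup>2) powr (3/2) \<le> K / (x + p\<^sup>2) powr (3/2)"
      using pos[of x p] pos[of x q] x assms by (intro divide_left_mono) auto
  qed (use assms in auto)
  also have "((\<lambda>x. K / (x + p\<^sup>2) powr (3/2)) has_integral
      (- 2 * K * (X + p\<^sup>2) powr (-1/2)) - (- 2 * K * (0 + p\<^sup>2) powr (-1/2))) {0..X}"
  proof (rule fundamental_theorem_of_calculus)
    fix x assume "x \<in> {0..X}"
    then have x: "0 < x + p\<^sup>2" using pos[of x p] by simp
    have "((\<lambda>x. - 2 * K * (x + p\<^sup>2) powr (-1/2)) has_real_derivative
        - 2 * K * ((-1/2) * (x + p\<^sup>2) powr (-1/2 - 1))) (at x within {0..X})"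
      using x by (auto intro!: derivative_eq_intros)
    moreover have "- 2 * K * ((-1/2) * (x + p\<^sup>2) powr (-1/2 - 1)) = K / (x + p\<^sup>2) powr (3/2)"
      using powr_minus_divide[of "x + p\<^sup>2" "3/2"] by simp
    ultimately show "((\<lambda>x. - 2 * K * (x + p\<^sup>2) powr (-1/2)) has_vector_derivative K / (x + p\<^sup>2) powr (3/2)) (at x within {0..X})"
      by (simp add: has_real_derivative_iff_has_vector_derivative)
  qed (use assms in auto)
  then have "integral {0..X} (\<lambda>x. K / (x + p\<^sup>2) powr (3/2))
      = (- 2 * K * (X + p\<^sup>2) powr (-1/2)) - (- 2 * K * (0 + p\<^sup>2) powr (-1/2))"
    by (rule integral_unique)
  also have "\<dots> = 2 * K * (1 / p - 1 / sqrt (X + p\<^sup>2))"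
  proof -
    have "y powr (-1/2) = 1 / sqrt y" if "0 < y" for y :: real
      using powr_minus_divide[of y "1/2"] that by (simp add: powr_half_sqrt)
    then show ?thesis using pos[of X p] pos[of 0 p] assms by (simp add: algebra_simps)
  qed
  finally show "integral {0..X} (\<lambda>x. K / (x + q\<^sup>2) powr (3/2)) \<le> 2 * K * (1 / p - 1 / sqrt (X + p\<^sup>2))" .
  show "0 \<le> integral {0..X} (\<lambda>x. K / (x + q\<^sup>2) powr (3/2))"
    by (intro integral_nonneg int) (use assms in auto)
qed

text \<open>
  Only the modes with $k\ge1/\sqrt g$, for which $1-e^{-ck^2g}\ge1-e^{-c}$, are kept. Their inverse
  squares sum to at least $1/n-1/(N+1)$ with $n = \lceil1/\sqrt g\rceil\le(1+\sqrt g)/\sqrt g$. The last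
  assumption amounts to $\sqrt g\,N>1$ and gives \<open>n \<le> N\<close>.
\<close>

lemma temporal_sum_ge:
  fixes c g \<theta> :: real
  assumes "0 < c" "0 < g" "0 \<le> \<theta>" "1 + sqrt g < sqrt g * (real N + 1)"
  shows "sqrt g * (1 - exp (- c))\<^sup>2 * \<theta> / (4 * c) * (1 / (1 + sqrt g) - 1 / (sqrt g * (real N + 1)))
    \<le> (\<Sum>k=1..N. (1 - exp (- (c * (real k)\<^sup>2 * g)))\<^sup>2 * \<theta> / (4 * (c * (real k)\<^sup>2)))"
proof -
  define n where "n = nat \<lceil>1 / sqrt g\<rceil>"
  have g: "0 < sqrt g" using assms by simp
  have n: "1 / sqrt g \<le> real n" "real n < 1 / sqrt g + 1"
  proof -
    have "real n = of_int \<lceil>1 / sqrt g\<rceil>" using g by (simp add: n_def)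
    then show "1 / sqrt g \<le> real n" "real n < 1 / sqrt g + 1"
      using ceiling_correct[of "1 / sqrt g"] by linarith+
  qed
  have "1 \<le> n"
  proof -
    have "0 < real n" using n(1) g by (meson divide_pos_pos less_le_trans zero_less_one)
    then show ?thesis by simp
  qed
  have "1 / sqrt g + 1 < real N + 1" using assms(4) g by (simp add: field_simps)
  then have "n \<le> N" using n(2) by linarith
  have "sqrt g * (1 / (1 + sqrt g) - 1 / (sqrt g * (real N + 1))) = sqrt g / (1 + sqrt g) - 1 / (real N + 1)"
    using g by (simp add: right_diff_distrib)
  also have "\<dots> \<le> 1 / real n - 1 / (real N + 1)"
  proof -
    have "real n \<le> (1 + sqrt g) / sqrt g" using n(2) g by (simp add: add_divide_distrib)
    then have "1 / ((1 + sqrt g) / sqrt g) \<le> 1 / real n"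
      using \<open>1 \<le> n\<close> g by (intro divide_left_mono) (auto intro!: mult_pos_pos divide_pos_pos add_pos_pos)
    then show ?thesis by simp
  qed
  also have "\<dots> \<le> (\<Sum>k=n..N. 1 / (real k)\<^sup>2)"
    using \<open>1 \<le> n\<close> \<open>n \<le> N\<close> by (intro sum_inverse_squares_ge) auto
  finally have "(1 - exp (- c))\<^sup>2 * \<theta> / (4 * c) * (sqrt g * (1 / (1 + sqrt g) - 1 / (sqrt g * (real N + 1))))
      \<le> (1 - exp (- c))\<^sup>2 * \<theta> / (4 * c) * (\<Sum>k=n..N. 1 / (real k)\<^sup>2)"
    using assms by (intro mult_left_mono) auto
  also have "\<dots> = (\<Sum>k=n..N. (1 - exp (- c))\<^sup>2 * \<theta> / (4 * (c * (real k)\<^sup>2)))"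
    unfolding sum_distrib_left by (intro sum.cong refl) simp
  also have "\<dots> \<le> (\<Sum>k=n..N. (1 - exp (- (c * (real k)\<^sup>2 * g)))\<^sup>2 * \<theta> / (4 * (c * (real k)\<^sup>2)))"
  proof (intro sum_mono divide_right_mono mult_right_mono power_mono)
    fix k assume "k \<in> {n..N}"
    then have "1 / sqrt g \<le> real k" using n(1) by (meson atLeastAtMost_iff of_nat_mono order_trans)
    then have "1 \<le> real k * sqrt g" using g by (simp add: field_simps)
    then have "1 \<le> (real k * sqrt g)\<^sup>2" by (simp add: one_le_power)
    then have "1 \<le> (real k)\<^sup>2 * g" using assms by (simp add: power_mult_distrib)
    then have "c * 1 \<le> c * ((real k)\<^sup>2 * g)" using assms by (intro mult_left_mono) auto
    then show "1 - exp (- c) \<le> 1 - exp (- (c * (real k)\<^sup>2 * g))" by (simp add: mult.assoc)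
  qed (use assms in auto)
  also have "\<dots> \<le> (\<Sum>k=1..N. (1 - exp (- (c * (real k)\<^sup>2 * g)))\<^sup>2 * \<theta> / (4 * (c * (real k)\<^sup>2)))"
    using \<open>1 \<le> n\<close> assms by (intro sum_mono2) auto
  finally show ?thesis by (simp add: mult_ac)
qed

text \<open>
  Put $g = T/(2M)$, half of the grid width. If the upper end \<open>X\<close> of the integral is \<open>0\<close>, nothing is
  to be shown. Otherwise $X+(1+\sqrt g)^2 = g(N+1)^2$, the minimum in the statement is \<open>1\<close>, and the
  left-hand side, once $1+\sqrt T$ is lowered to $1+\sqrt g$, is half of what \<open>temporal_sum_ge\<close> provides.
\<close>

lemma temporal_lower_bound:
  fixes c T :: real and M N :: nat
  assumes "0 < c" "0 < T" "1 \<le> M"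
  defines "X \<equiv> max 0 (T * (real N + 1)\<^sup>2 / (2 * real M) - (1 + sqrt T / sqrt (2 * real M))\<^sup>2)"
  shows "2 / sqrt (real M) * integral {0..X} (\<lambda>x. sqrt T * (1 - exp (- c * T))
        * (1 - exp (- c * min 1 (T * (real N)\<^sup>2 / (2 * real M))))\<^sup>2
        / (32 * c * sqrt 2 * (x + (1 + sqrt T)\<^sup>2) powr (3/2)))
    \<le> (\<Sum>k=1..N. (1 - exp (- (c * (real k)\<^sup>2 * (T / (2 * real M)))))\<^sup>2 * (1 - exp (- c * T)) / (4 * (c * (real k)\<^sup>2)))"
    (is "?l * integral _ ?f \<le> ?r")
    and "0 \<le> integral {0..X} (\<lambda>x. sqrt T * (1 - exp (- c * T))
        * (1 - exp (- c * min 1 (T * (real N)\<^sup>2 / (2 * real M))))\<^sup>2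
        / (32 * c * sqrt 2 * (x + (1 + sqrt T)\<^sup>2) powr (3/2)))"
proof -
  define g where "g = T / (2 * real M)"
  have g: "0 < g" using assms by (simp add: g_def)
  have sg: "sqrt T / sqrt (2 * real M) = sqrt g" by (simp add: g_def real_sqrt_divide)
  have "g \<le> T" using assms by (simp add: g_def field_simps)
  then have sgT: "sqrt g \<le> sqrt T" by simp
  define \<theta> where "\<theta> = 1 - exp (- c * T)"
  have \<theta>: "0 \<le> \<theta>" using assms by (simp add: \<theta>_def)
  define \<eta> where "\<eta> = (1 - exp (- c * min 1 (T * (real N)\<^sup>2 / (2 * real M))))\<^sup>2"
  define K where "K = sqrt T * \<theta> * \<eta> / (32 * c * sqrt 2)"
  have K: "0 \<le> K" using assms \<theta> by (simp add: K_def \<eta>_def)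
  have f: "?f = (\<lambda>x. K / (x + (1 + sqrt T)\<^sup>2) powr (3/2))"
    by (simp add: K_def \<theta>_def \<eta>_def fun_eq_iff)
  have X: "0 \<le> X" "X = max 0 ((sqrt g * (real N + 1))\<^sup>2 - (1 + sqrt g)\<^sup>2)"
    using g unfolding X_def sg by (auto simp: g_def power_mult_distrib)
  show nonneg: "0 \<le> integral {0..X} ?f"
    unfolding f by (rule integral_powr_le(2)[of "1 + sqrt g"]) (use g sgT X K in \<open>auto intro: add_pos_pos\<close>)
  show "?l * integral {0..X} ?f \<le> ?r"
  proof (cases "X = 0")
    case True
    then show ?thesis using \<theta> assms by (auto intro!: sum_nonneg simp: \<theta>_def)
  next
    case False
    then have "(1 + sqrt g)\<^sup>2 < (sqrt g * (real N + 1))\<^sup>2"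
      and Xp: "X + (1 + sqrt g)\<^sup>2 = (sqrt g * (real N + 1))\<^sup>2"
      using X by (auto simp: max_def split: if_splits)
    then have gN: "1 + sqrt g < sqrt g * (real N + 1)"
      using g by (intro power2_less_imp_less[of "1 + sqrt g"]) auto
    then have "1 < sqrt g * real N" by (simp add: algebra_simps)
    then have "1\<^sup>2 \<le> (sqrt g * real N)\<^sup>2" by (intro power_mono) auto
    then have "min 1 (T * (real N)\<^sup>2 / (2 * real M)) = 1" using g by (simp add: power_mult_distrib g_def)
    then have \<eta>: "\<eta> = (1 - exp (- c))\<^sup>2" by (simp add: \<eta>_def)
    have "?l * integral {0..X} ?f \<le> ?l * (2 * K * (1 / (1 + sqrt g) - 1 / sqrt (X + (1 + sqrt g)\<^sup>2)))"
      unfolding f using g sgT X K by (intro mult_left_mono integral_powr_le) (auto intro: add_pos_pos)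
    also have "\<dots> = (4 * K / sqrt (real M)) * (1 / (1 + sqrt g) - 1 / (sqrt g * (real N + 1)))"
      unfolding Xp using g by simp
    also have "4 * K / sqrt (real M) = sqrt g * \<eta> * \<theta> / (8 * c)"
    proof -
      have "sqrt T / (sqrt 2 * sqrt (real M)) = sqrt g" using sg by (simp add: real_sqrt_mult)
      then have "sqrt g * \<eta> * \<theta> / (8 * c) = sqrt T / (sqrt 2 * sqrt (real M)) * \<eta> * \<theta> / (8 * c)" by simp
      then show ?thesis by (simp add: K_def mult_ac)
    qed
    also have "sqrt g * \<eta> * \<theta> / (8 * c) * (1 / (1 + sqrt g) - 1 / (sqrt g * (real N + 1)))
        \<le> sqrt g * \<eta> * \<theta> / (4 * c) * (1 / (1 + sqrt g) - 1 / (sqrt g * (real N + 1)))"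
    proof (rule mult_right_mono)
      have "0 \<le> sqrt g * \<eta> * \<theta>" using g \<theta> by (simp add: \<eta>)
      then show "sqrt g * \<eta> * \<theta> / (8 * c) \<le> sqrt g * \<eta> * \<theta> / (4 * c)"
        using assms by (intro divide_left_mono) auto
      have "1 / (sqrt g * (real N + 1)) \<le> 1 / (1 + sqrt g)"
        using gN g by (intro frac_le) (auto intro: add_pos_pos)
      then show "0 \<le> 1 / (1 + sqrt g) - 1 / (sqrt g * (real N + 1))" by simp
    qed
    also have "\<dots> \<le> ?r"
      using temporal_sum_ge[OF \<open>0 < c\<close> g \<theta> gN] unfolding \<eta> g_def[symmetric] \<theta>_def .
    finally show ?thesis .
  qed
qed

section \<open>The error of a single Fourier mode\<close>

text \<open>
  The closed form also shows that the greatest grid point below \<open>s\<close> exists.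
\<close>

lemma floor_grid_eq:
  assumes "0 < h"
  shows "floor_grid h s = of_int \<lfloor>s / h\<rfloor> * h"
  unfolding floor_grid_def
proof (rule Greatest_equality)
  have "of_int \<lfloor>s / h\<rfloor> * h \<le> s / h * h" using assms by (intro mult_right_mono) auto
  then show "of_int \<lfloor>s / h\<rfloor> * h \<in> range (\<lambda>k::int. of_int k * h) \<inter> {..s}" using assms by auto
next
  fix y assume "y \<in> range (\<lambda>k::int. of_int k * h) \<inter> {..s}"
  then obtain k :: int where k: "y = of_int k * h" "of_int k * h \<le> s" by auto
  then have "of_int k \<le> s / h" using assms by (simp add: field_simps)
  then have "k \<le> \<lfloor>s / h\<rfloor>" by (simp add: le_floor_iff)
  then show "y \<le> of_int \<lfloor>s / h\<rfloor> * h" using k assms by simp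
qed

lemma floor_grid_measurable [measurable]:
  assumes "0 < h"
  shows "floor_grid h \<in> borel_measurable borel"
  unfolding floor_grid_eq[OF assms, abs_def] by measurable

lemma floor_grid_bounds:
  assumes "0 < h"
  shows "floor_grid h s \<le> s" "s - h \<le> floor_grid h s"
proof -
  have "of_int \<lfloor>s / h\<rfloor> * h \<le> s / h * h" "(s / h - 1) * h \<le> of_int \<lfloor>s / h\<rfloor> * h"
    using assms by (intro mult_right_mono; linarith)+
  then show "floor_grid h s \<le> s" "s - h \<le> floor_grid h s"
    using assms by (simp_all add: floor_grid_eq algebra_simps)
qed

lemma floor_grid_cell:
  assumes "0 < h" "real j * h \<le> s" "s < (real j + 1) * h"
  shows "floor_grid h s = real j * h"
proof -
  have "\<lfloor>s / h\<rfloor> = int j"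
    using assms by (intro floor_unique) (auto simp: field_simps)
  then show ?thesis using assms by (simp add: floor_grid_eq)
qed

lemma nn_integral_exp_Icc:
  assumes "0 < \<mu>" "a \<le> b"
  shows "(\<integral>\<^sup>+s\<in>{a..b}. ennreal (exp (- (2 * \<mu> * (t - s)))) \<partial>lborel)
    = ennreal ((exp (- (2 * \<mu> * (t - b))) - exp (- (2 * \<mu> * (t - a)))) / (2 * \<mu>))"
proof -
  have "(\<integral>\<^sup>+s\<in>{a..b}. ennreal (exp (- (2 * \<mu> * (t - s)))) \<partial>lborel)
    = ennreal (exp (- (2 * \<mu> * (t - b))) / (2 * \<mu>) - exp (- (2 * \<mu> * (t - a))) / (2 * \<mu>))"
    using assms by (intro nn_integral_FTC_Icc) (auto intro!: derivative_eq_intros)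
  then show ?thesis by (simp add: diff_divide_distrib)
qed

lemma temporal_error_factor:
  fixes \<mu> :: real
  shows "(exp (- \<mu> * (t - s)) - exp (- \<mu> * (t - r)))\<^sup>2
    = exp (- (2 * \<mu> * (t - s))) * (1 - exp (- (\<mu> * (s - r))))\<^sup>2"
proof -
  have "exp (- \<mu> * (t - r)) = exp (- \<mu> * (t - s)) * exp (- (\<mu> * (s - r)))"
    by (simp add: algebra_simps flip: exp_add)
  then have "(exp (- \<mu> * (t - s)) - exp (- \<mu> * (t - r)))\<^sup>2
      = (exp (- \<mu> * (t - s)) * (1 - exp (- (\<mu> * (s - r)))))\<^sup>2"
    by (simp add: right_diff_distrib)
  also have "\<dots> = (exp (- \<mu> * (t - s)))\<^sup>2 * (1 - exp (- (\<mu> * (s - r))))\<^sup>2" by (rule power_mult_distrib)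
  also have "(exp (- \<mu> * (t - s)))\<^sup>2 = exp (- (2 * \<mu> * (t - s)))"
    by (simp flip: exp_double)
  finally show ?thesis .
qed

lemma spatial_mode:
  assumes "0 < \<mu>" "0 \<le> t"
  shows "(\<integral>\<^sup>+s\<in>{0..t}. ennreal ((exp (- \<mu> * (t - s)))\<^sup>2) \<partial>lborel) = ennreal ((1 - exp (- (2 * \<mu> * t))) / (2 * \<mu>))"
proof -
  have "(exp (- \<mu> * (t - s)))\<^sup>2 = exp (- (2 * \<mu> * (t - s)))" for s
    by (simp flip: exp_double)
  then show ?thesis using nn_integral_exp_Icc[OF assms, of t] by simp
qed

text \<open>
  $1-e^{-x}\le\min(1,x)$, applied to the distance of at most \<open>h\<close> to the last grid point.
\<close>

lemma temporal_mode_le: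
  assumes "0 < \<mu>" "0 < h" "0 \<le> t"
  shows "(\<integral>\<^sup>+s\<in>{0..t}. ennreal ((exp (- \<mu> * (t - s)) - exp (- \<mu> * (t - floor_grid h s)))\<^sup>2) \<partial>lborel)
    \<le> ennreal ((min 1 (\<mu> * h))\<^sup>2 / (2 * \<mu>))"
proof -
  define C where "C = (min 1 (\<mu> * h))\<^sup>2"
  have le: "(exp (- \<mu> * (t - s)) - exp (- \<mu> * (t - floor_grid h s)))\<^sup>2 \<le> exp (- (2 * \<mu> * (t - s))) * C" for s
    unfolding temporal_error_factor C_def
  proof (intro mult_left_mono power_mono)
    have d: "0 \<le> s - floor_grid h s" "s - floor_grid h s \<le> h"
      using floor_grid_bounds[OF \<open>0 < h\<close>, of s] by auto
    have "1 + - (\<mu> * (s - floor_grid h s)) \<le> exp (- (\<mu> * (s - floor_grid h s)))" by (rule exp_ge_add_one_self)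
    moreover have "\<mu> * (s - floor_grid h s) \<le> \<mu> * h" using assms d by (intro mult_left_mono) auto
    ultimately have "1 - exp (- (\<mu> * (s - floor_grid h s))) \<le> \<mu> * h" by linarith
    then show "1 - exp (- (\<mu> * (s - floor_grid h s))) \<le> min 1 (\<mu> * h)" by simp
    show "0 \<le> 1 - exp (- (\<mu> * (s - floor_grid h s)))" using assms d by simp
  qed auto
  have "(\<integral>\<^sup>+s\<in>{0..t}. ennreal ((exp (- \<mu> * (t - s)) - exp (- \<mu> * (t - floor_grid h s)))\<^sup>2) \<partial>lborel)
      \<le> (\<integral>\<^sup>+s. ennreal C * (ennreal (exp (- (2 * \<mu> * (t - s)))) * indicator {0..t} s) \<partial>lborel)"
  proof (intro nn_integral_mono)
    fix s
    have "ennreal ((exp (- \<mu> * (t - s)) - exp (- \<mu> * (t - floor_grid h s)))\<^sup>2) \<le> ennreal C * ennreal (exp (- (2 * \<mu> * (t - s))))"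
      using le[of s] by (simp add: C_def mult.commute flip: ennreal_mult)
    then show "ennreal ((exp (- \<mu> * (t - s)) - exp (- \<mu> * (t - floor_grid h s)))\<^sup>2) * indicator {0..t} s
      \<le> ennreal C * (ennreal (exp (- (2 * \<mu> * (t - s)))) * indicator {0..t} s)"
      by (simp add: mult_right_mono flip: mult.assoc)
  qed
  also have "\<dots> = ennreal C * ennreal ((exp (- (2 * \<mu> * (t - t))) - exp (- (2 * \<mu> * (t - 0)))) / (2 * \<mu>))"
    by (subst nn_integral_cmult) (simp_all only: nn_integral_exp_Icc[OF assms(1,3)], measurable)
  also have "\<dots> = ennreal (C * ((1 - exp (- (2 * \<mu> * t))) / (2 * \<mu>)))"
    using assms by (simp add: C_def flip: ennreal_mult)
  also have "\<dots> \<le> ennreal (C * (1 / (2 * \<mu>)))"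
    using assms by (intro ennreal_leI mult_left_mono divide_right_mono) (auto simp: C_def)
  finally show ?thesis by (simp add: C_def)
qed

text \<open>
  On the second half of each grid cell the distance to the last grid point is at least \<open>h / 2\<close>. Since
  $e^{-2\mu(T-s)}$ increases in \<open>s\<close>, the second halves carry at least half of its integral over
  \<open>[0,T]\<close>.
\<close>

lemma temporal_mode_ge:
  assumes "0 < \<mu>" "0 < h" and T: "T = real M * h"
  shows "ennreal ((1 - exp (- (\<mu> * (h / 2))))\<^sup>2 * (1 - exp (- (2 * \<mu> * T))) / (4 * \<mu>))
    \<le> (\<integral>\<^sup>+s\<in>{0..T}. ennreal ((exp (- \<mu> * (T - s)) - exp (- \<mu> * (T - floor_grid h s)))\<^sup>2) \<partial>lborel)"
proof -
  define C where "C = (1 - exp (- (\<mu> * (h / 2))))\<^sup>2"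
  define f where "f s = (exp (- \<mu> * (T - s)) - exp (- \<mu> * (T - floor_grid h s)))\<^sup>2" for s
  define E where "E s = exp (- (2 * \<mu> * (T - s)))" for s
  define l where "l j = real j * h + h / 2" for j
  define r where "r j = real (Suc j) * h" for j
  have lr: "l j \<le> r j" for j using assms by (simp add: l_def r_def algebra_simps)
  have half: "(\<integral>\<^sup>+s\<in>{l j..<r j}. ennreal (C * E s) \<partial>lborel) = ennreal (C * ((E (r j) - E (l j)) / (2 * \<mu>)))" for j
  proof -
    have "(\<integral>\<^sup>+s\<in>{l j..<r j}. ennreal (C * E s) \<partial>lborel) = (\<integral>\<^sup>+s. ennreal C * (ennreal (E s) * indicator {l j..r j} s) \<partial>lborel)"
      \<comment> \<open>The right end point belongs to the next cell, but it is a null set.\<close>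
      using AE_lborel_singleton[of "r j"]
      by (intro nn_integral_cong_AE)
         (auto simp: C_def E_def ennreal_mult indicator_def elim!: eventually_mono)
    also have "\<dots> = ennreal C * ennreal ((E (r j) - E (l j)) / (2 * \<mu>))"
      unfolding E_def
      by (subst nn_integral_cmult) (simp_all only: nn_integral_exp_Icc[OF assms(1) lr], measurable)
    also have "\<dots> = ennreal (C * ((E (r j) - E (l j)) / (2 * \<mu>)))"
      using lr[of j] assms by (subst ennreal_mult) (auto simp: C_def E_def)
    finally show ?thesis .
  qed
  have cell: "(E (real (Suc j) * h) - E (real j * h)) / 2 \<le> E (r j) - E (l j)" for j
  proof -
    \<comment> \<open>With $y = e^{\mu h}$ the claim is $By^2-By\ge(By^2-B)/2$, that is $B(y-1)^2\ge0$.\<close>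
    define B where "B = E (real j * h)"
    define y where "y = exp (\<mu> * h)"
    have "E (l j) = B * y" "E (r j) = B * y\<^sup>2"
      unfolding E_def B_def y_def l_def r_def by (simp_all add: algebra_simps flip: exp_add exp_double)
    moreover have "0 \<le> B * (y - 1)\<^sup>2" by (simp add: B_def E_def)
    ultimately show ?thesis
      unfolding r_def[symmetric] B_def[symmetric] by (simp add: power2_eq_square field_simps)
  qed
  have "(\<Sum>j<M. (E (real (Suc j) * h) - E (real j * h))) = E T - E 0"
    using sum_lessThan_telescope[of "\<lambda>j. E (real j * h)" M] by (simp add: T)
  then have "1 - exp (- (2 * \<mu> * T)) = (\<Sum>j<M. (E (real (Suc j) * h) - E (real j * h)))"
    by (simp add: E_def)
  then have "C * (1 - exp (- (2 * \<mu> * T))) / (4 * \<mu>)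
      = (\<Sum>j<M. C * ((E (real (Suc j) * h) - E (real j * h)) / 2 / (2 * \<mu>)))"
    by (simp add: sum_divide_distrib sum_distrib_left)
  also have "\<dots> \<le> (\<Sum>j<M. C * ((E (r j) - E (l j)) / (2 * \<mu>)))"
    using assms by (intro sum_mono mult_left_mono divide_right_mono cell) (auto simp: C_def)
  finally have "ennreal (C * (1 - exp (- (2 * \<mu> * T))) / (4 * \<mu>))
      \<le> ennreal (\<Sum>j<M. C * ((E (r j) - E (l j)) / (2 * \<mu>)))" by (rule ennreal_leI)
  also have "\<dots> = (\<Sum>j<M. ennreal (C * ((E (r j) - E (l j)) / (2 * \<mu>))))"
    using lr assms by (intro sum_ennreal[symmetric] mult_nonneg_nonneg divide_nonneg_nonneg) (auto simp: C_def E_def)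
  also have "\<dots> = (\<integral>\<^sup>+s. (\<Sum>j<M. ennreal (C * E s) * indicator {l j..<r j} s) \<partial>lborel)"
  proof -
    have "(\<lambda>s. ennreal (C * E s) * indicator {l j..<r j} s) \<in> borel_measurable lborel" for j
      unfolding E_def by measurable
    then show ?thesis by (simp only: nn_integral_sum half)
  qed
  also have "\<dots> \<le> (\<integral>\<^sup>+s\<in>{0..T}. ennreal (f s) \<partial>lborel)"
  proof (rule nn_integral_mono)
    fix s
    show "(\<Sum>j<M. ennreal (C * E s) * indicator {l j..<r j} s) \<le> ennreal (f s) * indicator {0..T} s"
    proof (cases "\<exists>j<M. s \<in> {l j..<r j}")
      case False
      then have "(\<Sum>j<M. ennreal (C * E s) * indicator {l j..<r j} s) = 0" by (intro sum.neutral) auto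
      then show ?thesis by (simp only: zero_le)
    next
      case True
      then obtain j where j: "j < M" "s \<in> {l j..<r j}" by auto
      have fl: "floor_grid h s = real i * h" if "s \<in> {l i..<r i}" for i
        using that assms by (intro floor_grid_cell) (auto simp: l_def r_def algebra_simps)
      have unique: "i = j" if "s \<in> {l i..<r i}" for i
        using fl[OF that] fl[OF j(2)] assms by simp
      have ind: "indicator {l i..<r i} s = (if i = j then 1 else 0 :: ennreal)" for i
      proof (cases "i = j")
        case True
        then show ?thesis using j(2) by simp
      next
        case False
        then have "s \<notin> {l i..<r i}" using unique by blast
        then show ?thesis using False by simp
      qed
      have "(\<Sum>i<M. ennreal (C * E s) * indicator {l i..<r i} s) = (\<Sum>i<M. if i = j then ennreal (C * E s) else 0)"
        unfolding ind by (intro sum.cong) auto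
      also have "\<dots> = ennreal (C * E s)" using j by simp
      also have "\<dots> \<le> ennreal (f s)"
      proof (rule ennreal_leI)
        have "h / 2 \<le> s - floor_grid h s" unfolding fl[OF j(2)] using j(2) by (simp add: l_def)
        then have "\<mu> * (h / 2) \<le> \<mu> * (s - floor_grid h s)" using assms by (intro mult_left_mono) auto
        then have "C \<le> (1 - exp (- (\<mu> * (s - floor_grid h s))))\<^sup>2"
          unfolding C_def using assms by (intro power_mono) auto
        then show "C * E s \<le> f s"
          unfolding f_def temporal_error_factor E_def by (simp add: mult.commute)
      qed
      also have "\<dots> = ennreal (f s) * indicator {0..T} s"
      proof -
        have "real (Suc j) * h \<le> real M * h" using j(1) assms by (intro mult_right_mono) auto
        moreover have "0 \<le> l j" using assms by (simp add: l_def)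
        ultimately have "s \<in> {0..T}" using j(2) by (simp add: T r_def)
        then show ?thesis by simp
      qed
      finally show ?thesis .
    qed
  qed
  finally show ?thesis by (simp add: C_def f_def)
qed

section \<open>The mean square error as a sum over Fourier modes\<close>

lemma norm_sine_basis: "norm (sine_basis (Suc m)) = 1"
  using sine_basis_orthonormal[of m m] by (simp add: norm_eq_sqrt_inner)

lemma galerkin_proj_sine_basis:
  "galerkin_proj n (c *\<^sub>R sine_basis (Suc m)) = (if m < n then c else 0) *\<^sub>R sine_basis (Suc m)"
proof -
  have "galerkin_proj n (c *\<^sub>R sine_basis (Suc m))
      = (\<Sum>k<n. inner (sine_basis (Suc k)) (c *\<^sub>R sine_basis (Suc m)) *\<^sub>R sine_basis (Suc k))"
    unfolding galerkin_proj_def by (simp add: sum.atLeast1_atMost_eq)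
  also have "\<dots> = (\<Sum>k<n. if k = m then c *\<^sub>R sine_basis (Suc m) else 0)"
    by (intro sum.cong) (auto simp: sine_basis_orthonormal)
  finally show ?thesis by simp
qed

text \<open>
  The error operator is diagonal in the sine basis.
\<close>

lemma HS_norm_sq_error:
  assumes S: "is_exp_semigroup (dirichlet_laplacian \<nu>) S" and "0 \<le> r" "0 \<le> r'"
  shows "HS_norm_sq (\<lambda>v. S r v - galerkin_proj n (S r' v))
    = (\<Sum>m. ennreal ((exp (- (\<nu> * (real (Suc m) * pi)\<^sup>2) * r)
        - (if m < n then exp (- (\<nu> * (real (Suc m) * pi)\<^sup>2) * r') else 0))\<^sup>2))"
proof -
  have "(norm (S r (sine_basis (Suc m)) - galerkin_proj n (S r' (sine_basis (Suc m)))))\<^sup>2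
     = (exp (- (\<nu> * (real (Suc m) * pi)\<^sup>2) * r)
        - (if m < n then exp (- (\<nu> * (real (Suc m) * pi)\<^sup>2) * r') else 0))\<^sup>2" for m
    unfolding exp_semigroup_sine_basis[OF S \<open>0 \<le> r\<close>] exp_semigroup_sine_basis[OF S \<open>0 \<le> r'\<close>]
      galerkin_proj_sine_basis scaleR_diff_left[symmetric] norm_scaleR norm_sine_basis
    by simp
  then show ?thesis unfolding HS_norm_sq_def by simp
qed

text \<open>
  The Ito isometry for the difference of the two stochastic integrals, with the sum over the modes
  pulled out of the time integral by monotone convergence.
\<close>

lemma (in wiener) mean_square_error:
  assumes S: "is_exp_semigroup (dirichlet_laplacian \<nu>) S"
    and int1: "has_stochastic_integral \<PP> W t (\<lambda>s. S (t - s)) X"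
    and int2: "has_stochastic_integral \<PP> W t (\<lambda>s v. galerkin_proj n (S (t - floor_grid h s) v)) Y"
    and "0 < h" "t \<le> T"
  shows "(\<integral>\<^sup>+\<omega>. ennreal ((norm (X \<omega> - Y \<omega>))\<^sup>2) \<partial>\<PP>)
    = (\<Sum>m. \<integral>\<^sup>+s\<in>{0..t}. ennreal ((exp (- (\<nu> * (real (Suc m) * pi)\<^sup>2) * (t - s))
        - (if m < n then exp (- (\<nu> * (real (Suc m) * pi)\<^sup>2) * (t - floor_grid h s)) else 0))\<^sup>2) \<partial>lborel)"
proof -
  define f where "f m s = (exp (- (\<nu> * (real (Suc m) * pi)\<^sup>2) * (t - s))
        - (if m < n then exp (- (\<nu> * (real (Suc m) * pi)\<^sup>2) * (t - floor_grid h s)) else 0))\<^sup>2" for m s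
  note [measurable] = floor_grid_measurable[OF \<open>0 < h\<close>]
  have f_meas [measurable]: "f m \<in> borel_measurable borel" for m unfolding f_def by measurable
  have "(\<integral>\<^sup>+\<omega>. ennreal ((norm (X \<omega> - Y \<omega>))\<^sup>2) \<partial>\<PP>)
     = (\<integral>\<^sup>+s\<in>{0..t}. HS_norm_sq (\<lambda>v. S (t - s) v - galerkin_proj n (S (t - floor_grid h s) v)) \<partial>lborel)"
    by (rule ito_isometry_diff[OF int1 int2 \<open>t \<le> T\<close>])
  also have "\<dots> = (\<integral>\<^sup>+s. (\<Sum>m. ennreal (f m s) * indicator {0..t} s) \<partial>lborel)"
  proof (rule nn_integral_cong)
    fix s
    show "HS_norm_sq (\<lambda>v. S (t - s) v - galerkin_proj n (S (t - floor_grid h s) v)) * indicator {0..t} s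
      = (\<Sum>m. ennreal (f m s) * indicator {0..t} s)"
    proof (cases "s \<in> {0..t}")
      case True
      then have "0 \<le> t - s" "0 \<le> t - floor_grid h s"
        using floor_grid_bounds(1)[OF \<open>0 < h\<close>, of s] by auto
      from HS_norm_sq_error[OF S this] show ?thesis using True by (simp add: f_def)
    qed simp
  qed
  also have "\<dots> = (\<Sum>m. \<integral>\<^sup>+s\<in>{0..t}. ennreal (f m s) \<partial>lborel)"
    by (rule nn_integral_suminf) measurable
  finally show ?thesis by (simp add: f_def)
qed

lemma L2_norm_ge:
  assumes "0 \<le> x" "ennreal (x\<^sup>2) \<le> (\<integral>\<^sup>+\<omega>. ennreal ((norm (Z \<omega>))\<^sup>2) \<partial>M)"
  shows "ennreal x \<le> L2_norm M Z"
proof (cases "\<integral>\<^sup>+\<omega>. ennreal ((norm (Z \<omega>))\<^sup>2) \<partial>M")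
  case (real m)
  then have "x\<^sup>2 \<le> m" using assms by simp
  then have "x \<le> sqrt m" using real_le_rsqrt by blast
  then show ?thesis using real by (simp add: L2_norm_def Let_def)
qed (simp add: L2_norm_def)

lemma L2_norm_le:
  assumes "0 \<le> x" "(\<integral>\<^sup>+\<omega>. ennreal ((norm (Z \<omega>))\<^sup>2) \<partial>M) \<le> ennreal (x\<^sup>2)"
  shows "L2_norm M Z \<le> ennreal x"
proof (cases "\<integral>\<^sup>+\<omega>. ennreal ((norm (Z \<omega>))\<^sup>2) \<partial>M")
  case (real m)
  then have "m \<le> x\<^sup>2" using assms by simp
  then have "sqrt m \<le> x" using assms real_le_lsqrt by blast
  then show ?thesis using real assms by (simp add: L2_norm_def Let_def)
next
  case top
  then show ?thesis using assms by (simp add: top_unique)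
qed

section \<open>Two-sided error bounds\<close>

lemma power_quarter:
  assumes "1 \<le> (M::nat)"
  shows "(1 / real M powr (1/4))\<^sup>2 = 1 / sqrt (real M)"
proof -
  have "(real M powr (1/4))\<^sup>2 = real M powr (1/4 + 1/4)"
    unfolding power2_eq_square by (rule powr_add[symmetric])
  then show ?thesis using assms by (simp add: power_divide powr_half_sqrt)
qed

text \<open>
  By $p^2+q^2\le(p+q)^2$ it suffices to compare each part with the square of one summand.
\<close>

lemma sum_upper_bound:
  fixes T \<nu> :: real and M N :: nat
  assumes "0 < T" "0 < \<nu>" "1 \<le> M" "1 \<le> N"
  shows "(\<Sum>k=1..N. (min 1 (\<nu> * (real k * pi)\<^sup>2 * (T / real M)))\<^sup>2 / (2 * (\<nu> * (real k * pi)\<^sup>2)))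
      + (\<Sum>k=Suc N..n. 1 / (2 * (\<nu> * (real k * pi)\<^sup>2)))
    \<le> (1 / real M powr (1/4) * sqrt (sqrt T / 2 * (1 / (pi * sqrt \<nu>) + 1 / (\<nu> * pi\<^sup>2) + 4 * pi * sqrt \<nu>))
       + 1 / sqrt (real N) * (1 / (pi * sqrt (2 * \<nu>))))\<^sup>2"
    (is "?F + ?D \<le> (?P + ?Q)\<^sup>2")
proof -
  define a where "a = pi * sqrt \<nu>"
  have a: "0 < a" using assms by (simp add: a_def)
  have a_sq: "a\<^sup>2 = \<nu> * pi\<^sup>2" using assms by (simp add: a_def power_mult_distrib)
  have \<mu>: "\<nu> * (real k * pi)\<^sup>2 = (a * real k)\<^sup>2" for k
    by (simp add: a_sq power_mult_distrib)
  have "?F \<le> sqrt (T / real M) / 2 * (1 / a + 1 / a\<^sup>2 + 4 * a)"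
    unfolding \<mu> using assms by (intro temporal_sum_le a) auto
  also have "\<dots> = ?P\<^sup>2"
  proof -
    have eq: "sqrt T / 2 * (1 / (pi * sqrt \<nu>) + 1 / (\<nu> * pi\<^sup>2) + 4 * pi * sqrt \<nu>)
        = sqrt T / 2 * (1 / a + 1 / a\<^sup>2 + 4 * a)"
      unfolding a_sq by (simp add: a_def mult.assoc)
    have "0 \<le> sqrt T / 2 * (1 / a + 1 / a\<^sup>2 + 4 * a)" using a assms by simp
    then have "?P\<^sup>2 = 1 / sqrt (real M) * (sqrt T / 2 * (1 / a + 1 / a\<^sup>2 + 4 * a))"
      unfolding power_mult_distrib power_quarter[OF \<open>1 \<le> M\<close>] eq by (subst real_sqrt_pow2) auto
    then show ?thesis by (simp add: real_sqrt_divide)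
  qed
  finally have F: "?F \<le> ?P\<^sup>2" .
  have "?D = 1 / (2 * a\<^sup>2) * (\<Sum>k=Suc N..n. 1 / (real k)\<^sup>2)"
    unfolding \<mu> sum_distrib_left by (intro sum.cong refl) (simp add: power_mult_distrib)
  also have "\<dots> \<le> 1 / (2 * a\<^sup>2) * (1 / real N)"
    using assms by (intro mult_left_mono sum_inverse_squares_le) auto
  also have "\<dots> = ?Q\<^sup>2"
    using assms unfolding a_sq by (simp add: power_mult_distrib power_divide)
  finally have "?D \<le> ?Q\<^sup>2" .
  moreover have "0 \<le> ?P * ?Q"
    using a assms unfolding a_def by (intro mult_nonneg_nonneg real_sqrt_ge_zero add_nonneg_nonneg) auto
  ultimately show ?thesis using F unfolding power2_sum by linarith
qed

text \<open>
  Twice the square of each summand is bounded by one of the two parts. Stopping the spatial sum at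
  \<open>4 * N\<close> costs little: $1/(N+1)-1/(4N+1)\ge1/(4N)$, and $2q^2$ needs exactly $1/(4N)$.
\<close>

lemma sum_lower_bound:
  fixes T \<nu> :: real and M N :: nat
  assumes "0 < T" "0 < \<nu>" "1 \<le> M" "1 \<le> N"
  shows "(1 / real M powr (1/4) *
         sqrt (integral
           {0..max 0 (T * (real N + 1)\<^sup>2 / (2 * real M) - (1 + sqrt T / sqrt (2 * real M))\<^sup>2)}
           (\<lambda>x. sqrt T * (1 - exp (- \<nu> * pi\<^sup>2 * T))
                * (1 - exp (- \<nu> * pi\<^sup>2 * min 1 (T * (real N)\<^sup>2 / (2 * real M))))\<^sup>2
                / (32 * \<nu> * pi\<^sup>2 * sqrt 2 * (x + (1 + sqrt T)\<^sup>2) powr (3/2))))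
       + 1 / sqrt (real N) * (sqrt (1 - exp (- \<nu> * T)) / (4 * pi * sqrt \<nu>)))\<^sup>2
    \<le> (\<Sum>k=1..N. (1 - exp (- (\<nu> * (real k * pi)\<^sup>2 * (T / real M / 2))))\<^sup>2
          * (1 - exp (- (2 * (\<nu> * (real k * pi)\<^sup>2) * T))) / (4 * (\<nu> * (real k * pi)\<^sup>2)))
      + (\<Sum>k=Suc N..4*N. (1 - exp (- (2 * (\<nu> * (real k * pi)\<^sup>2) * T))) / (2 * (\<nu> * (real k * pi)\<^sup>2)))"
    (is "(?p * sqrt ?I + ?Q)\<^sup>2 \<le> ?F + ?D")
    and "0 \<le> 1 / real M powr (1/4) *
         sqrt (integral
           {0..max 0 (T * (real N + 1)\<^sup>2 / (2 * real M) - (1 + sqrt T / sqrt (2 * real M))\<^sup>2)}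
           (\<lambda>x. sqrt T * (1 - exp (- \<nu> * pi\<^sup>2 * T))
                * (1 - exp (- \<nu> * pi\<^sup>2 * min 1 (T * (real N)\<^sup>2 / (2 * real M))))\<^sup>2
                / (32 * \<nu> * pi\<^sup>2 * sqrt 2 * (x + (1 + sqrt T)\<^sup>2) powr (3/2))))
       + 1 / sqrt (real N) * (sqrt (1 - exp (- \<nu> * T)) / (4 * pi * sqrt \<nu>))"
proof -
  define c where "c = \<nu> * pi\<^sup>2"
  have c: "0 < c" using assms by (simp add: c_def)
  have \<mu>: "\<nu> * (real k * pi)\<^sup>2 = c * (real k)\<^sup>2" for k
    by (simp add: c_def power_mult_distrib)
  have I: "?I = integral {0..max 0 (T * (real N + 1)\<^sup>2 / (2 * real M) - (1 + sqrt T / sqrt (2 * real M))\<^sup>2)}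
      (\<lambda>x. sqrt T * (1 - exp (- c * T))
        * (1 - exp (- c * min 1 (T * (real N)\<^sup>2 / (2 * real M))))\<^sup>2
        / (32 * c * sqrt 2 * (x + (1 + sqrt T)\<^sup>2) powr (3/2)))"
    by (simp add: c_def mult.assoc)
  have I_nonneg: "0 \<le> ?I"
    unfolding I by (rule temporal_lower_bound(2)[OF c \<open>0 < T\<close> \<open>1 \<le> M\<close>])
  have Q_nonneg: "0 \<le> ?Q" using assms by simp
  show "0 \<le> ?p * sqrt ?I + ?Q"
    by (intro add_nonneg_nonneg[OF _ Q_nonneg] mult_nonneg_nonneg real_sqrt_ge_zero I_nonneg) auto
  have decay: "c \<le> 2 * (c * (real k)\<^sup>2)" if "1 \<le> k" for k
  proof -
    have "1 \<le> (real k)\<^sup>2" using that by simp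
    then have "c * 1 \<le> c * (real k)\<^sup>2" using c by (intro mult_left_mono) auto
    then show ?thesis using c by linarith
  qed
  have "2 * (?p * sqrt ?I)\<^sup>2 = 2 / sqrt (real M) * ?I"
    unfolding power_mult_distrib power_quarter[OF \<open>1 \<le> M\<close>] using I_nonneg by simp
  also have "\<dots> \<le> (\<Sum>k=1..N. (1 - exp (- (c * (real k)\<^sup>2 * (T / (2 * real M)))))\<^sup>2 * (1 - exp (- c * T)) / (4 * (c * (real k)\<^sup>2)))"
    unfolding I by (rule temporal_lower_bound(1)[OF c \<open>0 < T\<close> \<open>1 \<le> M\<close>])
  also have "\<dots> \<le> ?F"
    unfolding \<mu>
  proof (intro sum_mono divide_right_mono)
    fix k assume k: "k \<in> {1..N}"
    have half: "T / (2 * real M) = T / real M / 2" by simp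
    have "c * T \<le> 2 * (c * (real k)\<^sup>2) * T"
      using decay[of k] k assms by (intro mult_right_mono) auto
    then show "(1 - exp (- (c * (real k)\<^sup>2 * (T / (2 * real M)))))\<^sup>2 * (1 - exp (- c * T))
        \<le> (1 - exp (- (c * (real k)\<^sup>2 * (T / real M / 2))))\<^sup>2 * (1 - exp (- (2 * (c * (real k)\<^sup>2) * T)))"
      unfolding half using c assms by (intro mult_mono) auto
  qed (use c in auto)
  finally have F: "2 * (?p * sqrt ?I)\<^sup>2 \<le> ?F" .
  define \<theta> where "\<theta> = 1 - exp (- \<nu> * T)"
  have \<theta>: "0 \<le> \<theta>" using assms by (simp add: \<theta>_def)
  have "2 * ?Q\<^sup>2 = \<theta> / (8 * c * real N)"
    using \<theta> assms unfolding \<theta>_def[symmetric] by (simp add: c_def power_mult_distrib power_divide)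
  also have "\<dots> \<le> \<theta> / (2 * c) * (1 / real (Suc N) - 1 / (real (4 * N) + 1))"
  proof -
    have "1 / (2 * real N) \<le> 1 / real (Suc N)" using assms by (intro frac_le) auto
    moreover have "1 / (real (4 * N) + 1) \<le> 1 / (4 * real N)" using assms by (intro frac_le) auto
    moreover have "1 / (2 * real N) - 1 / (4 * real N) = 1 / (4 * real N)" by (simp add: field_simps)
    ultimately have "1 / (4 * real N) \<le> 1 / real (Suc N) - 1 / (real (4 * N) + 1)" by linarith
    then have "\<theta> / (2 * c) * (1 / (4 * real N)) \<le> \<theta> / (2 * c) * (1 / real (Suc N) - 1 / (real (4 * N) + 1))"
      using c \<theta> by (intro mult_left_mono) auto
    then show ?thesis by (simp add: mult_ac)
  qed
  also have "\<dots> \<le> \<theta> / (2 * c) * (\<Sum>k=Suc N..4*N. 1 / (real k)\<^sup>2)"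
    using c \<theta> by (intro mult_left_mono sum_inverse_squares_ge) auto
  also have "\<dots> = (\<Sum>k=Suc N..4*N. \<theta> / (2 * (c * (real k)\<^sup>2)))"
    unfolding sum_distrib_left by (intro sum.cong refl) simp
  also have "\<dots> \<le> ?D"
    unfolding \<mu>
  proof (intro sum_mono divide_right_mono)
    fix k assume k: "k \<in> {Suc N..4*N}"
    have "\<nu> * 1 \<le> \<nu> * pi\<^sup>2" using assms pi_ge_two by (intro mult_left_mono) (auto intro!: one_le_power)
    then have "\<nu> \<le> 2 * (c * (real k)\<^sup>2)" using decay[of k] k by (simp add: c_def)
    then have "\<nu> * T \<le> 2 * (c * (real k)\<^sup>2) * T" using assms by (intro mult_right_mono) auto
    then show "\<theta> \<le> 1 - exp (- (2 * (c * (real k)\<^sup>2) * T))" by (simp add: \<theta>_def)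
  qed (use c in auto)
  finally have D: "2 * ?Q\<^sup>2 \<le> ?D" .
  have "(?p * sqrt ?I + ?Q)\<^sup>2 \<le> 2 * (?p * sqrt ?I)\<^sup>2 + 2 * ?Q\<^sup>2"
    using sum_squares_bound[of "?p * sqrt ?I" ?Q] unfolding power2_sum by linarith
  then show "(?p * sqrt ?I + ?Q)\<^sup>2 \<le> ?F + ?D" using F D by linarith
qed

text \<open>
  Modes are summed from index \<open>0\<close> in the series, but numbered from \<open>1\<close> in the bounds.
\<close>

lemma sum_Suc_split:
  fixes f g :: "nat \<Rightarrow> 'a::comm_monoid_add"
  assumes "N \<le> n"
  shows "(\<Sum>m<n. if m < N then f (Suc m) else g (Suc m)) = (\<Sum>k=1..N. f k) + (\<Sum>k=Suc N..n. g k)"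
proof -
  have "(\<Sum>m<n. if m < N then f (Suc m) else g (Suc m))
      = (\<Sum>m<N. if m < N then f (Suc m) else g (Suc m)) + (\<Sum>m=N..<n. if m < N then f (Suc m) else g (Suc m))"
    using assms by (simp only: lessThan_atLeast0 sum.atLeastLessThan_concat[of 0 N n] le0)
  also have "(\<Sum>m<N. if m < N then f (Suc m) else g (Suc m)) = (\<Sum>k=1..N. f k)"
    by (simp add: sum.atLeast1_atMost_eq)
  also have "(\<Sum>m=N..<n. if m < N then f (Suc m) else g (Suc m)) = (\<Sum>k=Suc N..n. g k)"
    by (simp flip: sum.shift_bounds_Suc_ivl atLeastLessThanSuc_atLeastAtMost)
  finally show ?thesis .
qed

theorem corollary7p7:
  fixes T \<nu> :: real
    and \<PP> :: "'w measure"
    and W :: "real \<Rightarrow> l2 \<Rightarrow> 'w \<Rightarrow> real"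
    and S :: "real \<Rightarrow> l2 \<Rightarrow> l2"
    and O0 :: "real \<Rightarrow> 'w \<Rightarrow> l2"
    and \<O> :: "nat \<Rightarrow> nat \<Rightarrow> real \<Rightarrow> 'w \<Rightarrow> l2"
    and M N :: nat
  assumes "T > 0" and "\<nu> > 0"
    and "is_exp_semigroup (dirichlet_laplacian \<nu>) S"
    and "prob_space \<PP>"
    and "cylindrical_wiener \<PP> T W"
    and "\<And>t. t \<in> {0..T} \<Longrightarrow> O0 t \<in> borel_measurable \<PP>"
    and "\<And>m n t. m \<ge> 1 \<Longrightarrow> n \<ge> 1 \<Longrightarrow> t \<in> {0..T} \<Longrightarrow> \<O> m n t \<in> borel_measurable \<PP>"
    and "\<And>t. t \<in> {0..T} \<Longrightarrow>
           has_stochastic_integral \<PP> W t (\<lambda>s. S (t - s)) (O0 t)"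
    and "\<And>m n t. m \<ge> 1 \<Longrightarrow> n \<ge> 1 \<Longrightarrow> t \<in> {0..T} \<Longrightarrow>
           has_stochastic_integral \<PP> W t
             (\<lambda>s v. galerkin_proj n (S (t - floor_grid (T / real m) s) v)) (\<O> m n t)"
    and "M \<ge> 1" and "N \<ge> 1"
  shows "ennreal
      (1 / real M powr (1/4) *
         sqrt (integral
           {0..max 0 (T * (real N + 1)\<^sup>2 / (2 * real M) - (1 + sqrt T / sqrt (2 * real M))\<^sup>2)}
           (\<lambda>x. sqrt T * (1 - exp (- \<nu> * pi\<^sup>2 * T))
                * (1 - exp (- \<nu> * pi\<^sup>2 * min 1 (T * (real N)\<^sup>2 / (2 * real M))))\<^sup>2
                / (32 * \<nu> * pi\<^sup>2 * sqrt 2 * (x + (1 + sqrt T)\<^sup>2) powr (3/2))))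
       + 1 / sqrt (real N) * (sqrt (1 - exp (- \<nu> * T)) / (4 * pi * sqrt \<nu>)))
      \<le> L2_norm \<PP> (\<lambda>\<omega>. O0 T \<omega> - \<O> M N T \<omega>)
    \<and> L2_norm \<PP> (\<lambda>\<omega>. O0 T \<omega> - \<O> M N T \<omega>)
      \<le> (SUP t\<in>{0..T}. L2_norm \<PP> (\<lambda>\<omega>. O0 t \<omega> - \<O> M N t \<omega>))
    \<and> (SUP t\<in>{0..T}. L2_norm \<PP> (\<lambda>\<omega>. O0 t \<omega> - \<O> M N t \<omega>))
      \<le> ennreal
      (1 / real M powr (1/4) *
         sqrt (sqrt T / 2 * (1 / (pi * sqrt \<nu>) + 1 / (\<nu> * pi\<^sup>2) + 4 * pi * sqrt \<nu>))
       + 1 / sqrt (real N) * (1 / (pi * sqrt (2 * \<nu>))))"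
proof -
  let ?lower = "(1 / real M powr (1/4) *
         sqrt (integral
           {0..max 0 (T * (real N + 1)\<^sup>2 / (2 * real M) - (1 + sqrt T / sqrt (2 * real M))\<^sup>2)}
           (\<lambda>x. sqrt T * (1 - exp (- \<nu> * pi\<^sup>2 * T))
                * (1 - exp (- \<nu> * pi\<^sup>2 * min 1 (T * (real N)\<^sup>2 / (2 * real M))))\<^sup>2
                / (32 * \<nu> * pi\<^sup>2 * sqrt 2 * (x + (1 + sqrt T)\<^sup>2) powr (3/2))))
       + 1 / sqrt (real N) * (sqrt (1 - exp (- \<nu> * T)) / (4 * pi * sqrt \<nu>)))"
  let ?upper = "(1 / real M powr (1/4) *
         sqrt (sqrt T / 2 * (1 / (pi * sqrt \<nu>) + 1 / (\<nu> * pi\<^sup>2) + 4 * pi * sqrt \<nu>))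
       + 1 / sqrt (real N) * (1 / (pi * sqrt (2 * \<nu>))))"
  define h where "h = T / real M"
  define \<mu> where "\<mu> k = \<nu> * (real k * pi)\<^sup>2" for k
  define f where "f t m = (\<integral>\<^sup>+s\<in>{0..t}. ennreal ((exp (- \<mu> (Suc m) * (t - s))
        - (if m < N then exp (- \<mu> (Suc m) * (t - floor_grid h s)) else 0))\<^sup>2) \<partial>lborel)" for t m
  have h: "0 < h" "T = real M * h" using assms by (simp_all add: h_def)
  have \<mu>: "0 < \<mu> (Suc m)" for m using assms by (simp add: \<mu>_def)
  interpret wiener \<PP> T W
    using assms by (simp add: wiener_def wiener_axioms_def)
  have error: "(\<integral>\<^sup>+\<omega>. ennreal ((norm (O0 t \<omega> - \<O> M N t \<omega>))\<^sup>2) \<partial>\<PP>) = (\<Sum>m. f t m)" if "t \<in> {0..T}" for t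
    unfolding f_def \<mu>_def h_def
    by (rule mean_square_error[OF assms(3)]) (use assms that in auto)
  have lower: "ennreal ?lower \<le> L2_norm \<PP> (\<lambda>\<omega>. O0 T \<omega> - \<O> M N T \<omega>)"
  proof (rule L2_norm_ge)
    show "0 \<le> ?lower" by (rule sum_lower_bound(2)) (use assms in auto)
    have mode: "ennreal (if m < N then (1 - exp (- (\<mu> (Suc m) * (h / 2))))\<^sup>2 * (1 - exp (- (2 * \<mu> (Suc m) * T))) / (4 * \<mu> (Suc m))
         else (1 - exp (- (2 * \<mu> (Suc m) * T))) / (2 * \<mu> (Suc m))) \<le> f T m" for m
      using temporal_mode_ge[OF \<mu> h, of m] spatial_mode[OF \<mu>, of T m] assms by (simp add: f_def)
    have "ennreal (?lower\<^sup>2) \<le> ennreal (\<Sum>m<4*N. if m < N then (1 - exp (- (\<mu> (Suc m) * (h / 2))))\<^sup>2 * (1 - exp (- (2 * \<mu> (Suc m) * T))) / (4 * \<mu> (Suc m))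
         else (1 - exp (- (2 * \<mu> (Suc m) * T))) / (2 * \<mu> (Suc m)))"
    proof (rule ennreal_leI, subst sum_Suc_split)
      show "?lower\<^sup>2 \<le> (\<Sum>k=1..N. (1 - exp (- (\<mu> k * (h / 2))))\<^sup>2 * (1 - exp (- (2 * \<mu> k * T))) / (4 * \<mu> k))
        + (\<Sum>k=Suc N..4*N. (1 - exp (- (2 * \<mu> k * T))) / (2 * \<mu> k))"
        unfolding \<mu>_def h_def by (rule sum_lower_bound(1)) (use assms in auto)
    qed simp
    also have "\<dots> = (\<Sum>m<4*N. ennreal (if m < N then (1 - exp (- (\<mu> (Suc m) * (h / 2))))\<^sup>2 * (1 - exp (- (2 * \<mu> (Suc m) * T))) / (4 * \<mu> (Suc m))
         else (1 - exp (- (2 * \<mu> (Suc m) * T))) / (2 * \<mu> (Suc m))))"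
      using \<mu> assms by (intro sum_ennreal[symmetric]) (auto intro!: divide_nonneg_pos mult_nonneg_nonneg simp: less_imp_le)
    also have "\<dots> \<le> (\<Sum>m<4*N. f T m)" by (intro sum_mono mode)
    also have "\<dots> \<le> (\<Sum>m. f T m)" by (intro sum_le_suminf) auto
    finally show "ennreal (?lower\<^sup>2) \<le> (\<integral>\<^sup>+\<omega>. ennreal ((norm (O0 T \<omega> - \<O> M N T \<omega>))\<^sup>2) \<partial>\<PP>)"
      using error[of T] assms by simp
  qed
  have upper: "L2_norm \<PP> (\<lambda>\<omega>. O0 t \<omega> - \<O> M N t \<omega>) \<le> ennreal ?upper" if t: "t \<in> {0..T}" for t
  proof (rule L2_norm_le)
    show "0 \<le> ?upper" using assms by (intro add_nonneg_nonneg mult_nonneg_nonneg real_sqrt_ge_zero) auto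
    define u where "u m = (if m < N then (min 1 (\<mu> (Suc m) * h))\<^sup>2 / (2 * \<mu> (Suc m)) else 1 / (2 * \<mu> (Suc m)))" for m
    have mode: "f t m \<le> ennreal (u m)" for m
    proof (cases "m < N")
      case True
      then show ?thesis using temporal_mode_le[OF \<mu> h(1), of t m] t by (simp add: f_def u_def)
    next
      case False
      have "ennreal ((1 - exp (- (2 * \<mu> (Suc m) * t))) / (2 * \<mu> (Suc m))) \<le> ennreal (1 / (2 * \<mu> (Suc m)))"
        using \<mu>[of m] by (intro ennreal_leI divide_right_mono) auto
      then show ?thesis using False spatial_mode[OF \<mu>, of t m] t by (simp add: f_def u_def)
    qed
    have u_nonneg: "0 \<le> u m" for m using \<mu>[of m] by (simp add: u_def)
    have "(\<Sum>m. f t m) \<le> ennreal (?upper\<^sup>2)"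
    proof (rule suminf_le_const)
      fix n
      have "(\<Sum>m<n. f t m) \<le> (\<Sum>m<n. ennreal (u m))" by (intro sum_mono mode)
      also have "\<dots> = ennreal (\<Sum>m<n. u m)" by (intro sum_ennreal u_nonneg)
      also have "\<dots> \<le> ennreal (\<Sum>m<N+n. u m)"
        using u_nonneg by (intro ennreal_leI sum_mono2) auto
      also have "\<dots> \<le> ennreal (?upper\<^sup>2)"
        unfolding u_def
      proof (rule ennreal_leI, subst sum_Suc_split)
        show "(\<Sum>k=1..N. (min 1 (\<mu> k * h))\<^sup>2 / (2 * \<mu> k)) + (\<Sum>k=Suc N..N+n. 1 / (2 * \<mu> k)) \<le> ?upper\<^sup>2"
          unfolding \<mu>_def h_def by (rule sum_upper_bound) (use assms in auto)
      qed simp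
      finally show "(\<Sum>m<n. f t m) \<le> ennreal (?upper\<^sup>2)" .
    qed simp
    then show "(\<integral>\<^sup>+\<omega>. ennreal ((norm (O0 t \<omega> - \<O> M N t \<omega>))\<^sup>2) \<partial>\<PP>) \<le> ennreal (?upper\<^sup>2)"
      using error[OF t] by simp
  qed
  show ?thesis
    using lower upper assms(1) by (intro conjI SUP_upper SUP_least) auto
qed

end
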